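(* Let $d, n \ge 1$ be integers, let $A_1,\dots,A_d$ be constant Hermitian $n\times n$ complex matrices, and let $V$ be a locally bounded function on $\mathbb{R}^d$ with values in the Hermitian $n\times n$ matrices. Consider the operator $$H=-i\sum_{j=1}^{d} A_j\frac{\partial}{\partial x_j}+V(x)$$ in the space $L_2(\mathbb{R}^d;\mathbb{C}^n)$, with derivatives understood in the sense of distributions, and suppose that $H$ is selfadjoint on a domain $\mathcal{D}(H)\subset L_2(\mathbb{R}^d;\mathbb{C}^n)$ with the following two properties: (1) if $f\in L_2(\mathbb{R}^d;\mathbb{C}^n)$ has compact support and $\sum_{j=1}^d A_j\,\partial f/\partial x_j\in L_2(\mathbb{R}^d;\mathbb{C}^n)$, then $f\in\mathcal{D}(H)$; (2) if $f\in\mathcal{D}(H)$, then $\sum_{j=1}^d A_j\,\partial f/\partial x_j\in L_2^{(loc)}(\mathbb{R}^d;\mathbb{C}^n)$. Set $$\gamma=\max_{|x|=1}\Big\|\sum_{j=1}^d A_j x_j\Big\|,\qquad d(\lambda)=\operatorname{dist}\{\lambda,\sigma_{ess}(H)\}.$$ If $\psi\in\mathcal{D}(H)$ and $H\psi=\lambda\psi$, then $$\int_{\mathbb{R}^d}|\psi(x)|^2e^{2\delta|x|}\,dx<\infty\qquad\text{for all }\delta<\gamma^{-1}d(\lambda).$$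
   Context: In the definition of $\gamma$, the maximum is over unit vectors $x=(x_1,\dots,x_d)\in\mathbb{R}^d$ and $\|\cdot\|$ is the operator norm of an $n\times n$ matrix acting in $\mathbb{C}^n$ with its Euclidean norm; $|\psi(x)|$ is the Euclidean norm of $\psi(x)$ in $\mathbb{C}^n$. $\sigma_{ess}(H)$ is the essential spectrum of the selfadjoint operator $H$. The eigenvalue $\lambda$ is allowed to lie in a gap of $\sigma_{ess}(H)$. Neither ellipticity of $H$ nor boundedness of $V$ at infinity is assumed. *)

theory Defs
  imports "HOL-Analysis.Analysis"
begin

section \<open>Square integrable vector fields\<close>

text \<open>
  Elements of \<open>L\<^sub>2(\<real>\<^sup>d; \<complex>\<^sup>n)\<close> are handled through representatives: Lebesgue measurable functions,
  with equality almost everywhere in place of equality.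
\<close>

type_synonym ('d, 'n) field = "real ^ 'd \<Rightarrow> complex ^ 'n"

abbreviation ae_eq :: "('d::finite, 'n::finite) field \<Rightarrow> ('d, 'n) field \<Rightarrow> bool"
  where "ae_eq f g \<equiv> (AE x in lebesgue. f x = g x)"

definition L2 :: "('d::finite, 'n::finite) field set"
  where "L2 = {f. f \<in> borel_measurable lebesgue \<and> integrable lebesgue (\<lambda>x. (norm (f x))\<^sup>2)}"

definition L2_loc :: "('d::finite, 'n::finite) field set"
  where "L2_loc = {f. f \<in> borel_measurable lebesgue \<and>
           (\<forall>K. compact K \<longrightarrow> set_integrable lebesgue K (\<lambda>x. (norm (f x))\<^sup>2))}"

definition L1_loc :: "('d::finite, 'n::finite) field set"
  where "L1_loc = {f. f \<in> borel_measurable lebesgue \<and>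
           (\<forall>K. compact K \<longrightarrow> set_integrable lebesgue K f)}"

definition L2_norm :: "('d::finite, 'n::finite) field \<Rightarrow> real"
  where "L2_norm f = sqrt (\<integral>x. (norm (f x))\<^sup>2 \<partial>lebesgue)"

definition L2_inner :: "('d::finite, 'n::finite) field \<Rightarrow> ('d, 'n) field \<Rightarrow> complex"
  where "L2_inner f g = (\<integral>x. (\<Sum>k\<in>UNIV. f x $ k * cnj (g x $ k)) \<partial>lebesgue)"

text \<open>Compact support of an equivalence class, hence up to a null set.\<close>

definition compactly_supported :: "('d::finite, 'n::finite) field \<Rightarrow> bool"
  where "compactly_supported f \<longleftrightarrow> (\<exists>K. compact K \<and> (AE x in lebesgue. x \<notin> K \<longrightarrow> f x = 0))"


section \<open>Distributional derivatives\<close>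

definition partial_deriv :: "'d::finite \<Rightarrow> (real ^ 'd \<Rightarrow> real) \<Rightarrow> real ^ 'd \<Rightarrow> real"
  where "partial_deriv j \<phi> x = frechet_derivative \<phi> (at x) (axis j 1)"

fun times_differentiable :: "nat \<Rightarrow> (real ^ 'd::finite \<Rightarrow> real) \<Rightarrow> bool"
  where
    "times_differentiable 0 \<phi> \<longleftrightarrow> continuous_on UNIV \<phi>"
  | "times_differentiable (Suc k) \<phi> \<longleftrightarrow>
       (\<forall>x. \<phi> differentiable (at x)) \<and> (\<forall>j. times_differentiable k (partial_deriv j \<phi>))"

text \<open>
  \<open>C\<^sub>c\<^sup>\<infinity>\<close>. Real-valued test functions suffice: a distribution is determined by its values on them,
  by complex linearity.
\<close>

definition test_functions :: "(real ^ 'd::finite \<Rightarrow> real) set"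
  where "test_functions = {\<phi>. (\<forall>k. times_differentiable k \<phi>) \<and>
           (\<exists>K. compact K \<and> (\<forall>x. x \<notin> K \<longrightarrow> \<phi> x = 0))}"

definition regular_distr :: "('d::finite, 'n::finite) field \<Rightarrow> (real ^ 'd \<Rightarrow> real) \<Rightarrow> complex ^ 'n"
  where "regular_distr f \<phi> = (\<integral>x. \<phi> x *\<^sub>R f x \<partial>lebesgue)"

definition distr_deriv ::
    "'d::finite \<Rightarrow> ('d, 'n::finite) field \<Rightarrow> (real ^ 'd \<Rightarrow> real) \<Rightarrow> complex ^ 'n"
  where "distr_deriv j f \<phi> = - regular_distr f (partial_deriv j \<phi>)"

text \<open>
  The distribution \<open>\<Sum>\<^sub>j A\<^sub>j \<partial>f/\<partial>x\<^sub>j\<close> is the locally integrable function \<open>g\<close>. The individual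
  derivatives \<open>\<partial>f/\<partial>x\<^sub>j\<close> need not be functions.
\<close>

definition is_symbol_deriv ::
    "('d::finite \<Rightarrow> complex ^ 'n ^ 'n::finite) \<Rightarrow> ('d, 'n) field \<Rightarrow> ('d, 'n) field \<Rightarrow> bool"
  where "is_symbol_deriv A f g \<longleftrightarrow> f \<in> L1_loc \<and> g \<in> L1_loc \<and>
           (\<forall>\<phi>\<in>test_functions. (\<Sum>j\<in>UNIV. A j *v distr_deriv j f \<phi>) = regular_distr g \<phi>)"

text \<open>
  The differential expression \<open>-i \<Sum>\<^sub>j A\<^sub>j \<partial>f/\<partial>x\<^sub>j + V f\<close>. It is meaningful only if
  \<open>\<Sum>\<^sub>j A\<^sub>j \<partial>f/\<partial>x\<^sub>j\<close> is a locally integrable function, which is then unique up to a null set.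
\<close>

definition first_order_op ::
    "('d::finite \<Rightarrow> complex ^ 'n ^ 'n::finite) \<Rightarrow> (real ^ 'd \<Rightarrow> complex ^ 'n ^ 'n) \<Rightarrow>
     ('d, 'n) field \<Rightarrow> ('d, 'n) field"
  where "first_order_op A V f =
           (\<lambda>x. (- \<i>) *s (SOME g. is_symbol_deriv A f g) x + V x *v f x)"


section \<open>Matrices\<close>

definition hermitian :: "complex ^ 'n ^ 'n::finite \<Rightarrow> bool"
  where "hermitian M \<longleftrightarrow> (\<forall>i j. M $ i $ j = cnj (M $ j $ i))"

text \<open>Measurability is tacit when \<open>V\<close> acts as a multiplication operator in \<open>L\<^sub>2\<close>.\<close>

definition locally_bounded :: "(real ^ 'd::finite \<Rightarrow> complex ^ 'n ^ 'n::finite) \<Rightarrow> bool"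
  where "locally_bounded V \<longleftrightarrow>
           V \<in> borel_measurable lebesgue \<and> (\<forall>K. compact K \<longrightarrow> bounded (V ` K))"

text \<open>The supremum is a maximum, since the unit sphere is compact.\<close>

definition max_speed :: "('d::finite \<Rightarrow> complex ^ 'n ^ 'n::finite) \<Rightarrow> real"
  where "max_speed A = (SUP x\<in>sphere (0 :: real ^ 'd) 1. onorm ((*v) (\<Sum>j\<in>UNIV. x $ j *\<^sub>R A j)))"


section \<open>Unbounded operators in \<open>L\<^sub>2\<close>\<close>

text \<open>
  An operator is given by its domain \<open>D\<close>, a set of representatives saturated under equality almost
  everywhere, and its action \<open>T\<close> on representatives, whose values outside \<open>D\<close> are irrelevant.
\<close>

definition L2_operator ::
    "('d::finite, 'n::finite) field set \<Rightarrow> (('d, 'n) field \<Rightarrow> ('d, 'n) field) \<Rightarrow> bool"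
  where "L2_operator D T \<longleftrightarrow>
    D \<subseteq> L2 \<and>
    (\<lambda>x. 0) \<in> D \<and>
    (\<forall>f\<in>D. \<forall>g\<in>D. (\<lambda>x. f x + g x) \<in> D) \<and>
    (\<forall>f\<in>D. \<forall>c. (\<lambda>x. c *s f x) \<in> D) \<and>
    (\<forall>f\<in>D. \<forall>g\<in>L2. ae_eq f g \<longrightarrow> g \<in> D) \<and>
    (\<forall>f\<in>D. T f \<in> L2) \<and>
    (\<forall>f\<in>D. \<forall>g\<in>D. ae_eq f g \<longrightarrow> ae_eq (T f) (T g)) \<and>
    (\<forall>f\<in>D. \<forall>g\<in>D. ae_eq (T (\<lambda>x. f x + g x)) (\<lambda>x. T f x + T g x)) \<and>
    (\<forall>f\<in>D. \<forall>c. ae_eq (T (\<lambda>x. c *s f x)) (\<lambda>x. c *s T f x))"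

definition L2_dense :: "('d::finite, 'n::finite) field set \<Rightarrow> bool"
  where "L2_dense D \<longleftrightarrow> (\<forall>f\<in>L2. \<forall>\<epsilon>>0. \<exists>g\<in>D. L2_norm (\<lambda>x. f x - g x) < \<epsilon>)"

text \<open>The graph of the adjoint of a densely defined operator.\<close>

definition adjoint_graph ::
    "('d::finite, 'n::finite) field set \<Rightarrow> (('d, 'n) field \<Rightarrow> ('d, 'n) field) \<Rightarrow>
     (('d, 'n) field \<times> ('d, 'n) field) set"
  where "adjoint_graph D T =
    {(f, h). f \<in> L2 \<and> h \<in> L2 \<and> (\<forall>g\<in>D. L2_inner (T g) f = L2_inner g h)}"

definition selfadjoint_on ::
    "('d::finite, 'n::finite) field set \<Rightarrow> (('d, 'n) field \<Rightarrow> ('d, 'n) field) \<Rightarrow> bool"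
  where "selfadjoint_on D T \<longleftrightarrow> L2_operator D T \<and> L2_dense D \<and>
    adjoint_graph D T = {(f, h). f \<in> D \<and> h \<in> L2 \<and> ae_eq (T f) h}"

text \<open>The estimate says that \<open>T - z\<close> is injective with bounded inverse.\<close>

definition resolvent_set ::
    "('d::finite, 'n::finite) field set \<Rightarrow> (('d, 'n) field \<Rightarrow> ('d, 'n) field) \<Rightarrow> complex set"
  where "resolvent_set D T = {z.
    (\<forall>h\<in>L2. \<exists>f\<in>D. ae_eq (\<lambda>x. T f x - z *s f x) h) \<and>
    (\<exists>C. \<forall>f\<in>D. L2_norm f \<le> C * L2_norm (\<lambda>x. T f x - z *s f x))}"

definition op_spectrum ::
    "('d::finite, 'n::finite) field set \<Rightarrow> (('d, 'n) field \<Rightarrow> ('d, 'n) field) \<Rightarrow> complex set"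
  where "op_spectrum D T = - resolvent_set D T"

definition eigenspace ::
    "('d::finite, 'n::finite) field set \<Rightarrow> (('d, 'n) field \<Rightarrow> ('d, 'n) field) \<Rightarrow> complex \<Rightarrow>
     ('d, 'n) field set"
  where "eigenspace D T z = {f \<in> D. ae_eq (T f) (\<lambda>x. z *s f x)}"

definition is_eigenvalue ::
    "('d::finite, 'n::finite) field set \<Rightarrow> (('d, 'n) field \<Rightarrow> ('d, 'n) field) \<Rightarrow> complex \<Rightarrow> bool"
  where "is_eigenvalue D T z \<longleftrightarrow> (\<exists>f\<in>eigenspace D T z. \<not> ae_eq f (\<lambda>x. 0))"

definition finite_multiplicity ::
    "('d::finite, 'n::finite) field set \<Rightarrow> (('d, 'n) field \<Rightarrow> ('d, 'n) field) \<Rightarrow> complex \<Rightarrow> bool"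
  where "finite_multiplicity D T z \<longleftrightarrow>
    (\<exists>B. finite B \<and> B \<subseteq> eigenspace D T z \<and>
      (\<forall>f\<in>eigenspace D T z. \<exists>c. ae_eq f (\<lambda>x. \<Sum>b\<in>B. c b *s b x)))"

definition discrete_spectrum ::
    "('d::finite, 'n::finite) field set \<Rightarrow> (('d, 'n) field \<Rightarrow> ('d, 'n) field) \<Rightarrow> complex set"
  where "discrete_spectrum D T =
    {z. z isolated_in op_spectrum D T \<and> is_eigenvalue D T z \<and> finite_multiplicity D T z}"

definition essential_spectrum ::
    "('d::finite, 'n::finite) field set \<Rightarrow> (('d, 'n) field \<Rightarrow> ('d, 'n) field) \<Rightarrow> complex set"
  where "essential_spectrum D T = op_spectrum D T - discrete_spectrum D T"

text \<open>Extended-real valued, so that the distance to the empty set is \<open>\<infinity>\<close>.\<close>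

definition edist_set :: "complex \<Rightarrow> complex set \<Rightarrow> ereal"
  where "edist_set z S = (INF w\<in>S. ereal (dist z w))"

end

theory Submission
  imports Defs
begin

text \<open>
  Only \<open>\<delta> > 0\<close> and \<open>\<psi> \<noteq> 0\<close> need an argument, and then the eigenvalue \<open>\<lambda>\<close> is real.
  Put \<open>\<gamma> = max_speed A\<close>, and choose \<open>d\<close> strictly between \<open>\<gamma> \<delta>\<close> and the
  distance from \<open>\<lambda>\<close> to the essential spectrum. The proof compares two estimates for \<open>u = w \<psi>\<close>, where
  \<open>w\<close> is a nonnegative smooth weight of compact support that satisfies \<open>|\<nabla>w| \<le> \<delta> w + 2\<close>.

  \<^item> As \<open>H\<close> is of first order and \<open>V\<close> commutes with multiplication by \<open>w\<close>, the function
    \<open>(H - \<lambda>) u = -i \<Sum>\<^sub>j (\<partial>\<^sub>j w) A\<^sub>j \<psi>\<close> involves no derivative of \<open>\<psi>\<close>, and its norm is at most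
    \<open>\<gamma> \<delta> \<parallel>u\<parallel> + 2 \<gamma> \<parallel>\<psi>\<parallel>\<close>
    (\<open>localization\<close>, \<open>norm_symbol_le\<close>). The compact support of \<open>w\<close> is what puts \<open>u\<close> into the domain.

  \<^item> Inside \<open>[\<lambda> - d, \<lambda> + d]\<close> the operator has only isolated eigenvalues of finite multiplicity. Hence
    \<open>H - \<lambda>\<close> is bounded below by \<open>d\<close> off a finite-dimensional space, which gives
    \<open>d \<parallel>u\<parallel> \<le> \<parallel>(H - \<lambda>) u\<parallel> + K \<Sum>\<^sub>c |\<langle>c, u\<rangle>|\<close> with finitely many fixed vectors \<open>c\<close>
    (\<open>coercive_modulo_finite_rank\<close>).

  The terms \<open>|\<langle>c, u\<rangle>|\<close> are harmless: most of the mass of \<open>c\<close> lies in a ball, where all the weights are bounded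
  by one constant, and the rest of \<open>c\<close> contributes at most a small multiple of \<open>\<parallel>u\<parallel>\<close> (\<open>pairing_bound\<close>).
  Together the estimates bound \<open>(d - \<gamma> \<delta>) \<parallel>w \<psi>\<parallel>\<close> independently of \<open>w\<close>. There is a sequence of such weights
  that tends to \<open>exp (\<delta> \<surd>(1 + |x|\<^sup>2))\<close> pointwise, so Fatou's lemma yields the theorem.

  The second estimate is a piece of spectral theory, which is derived here from inequalities between
  quadratic forms. That an interval \<open>(a, b)\<close> is free of spectrum is expressed by
  \<open>\<langle>(H - a) u, (H - b) u\<rangle> \<ge> 0\<close>. Two such inequalities on adjacent intervals can be joined
  if the common end point is no eigenvalue (\<open>gap_merge\<close>), and on the orthogonal complement of the
  eigenvectors it never is. A bisection argument then covers all of \<open>[\<lambda> - d, \<lambda> + d]\<close>.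

  Since the action of \<open>H\<close> is defined through an arbitrary choice of \<open>\<Sum>\<^sub>j A\<^sub>j \<partial>f/\<partial>x\<^sub>j\<close>, the first estimate
  also needs the fact that a locally integrable function is determined almost everywhere by the
  distribution it defines (\<open>is_symbol_deriv_unique\<close>).
\<close>

section \<open>Self-adjoint operators with discrete spectrum in an interval\<close>

text \<open>
  The projection theorem. By the parallelogram law a sequence in \<open>S\<close> whose distances to \<open>y\<close> tend to the
  infimum is Cauchy; its limit is the nearest point of \<open>closure S\<close>, and minimality makes the remainder
  orthogonal to \<open>S\<close>.
\<close>

lemma closure_decomposition:
  fixes S :: "'a::{real_inner,complete_space} set"
  assumes S: "subspace S"
  obtains z where "y - z \<in> closure S" "\<And>s. s \<in> S \<Longrightarrow> z \<bullet> s = 0"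
proof -
  define d where "d = infdist y S"
  have ne: "S \<noteq> {}" using subspace_0[OF S] by blast
  have d0: "d \<ge> 0" by (simp add: d_def infdist_nonneg)
  have d_le: "d \<le> norm (y - s)" if "s \<in> S" for s
    using infdist_le[OF that, of y] by (simp add: d_def dist_norm)
  have "\<exists>s\<in>S. norm (y - s) < d + inverse (real (Suc n))" for n
  proof (rule ccontr)
    assume "\<not> ?thesis"
    then have "d + inverse (real (Suc n)) \<le> d"
      unfolding d_def infdist_notempty[OF ne] using ne
      by (intro cINF_greatest) (auto simp: dist_norm not_less d_def infdist_notempty[OF ne])
    then show False by simp
  qed
  then obtain s where sS: "\<And>n. s n \<in> S"
    and s: "\<And>n. norm (y - s n) < d + inverse (real (Suc n))" by metis
  have par: "(norm (s m - s n))\<^sup>2 \<le> 2 * (norm (y - s m))\<^sup>2 + 2 * (norm (y - s n))\<^sup>2 - 4 * d\<^sup>2" for m n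
  proof -
    let ?c = "(1/2) *\<^sub>R (s m + s n)"
    have "?c \<in> S" by (intro subspace_scale subspace_add S sS)
    then have "d\<^sup>2 \<le> (norm (y - ?c))\<^sup>2" using d_le d0 by (simp add: power_mono)
    moreover have "4 * (norm (y - ?c))\<^sup>2
        = 2 * (norm (y - s m))\<^sup>2 + 2 * (norm (y - s n))\<^sup>2 - (norm (s m - s n))\<^sup>2"
      by (simp add: power2_norm_eq_inner inner_diff inner_add inner_commute algebra_simps)
    ultimately show ?thesis by linarith
  qed
  have s2: "(norm (y - s n))\<^sup>2 \<le> d\<^sup>2 + (2 * d + 1) * inverse (real (Suc n))" for n
  proof -
    let ?e = "inverse (real (Suc n))"
    have "(norm (y - s n))\<^sup>2 \<le> (d + ?e)\<^sup>2" using s[of n] by (intro power_mono) auto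
    also have "\<dots> = d\<^sup>2 + 2 * d * ?e + ?e * ?e" by (simp add: power2_eq_square algebra_simps)
    also have "?e * ?e \<le> 1 * ?e" by (intro mult_right_mono) (auto simp: inverse_le_1_iff)
    finally show ?thesis by (simp add: algebra_simps)
  qed
  have "Cauchy s"
  proof (rule metric_CauchyI)
    fix e :: real assume e: "e > 0"
    define c where "c = 4 * (2 * d + 1)"
    have c: "c > 0" using d0 by (simp add: c_def)
    obtain M where M: "inverse (real (Suc M)) < e\<^sup>2 / c"
      using reals_Archimedean[of "e\<^sup>2 / c"] e c by auto
    show "\<exists>M. \<forall>m\<ge>M. \<forall>n\<ge>M. dist (s m) (s n) < e"
    proof (intro exI allI impI)
      fix m n assume mn: "m \<ge> M" "n \<ge> M"
      have mono: "(2 * d + 1) * inverse (real (Suc k)) \<le> (2 * d + 1) * inverse (real (Suc M))" if "k \<ge> M" for k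
        using that d0 by (intro mult_left_mono) (auto simp: le_imp_inverse_le)
      have "(norm (s m - s n))\<^sup>2 \<le> c * inverse (real (Suc M))"
        using par[of m n] s2[of m] s2[of n] mono[OF mn(1)] mono[OF mn(2)]
        unfolding c_def by linarith
      also have "\<dots> < e\<^sup>2" using M c by (simp add: field_simps)
      finally show "dist (s m) (s n) < e"
        using e by (simp add: dist_norm power_less_imp_less_base)
    qed
  qed
  then obtain k where k: "s \<longlonglongrightarrow> k" using Cauchy_convergent convergent_def by blast
  have kcl: "k \<in> closure S" using k sS closure_sequential by blast
  have z: "norm (y - k) \<le> norm (y - (k + r))" if "r \<in> S" for r
  proof -
    have "norm (y - k) \<le> d"
    proof (rule LIMSEQ_le)
      show "(\<lambda>n. norm (y - s n)) \<longlonglongrightarrow> norm (y - k)" by (intro tendsto_intros k)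
      show "(\<lambda>n. d + inverse (real (Suc n))) \<longlonglongrightarrow> d"
        using tendsto_add[OF tendsto_const[of d] LIMSEQ_inverse_real_of_nat] by simp
    qed (use s in \<open>auto intro: less_imp_le\<close>)
    also have "d \<le> norm (y - (k + r))"
    proof (rule LIMSEQ_le_const)
      show "(\<lambda>n. norm (y - (s n + r))) \<longlonglongrightarrow> norm (y - (k + r))" by (intro tendsto_intros k)
    qed (use d_le sS that S in \<open>auto intro: subspace_add\<close>)
    finally show ?thesis .
  qed
  show thesis
  proof
    show "y - (y - k) \<in> closure S" using kcl by simp
    fix r assume r: "r \<in> S"
    show "(y - k) \<bullet> r = 0"
    proof (cases "r = 0")
      case False
      \<comment> \<open>This step length minimises the distance from \<open>y\<close> along the line through \<open>k\<close> in direction \<open>r\<close>.\<close>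
      define t where "t = ((y - k) \<bullet> r) / (r \<bullet> r)"
      have rr: "r \<bullet> r > 0" using False by simp
      have "(norm (y - k))\<^sup>2 \<le> (norm (y - (k + t *\<^sub>R r)))\<^sup>2"
        using z[of "t *\<^sub>R r"] r S by (intro power_mono) (auto intro: subspace_scale)
      also have "\<dots> = (norm ((y - k) - t *\<^sub>R r))\<^sup>2" by (simp add: algebra_simps)
      also have "\<dots> = (norm (y - k))\<^sup>2 - 2 * t * ((y - k) \<bullet> r) + t\<^sup>2 * (r \<bullet> r)"
        unfolding power2_norm_eq_inner power2_eq_square[of t]
        by (simp add: inner_diff inner_commute algebra_simps)
      also have "\<dots> = (norm (y - k))\<^sup>2 - ((y - k) \<bullet> r)\<^sup>2 / (r \<bullet> r)"
        using rr by (simp add: t_def power2_eq_square field_simps)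
      finally show ?thesis using rr by (simp add: divide_le_0_iff)
    qed simp
  qed
qed

text \<open>
  \<open>C\<close> is an orthogonal basis of \<open>span B\<close>. The projection is stated through its coefficients because they
  bound the norm of the projection by finitely many inner products. The vector \<open>0\<close> may belong to \<open>C\<close>;
  its summand vanishes.
\<close>

lemma finite_span_projection:
  fixes B :: "'a::real_inner set"
  assumes "finite B"
  obtains C where "finite C"
    "\<And>u. (\<Sum>c\<in>C. ((c \<bullet> u) / (c \<bullet> c)) *\<^sub>R c) \<in> span B"
    "\<And>u v. v \<in> span B \<Longrightarrow> (u - (\<Sum>c\<in>C. ((c \<bullet> u) / (c \<bullet> c)) *\<^sub>R c)) \<bullet> v = 0"
proof -
  obtain C where C: "finite C" "span C = span B" "pairwise orthogonal C"
    using basis_orthogonal[OF assms] by blast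
  define P where "P u = (\<Sum>c\<in>C. ((c \<bullet> u) / (c \<bullet> c)) *\<^sub>R c)" for u
  have orth: "(u - P u) \<bullet> c = 0" if c: "c \<in> C" for u c
  proof -
    have "P u \<bullet> c = (\<Sum>e\<in>C. ((e \<bullet> u) / (e \<bullet> e)) * (e \<bullet> c))"
      by (simp add: P_def inner_sum_left)
    also have "\<dots> = (\<Sum>e\<in>C. if e = c then c \<bullet> u else 0)"
      using C(3) c by (intro sum.cong) (auto simp: pairwise_def orthogonal_def)
    also have "\<dots> = c \<bullet> u" using C(1) c by simp
    finally show ?thesis by (simp add: inner_diff_left inner_commute[of u c])
  qed
  have "(u - P u) \<bullet> v = 0" if "v \<in> span B" for u v
  proof -
    have "v \<in> span C" using that C by simp
    then show ?thesis
      by (induction rule: span_induct) (auto simp: orth subspace_def inner_add_right)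
  qed
  moreover have "P u \<in> span B" for u
    unfolding P_def C(2)[symmetric] by (intro span_sum span_scale span_base)
  ultimately show thesis using that[OF C(1)] unfolding P_def by blast
qed

text \<open>
  The equivalence \<open>adjoint\<close> says that \<open>T\<close> equals its adjoint: from right to left it is symmetry, from left
  to right maximality of the domain. The scalar product is real. For a complex linear operator nothing
  changes if the scalar product is replaced by its real part, because \<open>u\<close> may be replaced by \<open>i u\<close>; so the type
  classes for real Hilbert spaces suffice.
\<close>

locale selfadjoint =
  fixes D :: "'a::{real_inner,complete_space} set" and T :: "'a \<Rightarrow> 'a"
  assumes subspace_D: "subspace D"
    and T_add: "u \<in> D \<Longrightarrow> v \<in> D \<Longrightarrow> T (u + v) = T u + T v"
    and T_scale: "u \<in> D \<Longrightarrow> T (r *\<^sub>R u) = r *\<^sub>R T u"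
    and adjoint: "(\<forall>u\<in>D. T u \<bullet> v = u \<bullet> w) \<longleftrightarrow> v \<in> D \<and> T v = w"
begin

text \<open>
  By the spectral theorem, \<open>gap a b D\<close> says for \<open>a \<le> b\<close> that the open interval \<open>(a, b)\<close> contains no spectrum, since
  \<open>(s - a) * (s - b) < 0\<close> exactly for \<open>s\<close> in that interval.
\<close>

definition gap :: "real \<Rightarrow> real \<Rightarrow> 'a set \<Rightarrow> bool"
  where "gap a b N \<longleftrightarrow> (\<forall>u\<in>N. 0 \<le> (T u - a *\<^sub>R u) \<bullet> (T u - b *\<^sub>R u))"

definition perp :: "'a set \<Rightarrow> 'a set"
  where "perp B = {u \<in> D. \<forall>b\<in>B. b \<bullet> u = 0}"

text \<open>
  The eigenvalues may differ. The span of such a set is invariant under \<open>T\<close>, so its orthogonal complement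
  reduces \<open>T\<close>.
\<close>

definition eigenvectors :: "'a set \<Rightarrow> bool"
  where "eigenvectors B \<longleftrightarrow> finite B \<and> B \<subseteq> D \<and> (\<forall>b\<in>B. \<exists>r. T b = r *\<^sub>R b)"

text \<open>
  For a self-adjoint operator a lower bound of this kind already makes \<open>t\<close> a point of the resolvent set.
\<close>

definition regular_at :: "real \<Rightarrow> bool"
  where "regular_at t \<longleftrightarrow> (\<exists>C. \<forall>u\<in>D. norm u \<le> C * norm (T u - t *\<^sub>R u))"

lemma symmetric: "u \<in> D \<Longrightarrow> v \<in> D \<Longrightarrow> T u \<bullet> v = u \<bullet> T v"
  using adjoint by blast

lemma T_diff: "u \<in> D \<Longrightarrow> v \<in> D \<Longrightarrow> T (u - v) = T u - T v"
  using T_add[of u "(-1) *\<^sub>R v"] T_scale[of v "-1"] subspace_scale[OF subspace_D, of v "-1"] by simp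

lemma T_zero: "T 0 = 0"
  using T_scale[of 0 0] subspace_0[OF subspace_D] by simp

lemma subspace_perp: "subspace (perp B)"
  unfolding perp_def subspace_def using subspace_D
  by (auto simp: subspace_def inner_add_right)

lemma span_perp:
  assumes "v \<in> span B" "\<And>b. b \<in> B \<Longrightarrow> b \<bullet> u = 0"
  shows "v \<bullet> u = 0"
  using assms(1)
  by (induction rule: span_induct) (auto simp: assms(2) subspace_def inner_add_left)

lemma gap_mono: "gap a b N \<Longrightarrow> N' \<subseteq> N \<Longrightarrow> gap a b N'"
  by (auto simp: gap_def)

lemma perp_mono: "B \<subseteq> B' \<Longrightarrow> perp B' \<subseteq> perp B"
  by (auto simp: perp_def)

lemma perp_empty: "perp {} = D"
  by (simp add: perp_def)

lemma span_eigenvectors: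
  assumes "eigenvectors B" "v \<in> span B"
  shows "v \<in> D \<and> T v \<in> span B"
  using assms(2)
proof (induction rule: span_induct)
  case base
  show ?case
    using subspace_D
    by (auto simp: subspace_def T_add T_scale T_zero span_zero span_add span_scale)
next
  case (step x)
  then show ?case using assms(1) unfolding eigenvectors_def
    by (metis span_base span_scale subsetD)
qed

lemma perp_invariant:
  assumes "eigenvectors B" "u \<in> perp B" "v \<in> span B"
  shows "v \<bullet> (T u - t *\<^sub>R u) = 0"
proof -
  have u: "u \<in> D" "\<And>b. b \<in> B \<Longrightarrow> b \<bullet> u = 0" using assms(2) by (auto simp: perp_def)
  have "v \<bullet> T u = T v \<bullet> u" using symmetric u(1) span_eigenvectors[OF assms(1,3)] by simp
  also have "\<dots> = 0" using span_perp span_eigenvectors[OF assms(1,3)] u(2) by blast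
  finally show ?thesis using span_perp[OF assms(3) u(2)] by (simp add: inner_diff_right)
qed

text \<open>
  On the complement of \<open>B\<close>, a vector orthogonal to the range of \<open>T - t\<close> lies in the kernel of the adjoint of
  \<open>T - t\<close>, which is the kernel of \<open>T - t\<close> itself.
\<close>

lemma range_dense:
  assumes B: "eigenvectors B"
    and ker: "\<And>u. u \<in> perp B \<Longrightarrow> T u = t *\<^sub>R u \<Longrightarrow> u = 0"
    and y: "\<And>b. b \<in> B \<Longrightarrow> b \<bullet> y = 0"
  shows "y \<in> closure ((\<lambda>u. T u - t *\<^sub>R u) ` perp B)"
proof -
  define A where "A u = T u - t *\<^sub>R u" for u
  have NB: "u \<in> D" if "u \<in> perp B" for u using that by (simp add: perp_def)
  have sub: "subspace (A ` perp B)"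
    unfolding subspace_def
  proof (intro conjI ballI allI)
    show "0 \<in> A ` perp B"
      using T_zero subspace_0[OF subspace_perp] by (intro image_eqI[of _ _ 0]) (auto simp: A_def)
    fix x assume "x \<in> A ` perp B"
    then obtain u where u: "u \<in> perp B" "x = A u" by auto
    { fix c :: real
      have "c *\<^sub>R x = A (c *\<^sub>R u)"
        unfolding u(2) using NB[OF u(1)] by (simp add: A_def T_scale algebra_simps)
      then show "c *\<^sub>R x \<in> A ` perp B" using subspace_scale[OF subspace_perp u(1)] by blast }
    fix x' assume "x' \<in> A ` perp B"
    then obtain u' where u': "u' \<in> perp B" "x' = A u'" by auto
    have "x + x' = A (u + u')"
      unfolding u(2) u'(2) using NB[OF u(1)] NB[OF u'(1)] by (simp add: A_def T_add algebra_simps)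
    then show "x + x' \<in> A ` perp B" using subspace_add[OF subspace_perp u(1) u'(1)] by blast
  qed
  obtain z where z: "y - z \<in> closure (A ` perp B)" "\<And>s. s \<in> A ` perp B \<Longrightarrow> z \<bullet> s = 0"
    using closure_decomposition[OF sub] by blast
  have "b \<bullet> (y - z) = 0" if b: "b \<in> B" for b
  proof -
    have "closed {x. b \<bullet> x = 0}" by (rule closed_hyperplane)
    moreover have "A ` perp B \<subseteq> {x. b \<bullet> x = 0}"
      using perp_invariant[OF B _ span_base[OF b]] by (auto simp: A_def)
    ultimately show ?thesis using z(1) closure_minimal by blast
  qed
  then have zB: "b \<bullet> z = 0" if "b \<in> B" for b using y that by (simp add: inner_diff_right)
  obtain C where C: "\<And>u. (\<Sum>c\<in>C. ((c \<bullet> u) / (c \<bullet> c)) *\<^sub>R c) \<in> span B"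
    "\<And>u v. v \<in> span B \<Longrightarrow> (u - (\<Sum>c\<in>C. ((c \<bullet> u) / (c \<bullet> c)) *\<^sub>R c)) \<bullet> v = 0"
    by (rule finite_span_projection[of B]) (use B in \<open>auto simp: eigenvectors_def\<close>)
  have "T u \<bullet> z = u \<bullet> (t *\<^sub>R z)" if u: "u \<in> D" for u
  proof -
    define p where "p = (\<Sum>c\<in>C. ((c \<bullet> u) / (c \<bullet> c)) *\<^sub>R c)"
    have p: "p \<in> D" "T p \<in> span B" "p \<in> span B"
      using span_eigenvectors[OF B C(1)] C(1) by (auto simp: p_def)
    have "b \<bullet> (u - p) = 0" if "b \<in> B" for b
      unfolding p_def inner_commute[of b] by (rule C(2)[OF span_base[OF that]])
    then have "u - p \<in> perp B"
      using u p(1) subspace_D by (simp add: perp_def subspace_diff)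
    then have "z \<bullet> A (u - p) = 0" using z(2) by blast
    moreover have "z \<bullet> p = 0" "z \<bullet> T p = 0"
      unfolding inner_commute[of z]
      by (rule span_perp[OF p(3)] span_perp[OF p(2)], rule zB, assumption)+
    ultimately show ?thesis
      using u p by (simp add: A_def T_diff inner_diff_right inner_commute)
  qed
  then have "z \<in> D \<and> T z = t *\<^sub>R z" using adjoint by blast
  then have "z = 0" using ker zB by (simp add: perp_def)
  then show ?thesis using z(1) by (simp add: A_def)
qed

text \<open>
  Write \<open>N = perp B\<close>, \<open>A = T - t\<close>, \<open>p = c - t\<close> and \<open>q = t - a\<close>. As \<open>A\<close> is injective on \<open>N\<close>, one may think of
  \<open>S = A\<^sup>-\<^sup>1\<close> on its range. The two hypotheses say that \<open>- 1 / q \<le> S \<le> 1 / p\<close> as quadratic forms, and the claim is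
  that the product \<open>(1 / p - S) (S + 1 / q)\<close> is nonnegative. Put \<open>X = 1 / p - S\<close>, so that the second factor is
  \<open>(1 / p + 1 / q) - X\<close>. Then the claim reads \<open>\<parallel>X v\<parallel>\<^sup>2 \<le> (1 / p + 1 / q) \<langle>X v, v\<rangle>\<close>, which follows from
  \<open>0 \<le> X \<le> 1 / p + 1 / q\<close> and the Cauchy-Schwarz inequality for the form of \<open>X\<close>, tested against vectors of the range that
  approximate \<open>X v\<close>. That the range is dense is the reason why \<open>t\<close> must not be an eigenvalue on \<open>N\<close>.
\<close>

lemma gap_merge:
  assumes B: "eigenvectors B"
    and ker: "\<And>u. u \<in> perp B \<Longrightarrow> T u = t *\<^sub>R u \<Longrightarrow> u = 0"
    and at: "a \<le> t" and tc: "t \<le> c"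
    and gap1: "gap a t (perp B)" and gap2: "gap t c (perp B)"
  shows "gap a c (perp B)"
proof (cases "a = t \<or> t = c")
  case True
  then show ?thesis using gap1 gap2 by auto
next
  case False
  define p q where "p = c - t" and "q = t - a"
  have pq: "p > 0" "q > 0" using False at tc by (auto simp: p_def q_def)
  define A where "A u = T u - t *\<^sub>R u" for u
  have A_a: "T u - a *\<^sub>R u = A u + q *\<^sub>R u" and A_c: "T u - c *\<^sub>R u = A u - p *\<^sub>R u" for u
    by (auto simp: A_def p_def q_def algebra_simps)
  have NB: "u \<in> D" if "u \<in> perp B" for u using that by (simp add: perp_def)
  have symA: "A u \<bullet> v = u \<bullet> A v" if "u \<in> perp B" "v \<in> perp B" for u v
    using symmetric NB that by (simp add: A_def inner_diff)
  \<comment> \<open>\<open>\<beta> u v\<close> is \<open>p\<close> times the form of \<open>1 / p - A\<^sup>-\<^sup>1\<close> at \<open>A u\<close> and \<open>A v\<close>.\<close>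
  define \<beta> where "\<beta> u v = (A u - p *\<^sub>R u) \<bullet> A v" for u v
  have \<beta>_pos: "\<beta> u u \<ge> 0" if "u \<in> perp B" for u
    using gap2 that unfolding gap_def \<beta>_def A_c by (simp add: A_def inner_commute)
  have \<beta>_le: "\<beta> u u \<le> (1 + p / q) * (A u \<bullet> A u)" if "u \<in> perp B" for u
  proof -
    have "0 \<le> (A u + q *\<^sub>R u) \<bullet> A u"
      using gap1 that unfolding gap_def A_a by (simp add: A_def)
    then have "- (u \<bullet> A u) \<le> (A u \<bullet> A u) / q" using pq by (simp add: inner_add_left field_simps)
    then have "p * (- (u \<bullet> A u)) \<le> p * ((A u \<bullet> A u) / q)" using pq by (intro mult_left_mono) auto
    then show ?thesis by (simp add: \<beta>_def inner_diff_left algebra_simps)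
  qed
  have cs: "(\<beta> u v)\<^sup>2 \<le> \<beta> u u * \<beta> v v" if u: "u \<in> perp B" and v: "v \<in> perp B" for u v
  proof -
    have quad: "0 \<le> \<beta> u u + 2 * r * \<beta> u v + r\<^sup>2 * \<beta> v v" for r
    proof -
      have "u + r *\<^sub>R v \<in> perp B" using u v subspace_perp by (simp add: subspace_def)
      moreover have "A (u + r *\<^sub>R v) = A u + r *\<^sub>R A v"
        using u v NB subspace_scale[OF subspace_D] by (simp add: A_def T_add T_scale algebra_simps)
      ultimately have "0 \<le> (A u + r *\<^sub>R A v - p *\<^sub>R (u + r *\<^sub>R v)) \<bullet> (A u + r *\<^sub>R A v)"
        using \<beta>_pos[of "u + r *\<^sub>R v"] by (simp add: \<beta>_def)
      also have "\<dots> = \<beta> u u + 2 * r * \<beta> u v + r\<^sup>2 * \<beta> v v"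
        using symA[OF u v] symA[OF v u]
        by (simp add: \<beta>_def inner_add inner_diff inner_commute algebra_simps power2_eq_square)
      finally show ?thesis .
    qed
    show ?thesis
    proof (cases "\<beta> v v = 0")
      case True
      have "\<beta> u v = 0"
      proof (rule ccontr)
        assume ne: "\<beta> u v \<noteq> 0"
        show False
          using quad[of "- (\<beta> u u + 1) / (2 * \<beta> u v)"] True ne by (simp add: field_simps)
      qed
      then show ?thesis using True by simp
    next
      case False
      then have pos: "\<beta> v v > 0" using \<beta>_pos[OF v] by simp
      show ?thesis using quad[of "- \<beta> u v / \<beta> v v"] pos
        by (simp add: field_simps power2_eq_square)
    qed
  qed
  show ?thesis
    unfolding gap_def
  proof
    fix u assume u: "u \<in> perp B"
    define y where "y = A u - p *\<^sub>R u"
    have "b \<bullet> y = 0" if "b \<in> B" for b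
      using perp_invariant[OF B u span_base[OF that], of t] u that
      by (simp add: y_def A_def perp_def inner_diff_right)
    then have "y \<in> closure (A ` perp B)"
      using range_dense[OF B ker] unfolding A_def by blast
    then obtain x where x: "\<And>n. x n \<in> A ` perp B" "x \<longlonglongrightarrow> y"
      using closure_sequential by blast
    have "(y \<bullet> x n)\<^sup>2 \<le> \<beta> u u * ((1 + p / q) * (x n \<bullet> x n))" for n
    proof -
      obtain v where v: "v \<in> perp B" "x n = A v" using x(1) by blast
      have "(y \<bullet> x n)\<^sup>2 = (\<beta> u v)\<^sup>2" by (simp add: \<beta>_def y_def v)
      also have "\<dots> \<le> \<beta> u u * \<beta> v v" by (rule cs[OF u v(1)])
      also have "\<dots> \<le> \<beta> u u * ((1 + p / q) * (x n \<bullet> x n))"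
        using \<beta>_pos[OF u] \<beta>_le[OF v(1)] by (intro mult_left_mono) (auto simp: v)
      finally show ?thesis .
    qed
    then have "(y \<bullet> y)\<^sup>2 \<le> \<beta> u u * ((1 + p / q) * (y \<bullet> y))"
      by (intro LIMSEQ_le[of "\<lambda>n. (y \<bullet> x n)\<^sup>2" _ "\<lambda>n. \<beta> u u * ((1 + p / q) * (x n \<bullet> x n))"] tendsto_intros x) auto
    then have "(y \<bullet> y) * (y \<bullet> y) \<le> (\<beta> u u * (1 + p / q)) * (y \<bullet> y)"
      by (simp add: power2_eq_square)
    then have yy: "y \<bullet> y \<le> \<beta> u u * (1 + p / q)"
      using pq \<beta>_pos[OF u] by (cases "y = 0") (auto simp: mult_le_cancel_right)
    then have yy': "q * (y \<bullet> y) \<le> (p + q) * (y \<bullet> A u)"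
      using pq by (simp add: \<beta>_def y_def field_simps)
    have "p *\<^sub>R (A u + q *\<^sub>R u) = (p + q) *\<^sub>R A u - q *\<^sub>R y"
      by (simp add: y_def algebra_simps)
    then have "p * (y \<bullet> (A u + q *\<^sub>R u)) = (p + q) * (y \<bullet> A u) - q * (y \<bullet> y)"
      by (metis inner_diff_right inner_scaleR_right)
    then have "0 \<le> p * (y \<bullet> (A u + q *\<^sub>R u))" using yy' by simp
    then have "0 \<le> y \<bullet> (A u + q *\<^sub>R u)" using pq by (simp add: zero_le_mult_iff)
    then show "0 \<le> (T u - a *\<^sub>R u) \<bullet> (T u - c *\<^sub>R u)"
      unfolding A_a A_c by (simp add: y_def inner_commute)
  qed
qed

text \<open>
  Completing the square turns the form inequality into a lower bound at the midpoint of the interval.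
\<close>

lemma gap_iff_midpoint:
  "gap a b N \<longleftrightarrow> (\<forall>u\<in>N. \<bar>b - a\<bar> / 2 * norm u \<le> norm (T u - ((a + b) / 2) *\<^sub>R u))"
proof -
  have "(T u - a *\<^sub>R u) \<bullet> (T u - b *\<^sub>R u)
      = (norm (T u - ((a + b) / 2) *\<^sub>R u))\<^sup>2 - (\<bar>b - a\<bar> / 2 * norm u)\<^sup>2" for u
    unfolding power_mult_distrib power2_norm_eq_inner power_divide power2_abs
    by (simp add: inner_diff inner_commute power2_eq_square field_simps)
  moreover have "y\<^sup>2 \<le> x\<^sup>2 \<longleftrightarrow> y \<le> x" if "0 \<le> x" "0 \<le> y" for x y :: real
    using that by (simp add: abs_le_square_iff[symmetric])
  ultimately show ?thesis unfolding gap_def by simp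
qed

lemma regular_imp_ker: "regular_at t \<Longrightarrow> u \<in> D \<Longrightarrow> T u = t *\<^sub>R u \<Longrightarrow> u = 0"
  by (fastforce simp: regular_at_def)

lemma regular_atE:
  assumes "regular_at t"
  obtains C where "C > 0" "\<And>u. u \<in> D \<Longrightarrow> norm u \<le> C * norm (T u - t *\<^sub>R u)"
proof -
  obtain C0 where C0: "\<And>u. u \<in> D \<Longrightarrow> norm u \<le> C0 * norm (T u - t *\<^sub>R u)"
    using assms by (auto simp: regular_at_def)
  have "norm u \<le> max C0 1 * norm (T u - t *\<^sub>R u)" if "u \<in> D" for u
    using C0[OF that] mult_right_mono[of C0 "max C0 1" "norm (T u - t *\<^sub>R u)"] by auto
  then show thesis by (intro that[of "max C0 1"]) auto
qed

lemma regular_imp_gap_near: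
  assumes "regular_at t"
  obtains d where "d > 0" "\<And>a b. a \<le> t \<Longrightarrow> t \<le> b \<Longrightarrow> b - a < d \<Longrightarrow> gap a b D"
proof -
  obtain C where C: "C > 0" "\<And>u. u \<in> D \<Longrightarrow> norm u \<le> C * norm (T u - t *\<^sub>R u)"
    using regular_atE[OF assms] by blast
  show thesis
  proof
    show "1 / C > 0" using C by simp
    fix a b :: real assume ab: "a \<le> t" "t \<le> b" "b - a < 1 / C"
    define m where "m = (a + b) / 2"
    have "(b - a) / 2 * norm u \<le> norm (T u - m *\<^sub>R u)" if u: "u \<in> D" for u
    proof -
      have "norm u / C \<le> norm (T u - t *\<^sub>R u)" using C(2)[OF u] C(1) by (simp add: field_simps)
      also have "\<dots> = norm ((T u - m *\<^sub>R u) + (m - t) *\<^sub>R u)" by (simp add: algebra_simps)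
      also have "\<dots> \<le> norm (T u - m *\<^sub>R u) + \<bar>m - t\<bar> * norm u"
        by (metis norm_scaleR norm_triangle_ineq)
      finally have 1: "norm u / C \<le> norm (T u - m *\<^sub>R u) + \<bar>m - t\<bar> * norm u" .
      have 2: "\<bar>m - t\<bar> * norm u \<le> (b - a) / 2 * norm u"
        using ab by (intro mult_right_mono) (auto simp: m_def abs_le_iff field_simps)
      have "(b - a) * norm u \<le> (1 / C) * norm u" using ab by (intro mult_right_mono) auto
      with 1 2 show ?thesis by simp
    qed
    then show "gap a b D" using ab unfolding gap_iff_midpoint m_def by simp
  qed
qed

text \<open>
  Bisection: short intervals have a gap by the lower bound at an interior point, and adjacent gaps merge
  because a regular point is not an eigenvalue. This covers every closed subinterval; the end points are
  reached by a limit, since the form depends continuously on \<open>a\<close> and \<open>b\<close>.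
\<close>

lemma regular_imp_gap:
  assumes "a < b" and reg: "\<And>t. a < t \<Longrightarrow> t < b \<Longrightarrow> regular_at t"
  shows "gap a b D"
proof -
  have closed: "gap l r D" if "a < l" "l \<le> r" "r < b" for l r
  proof -
    have "a < l \<longrightarrow> r < b \<longrightarrow> gap l r D"
      using that(2)
    proof (induction rule: Bolzano)
      case (trans x y z)
      show ?case
      proof (intro impI)
        assume "a < x" "z < b"
        then have "regular_at y" "gap x y D" "gap y z D"
          using trans reg by auto
        then show "gap x z D"
          using gap_merge[of "{}" y x z] regular_imp_ker trans
          by (simp add: eigenvectors_def perp_empty)
      qed
    next
      case (local x)
      then have "regular_at x" using that reg by auto
      then show ?case by (metis regular_imp_gap_near)
    qed
    then show ?thesis using that by blast
  qed
  show ?thesis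
    unfolding gap_def
  proof
    fix u assume u: "u \<in> D"
    define e where "e n = (b - a) / 2 * inverse (real (Suc n))" for n
    have e: "0 < e n" "2 * e n \<le> b - a" for n
    proof -
      have i: "0 < inverse (real (Suc n))" "inverse (real (Suc n)) \<le> 1" by (auto simp: inverse_le_1_iff)
      show "0 < e n" using assms i by (simp add: e_def del: of_nat_Suc)
      have "(b - a) * inverse (real (Suc n)) \<le> (b - a) * 1"
        using assms i by (intro mult_left_mono) auto
      then show "2 * e n \<le> b - a" by (simp add: e_def)
    qed
    have "e \<longlonglongrightarrow> (b - a) / 2 * 0"
      unfolding e_def by (intro tendsto_mult tendsto_const LIMSEQ_inverse_real_of_nat)
    then have e0: "e \<longlonglongrightarrow> 0" by simp
    have "(\<lambda>n. (T u - (a + e n) *\<^sub>R u) \<bullet> (T u - (b - e n) *\<^sub>R u))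
        \<longlonglongrightarrow> (T u - (a + 0) *\<^sub>R u) \<bullet> (T u - (b - 0) *\<^sub>R u)"
      by (intro tendsto_intros e0)
    moreover have "0 \<le> (T u - (a + e n) *\<^sub>R u) \<bullet> (T u - (b - e n) *\<^sub>R u)" for n
      using closed[of "a + e n" "b - e n"] e[of n] u by (auto simp: gap_def)
    ultimately show "0 \<le> (T u - a *\<^sub>R u) \<bullet> (T u - b *\<^sub>R u)"
      by (intro LIMSEQ_le_const) auto
  qed
qed

text \<open>
  This covers both ways for \<open>t\<close> to lie outside the essential spectrum: \<open>t\<close> may be regular, or an isolated
  point of the spectrum whose eigenspace has finite dimension.
\<close>

definition discrete_at :: "real \<Rightarrow> bool"
  where "discrete_at t \<longleftrightarrow> (\<exists>e>0. \<forall>s. s \<noteq> t \<and> \<bar>s - t\<bar> < e \<longrightarrow> regular_at s) \<and>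
    (\<exists>B. eigenvectors B \<and> (\<forall>u\<in>D. T u = t *\<^sub>R u \<longrightarrow> u \<in> span B))"

lemma regular_imp_discrete:
  assumes "regular_at t" shows "discrete_at t"
proof -
  obtain C where C: "C > 0" "\<And>u. u \<in> D \<Longrightarrow> norm u \<le> C * norm (T u - t *\<^sub>R u)"
    using regular_atE[OF assms] by blast
  have "regular_at s" if s: "\<bar>s - t\<bar> < 1 / (2 * C)" for s
    unfolding regular_at_def
  proof (intro exI[of _ "2 * C"] ballI)
    fix u assume u: "u \<in> D"
    have "norm (T u - t *\<^sub>R u) = norm ((T u - s *\<^sub>R u) + (s - t) *\<^sub>R u)" by (simp add: algebra_simps)
    also have "\<dots> \<le> norm (T u - s *\<^sub>R u) + \<bar>s - t\<bar> * norm u" by (metis norm_scaleR norm_triangle_ineq)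
    also have "\<dots> \<le> norm (T u - s *\<^sub>R u) + 1 / (2 * C) * norm u"
      using s by (intro add_left_mono mult_right_mono) auto
    finally have "C * norm (T u - t *\<^sub>R u) \<le> C * (norm (T u - s *\<^sub>R u) + 1 / (2 * C) * norm u)"
      using C(1) by (intro mult_left_mono) auto
    also have "\<dots> = C * norm (T u - s *\<^sub>R u) + norm u / 2" using C(1) by (simp add: field_simps)
    finally show "norm u \<le> 2 * C * norm (T u - s *\<^sub>R u)" using C(2)[OF u] by simp
  qed
  moreover have "1 / (2 * C) > 0" using C(1) by simp
  moreover have "eigenvectors {} \<and> (\<forall>u\<in>D. T u = t *\<^sub>R u \<longrightarrow> u \<in> span {})"
    using regular_imp_ker[OF assms] by (auto simp: eigenvectors_def)
  ultimately show ?thesis unfolding discrete_at_def by blast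
qed

lemma discrete_ker:
  assumes "u \<in> perp B" "T u = t *\<^sub>R u" "\<And>v. v \<in> D \<Longrightarrow> T v = t *\<^sub>R v \<Longrightarrow> v \<in> span B"
  shows "u = 0"
proof -
  have "u \<in> D" "\<And>b. b \<in> B \<Longrightarrow> b \<bullet> u = 0" using assms(1) by (auto simp: perp_def)
  then have "u \<bullet> u = 0" using assms by (intro span_perp[of u B]) auto
  then show ?thesis by simp
qed

lemma eigenvectors_Un: "eigenvectors B \<Longrightarrow> eigenvectors B' \<Longrightarrow> eigenvectors (B \<union> B')"
  by (auto simp: eigenvectors_def)

text \<open>
  Bisection again. Near a discrete point \<open>t\<close> there are gaps on both sides of \<open>t\<close>, and they merge once the eigenvectors for
  \<open>t\<close> are projected away. When two subintervals are joined, their exceptional sets are united with the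
  eigenvectors for the common end point, so the exceptional set stays finite.
\<close>

lemma finite_rank_gap:
  assumes "a \<le> b" and disc: "\<And>t. a \<le> t \<Longrightarrow> t \<le> b \<Longrightarrow> discrete_at t"
  obtains B where "eigenvectors B" "gap a b (perp B)"
proof -
  have "\<exists>B. eigenvectors B \<and> gap l r (perp B)" if "l \<le> r" "a \<le> l" "r \<le> b" for l r
  proof -
    have "a \<le> l \<longrightarrow> r \<le> b \<longrightarrow> (\<exists>B. eigenvectors B \<and> gap l r (perp B))"
      using that(1)
    proof (induction rule: Bolzano)
      case (trans x y z)
      show ?case
      proof (intro impI)
        assume "a \<le> x" "z \<le> b"
        with trans obtain B1 B2 where B: "eigenvectors B1" "gap x y (perp B1)"
          "eigenvectors B2" "gap y z (perp B2)" by auto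
        obtain B3 where B3: "eigenvectors B3" "\<And>v. v \<in> D \<Longrightarrow> T v = y *\<^sub>R v \<Longrightarrow> v \<in> span B3"
          using disc[of y] trans \<open>a \<le> x\<close> \<open>z \<le> b\<close> by (auto simp: discrete_at_def)
        define B where "B = B1 \<union> B2 \<union> B3"
        have eB: "eigenvectors B" unfolding B_def by (intro eigenvectors_Un B B3)
        have "gap x z (perp B)"
        proof (rule gap_merge[OF eB, where t = y])
          show "u = 0" if "u \<in> perp B" "T u = y *\<^sub>R u" for u
            using that B3(2) discrete_ker[of u B3 y] perp_mono[of B3 B] by (auto simp: B_def)
          show "gap x y (perp B)" by (rule gap_mono[OF B(2) perp_mono]) (auto simp: B_def)
          show "gap y z (perp B)" by (rule gap_mono[OF B(4) perp_mono]) (auto simp: B_def)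
        qed (use trans in auto)
        then show "\<exists>B. eigenvectors B \<and> gap x z (perp B)" using eB by blast
      qed
    next
      case (local t)
      then have "discrete_at t" using disc that by auto
      then obtain e B where e: "e > 0" "\<And>s. s \<noteq> t \<Longrightarrow> \<bar>s - t\<bar> < e \<Longrightarrow> regular_at s"
        and B: "eigenvectors B" "\<And>v. v \<in> D \<Longrightarrow> T v = t *\<^sub>R v \<Longrightarrow> v \<in> span B"
        unfolding discrete_at_def by blast
      show ?case
      proof (intro exI[of _ e] conjI allI impI)
        fix x y assume xy: "x \<le> t \<and> t \<le> y \<and> y - x < e"
        have side: "gap l r (perp B)" if "l \<le> r" "t = l \<or> t = r" "r - l < e" for l r
        proof (cases "l = r")
          case False
          with that have "gap l r D" by (intro regular_imp_gap e) auto
          then show ?thesis by (rule gap_mono) (auto simp: perp_def)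
        qed (simp add: gap_def)
        have "gap x y (perp B)"
        proof (rule gap_merge[OF B(1), where t = t])
          show "u = 0" if "u \<in> perp B" "T u = t *\<^sub>R u" for u
            using that B(2) discrete_ker by blast
        qed (use xy in \<open>auto intro!: side\<close>)
        then show "\<exists>B. eigenvectors B \<and> gap x y (perp B)" using B(1) by blast
      qed (use e in simp)
    qed
    then show ?thesis using that by blast
  qed
  then show thesis using that assms(1) by blast
qed

text \<open>
  On the complement of the exceptional eigenvectors the gap \<open>(l - d, l + d)\<close> means \<open>d \<parallel>u\<parallel> \<le> \<parallel>(T - l) u\<parallel>\<close>. A general
  \<open>u\<close> is split orthogonally; the splitting is respected by \<open>T\<close>, and the finite-dimensional part is bounded by
  its coefficients.
\<close>

lemma coercive_modulo_finite_rank: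
  assumes d: "0 \<le> d" and disc: "\<And>t. \<bar>t - l\<bar> \<le> d \<Longrightarrow> discrete_at t"
  obtains C K where "finite C" "K \<ge> 0"
    "\<And>u. u \<in> D \<Longrightarrow> d * norm u \<le> norm (T u - l *\<^sub>R u) + K * (\<Sum>c\<in>C. \<bar>c \<bullet> u\<bar>)"
proof -
  obtain B where B: "eigenvectors B" and gapB: "gap (l - d) (l + d) (perp B)"
    using finite_rank_gap[of "l - d" "l + d"] d disc by (auto simp: abs_le_iff)
  obtain C where C: "finite C" "\<And>u. (\<Sum>c\<in>C. ((c \<bullet> u) / (c \<bullet> c)) *\<^sub>R c) \<in> span B"
    "\<And>u v. v \<in> span B \<Longrightarrow> (u - (\<Sum>c\<in>C. ((c \<bullet> u) / (c \<bullet> c)) *\<^sub>R c)) \<bullet> v = 0"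
    by (rule finite_span_projection[of B]) (use B in \<open>auto simp: eigenvectors_def\<close>)
  define K where "K = d * (\<Sum>c\<in>C. 1 / norm c)"
  show thesis
  proof
    show "finite C" by (rule C(1))
    show "K \<ge> 0" using d by (auto simp: K_def intro!: mult_nonneg_nonneg sum_nonneg)
    fix u assume u: "u \<in> D"
    define p where "p = (\<Sum>c\<in>C. ((c \<bullet> u) / (c \<bullet> c)) *\<^sub>R c)"
    define w where "w = u - p"
    have p: "p \<in> span B" "p \<in> D" "T p \<in> span B"
      using C(2) span_eigenvectors[OF B] by (auto simp: p_def)
    have w: "w \<in> perp B"
      using C(3)[of _ u] u p(2) subspace_D
      by (auto simp: w_def p_def perp_def inner_commute span_base subspace_diff)
    have wD: "w \<in> D" using w by (simp add: perp_def)
    have "d * norm w \<le> norm (T w - l *\<^sub>R w)"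
    proof -
      have "\<bar>(l + d) - (l - d)\<bar> / 2 = d" "((l - d) + (l + d)) / 2 = l" using d by auto
      then show ?thesis using gapB w unfolding gap_iff_midpoint by metis
    qed
    also have "\<dots> \<le> norm (T u - l *\<^sub>R u)"
    proof -
      have eq: "T u - l *\<^sub>R u = (T p - l *\<^sub>R p) + (T w - l *\<^sub>R w)"
        using T_diff[OF u p(2)] by (simp add: w_def algebra_simps)
      have "orthogonal (T p - l *\<^sub>R p) (T w - l *\<^sub>R w)"
        unfolding orthogonal_def using perp_invariant[OF B w] p by (simp add: span_diff span_scale)
      then have "(norm (T u - l *\<^sub>R u))\<^sup>2 = (norm (T p - l *\<^sub>R p))\<^sup>2 + (norm (T w - l *\<^sub>R w))\<^sup>2"
        unfolding eq by (rule norm_add_Pythagorean)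
      then show ?thesis by (intro power2_le_imp_le[of "norm (T w - l *\<^sub>R w)"]) auto
    qed
    finally have 1: "d * norm w \<le> norm (T u - l *\<^sub>R u)" .
    have "norm p \<le> (\<Sum>c\<in>C. norm (((c \<bullet> u) / (c \<bullet> c)) *\<^sub>R c))" unfolding p_def by (rule norm_sum)
    also have "\<dots> = (\<Sum>c\<in>C. (1 / norm c) * \<bar>c \<bullet> u\<bar>)"
      by (intro sum.cong) (auto simp: power2_norm_eq_inner[symmetric] power2_eq_square)
    also have "\<dots> \<le> (\<Sum>c\<in>C. (\<Sum>c\<in>C. 1 / norm c) * \<bar>c \<bullet> u\<bar>)"
      using C(1) by (intro sum_mono mult_right_mono member_le_sum) auto
    also have "\<dots> = (\<Sum>c\<in>C. 1 / norm c) * (\<Sum>c\<in>C. \<bar>c \<bullet> u\<bar>)" by (simp add: sum_distrib_left)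
    finally have "d * norm p \<le> K * (\<Sum>c\<in>C. \<bar>c \<bullet> u\<bar>)"
      using d unfolding K_def mult.assoc by (rule mult_left_mono)
    moreover have "norm u \<le> norm w + norm p" using norm_triangle_ineq[of w p] by (simp add: w_def)
    then have "d * norm u \<le> d * norm w + d * norm p" using d by (metis distrib_left mult_left_mono)
    ultimately show "d * norm u \<le> norm (T u - l *\<^sub>R u) + K * (\<Sum>c\<in>C. \<bar>c \<bullet> u\<bar>)" using 1 by simp
  qed
qed

end

section \<open>The Hilbert space of square integrable fields\<close>

lemma L2D: "f \<in> L2 \<Longrightarrow> f \<in> borel_measurable lebesgue"
  and L2D2: "f \<in> L2 \<Longrightarrow> integrable lebesgue (\<lambda>x. (norm (f x))\<^sup>2)"
  by (auto simp: L2_def)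

lemma L2I_bound:
  assumes f: "f \<in> borel_measurable lebesgue" and h: "integrable lebesgue h"
    and le: "AE x in lebesgue. (norm (f x))\<^sup>2 \<le> h x"
  shows "f \<in> L2"
proof -
  have "integrable lebesgue (\<lambda>x. (norm (f x))\<^sup>2)"
  proof (rule Bochner_Integration.integrable_bound[OF h])
    show "AE x in lebesgue. norm ((norm (f x))\<^sup>2) \<le> norm (h x)"
      using le by eventually_elim auto
  qed (use f in measurable)
  then show ?thesis using f by (simp add: L2_def)
qed

lemma L2_zero: "(\<lambda>x. 0) \<in> L2"
  by (simp add: L2_def)

lemma L2_add:
  assumes f: "f \<in> L2" and g: "g \<in> L2"
  shows "(\<lambda>x. f x + g x) \<in> L2"
proof (rule L2I_bound)
  show "(\<lambda>x. f x + g x) \<in> borel_measurable lebesgue"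
    using L2D[OF f] L2D[OF g] by measurable
  show "integrable lebesgue (\<lambda>x. 2 * (norm (f x))\<^sup>2 + 2 * (norm (g x))\<^sup>2)"
    using L2D2[OF f] L2D2[OF g] by simp
  have "(norm (f x + g x))\<^sup>2 \<le> 2 * (norm (f x))\<^sup>2 + 2 * (norm (g x))\<^sup>2" for x
  proof -
    have "(norm (f x + g x))\<^sup>2 \<le> (norm (f x) + norm (g x))\<^sup>2"
      by (intro power_mono norm_triangle_ineq) auto
    also have "\<dots> \<le> 2 * (norm (f x))\<^sup>2 + 2 * (norm (g x))\<^sup>2"
      using sum_squares_bound[of "norm (f x)" "norm (g x)"] by (simp add: power2_sum)
    finally show ?thesis .
  qed
  then show "AE x in lebesgue. (norm (f x + g x))\<^sup>2 \<le> 2 * (norm (f x))\<^sup>2 + 2 * (norm (g x))\<^sup>2"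
    by simp
qed

lemma L2_bounded_mult:
  assumes f: "f \<in> L2" and g: "g \<in> borel_measurable lebesgue"
    and le: "AE x in lebesgue. norm (g x) \<le> C * norm (f x)"
  shows "g \<in> L2"
proof (rule L2I_bound[OF g])
  show "integrable lebesgue (\<lambda>x. C\<^sup>2 * (norm (f x))\<^sup>2)" using L2D2[OF f] by simp
  show "AE x in lebesgue. (norm (g x))\<^sup>2 \<le> C\<^sup>2 * (norm (f x))\<^sup>2"
    using le by eventually_elim (metis norm_ge_zero power_mono power_mult_distrib)
qed

lemma L2_scaleR:
  assumes f: "f \<in> L2"
  shows "(\<lambda>x. r *\<^sub>R f x) \<in> L2"
  by (rule L2_bounded_mult[OF f, of _ "\<bar>r\<bar>"]) (use L2D[OF f] in auto)

lemma norm_vector_smult: "norm (c *s v) = cmod c * norm v" for v :: "complex ^ 'n::finite"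
  by (simp add: norm_vec_def L2_set_def norm_mult power_mult_distrib sum_distrib_left[symmetric]
      real_sqrt_mult)

lemma bounded_linear_vector_smult: "bounded_linear (\<lambda>v. c *s v)" for c :: complex
  by (rule bounded_linear_intro[of _ "cmod c"])
    (simp_all add: norm_vector_smult vec_eq_iff algebra_simps)

lemma L2_smult:
  assumes f: "f \<in> L2"
  shows "(\<lambda>x. c *s f x) \<in> L2"
  by (rule L2_bounded_mult[OF f, of _ "cmod c"])
    (use L2D[OF f] borel_measurable_continuous_onI[OF linear_continuous_on[OF bounded_linear_vector_smult]]
      in \<open>auto simp: norm_vector_smult intro: measurable_compose\<close>)

lemma L2_diff: "f \<in> L2 \<Longrightarrow> g \<in> L2 \<Longrightarrow> (\<lambda>x. f x - g x) \<in> L2"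
  using L2_add[of f "\<lambda>x. (-1) *\<^sub>R g x"] L2_scaleR[of g "-1"] by simp

lemma L2_inner_integrable:
  assumes f: "f \<in> L2" and g: "g \<in> L2"
  shows "integrable lebesgue (\<lambda>x. f x \<bullet> g x)"
proof (rule Bochner_Integration.integrable_bound)
  show "integrable lebesgue (\<lambda>x. (norm (f x))\<^sup>2 + (norm (g x))\<^sup>2)"
    using L2D2[OF f] L2D2[OF g] by simp
  show "(\<lambda>x. f x \<bullet> g x) \<in> borel_measurable lebesgue"
    using L2D[OF f] L2D[OF g] by measurable
  have "\<bar>f x \<bullet> g x\<bar> \<le> (norm (f x))\<^sup>2 + (norm (g x))\<^sup>2" for x
  proof -
    have "\<bar>f x \<bullet> g x\<bar> \<le> norm (f x) * norm (g x)" by (rule Cauchy_Schwarz_ineq2)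
    moreover have "0 \<le> norm (f x) * norm (g x)" by simp
    moreover have "2 * norm (f x) * norm (g x) \<le> (norm (f x))\<^sup>2 + (norm (g x))\<^sup>2"
      by (rule sum_squares_bound)
    ultimately show ?thesis by linarith
  qed
  then show "AE x in lebesgue. norm (f x \<bullet> g x) \<le> norm ((norm (f x))\<^sup>2 + (norm (g x))\<^sup>2)" by simp
qed

text \<open>
  Riesz-Fischer. Along a fast subsequence \<open>g\<close> the sum of \<open>4 ^ k |g (k+1) - g k|\<^sup>2\<close> is integrable, hence finite
  almost everywhere, so that \<open>g\<close> converges geometrically at almost every point. Fatou's lemma shows that the
  pointwise limit is also the limit in the mean.
\<close>

lemma L2_complete:
  fixes f :: "nat \<Rightarrow> ('d::finite, 'n::finite) field"
  assumes f: "\<And>n. f n \<in> L2"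
    and cauchy: "\<And>e. e > 0 \<Longrightarrow> \<exists>N. \<forall>m\<ge>N. \<forall>n\<ge>N. (\<integral>x. (norm (f m x - f n x))\<^sup>2 \<partial>lebesgue) < e"
  obtains h where "h \<in> L2"
    "\<And>e. e > 0 \<Longrightarrow> \<exists>N. \<forall>n\<ge>N. (\<integral>x. (norm (f n x - h x))\<^sup>2 \<partial>lebesgue) \<le> e"
proof -
  note [measurable] = L2D[OF f]
  have nn: "(\<integral>\<^sup>+x. ennreal ((norm (f m x - f n x))\<^sup>2) \<partial>lebesgue)
      = ennreal (\<integral>x. (norm (f m x - f n x))\<^sup>2 \<partial>lebesgue)" for m n
    by (rule nn_integral_eq_integral) (use L2D2[OF L2_diff[OF f f]] in auto)
  define Q where "Q k N \<longleftrightarrow>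
    (\<forall>m\<ge>N. \<forall>n\<ge>N. (\<integral>x. (norm (f m x - f n x))\<^sup>2 \<partial>lebesgue) < (1/16) ^ k)" for k N
  have "\<exists>N. Q k N" for k
    unfolding Q_def by (rule cauchy) simp
  then obtain N where "\<And>k. Q k (N k)" by metis
  then have N: "\<forall>m\<ge>N k. \<forall>n\<ge>N k. (\<integral>x. (norm (f m x - f n x))\<^sup>2 \<partial>lebesgue) < (1/16) ^ k" for k
    by (simp add: Q_def)
  \<comment> \<open>Both \<open>r k\<close> and \<open>r (k+1)\<close> are at least \<open>N k\<close>, and \<open>r\<close> tends to infinity.\<close>
  define r where "r k = k + sum N {..k}" for k
  have r1: "r k \<ge> k" for k by (simp add: r_def)
  have r2: "r k \<ge> N k" for k using member_le_sum[of k "{..k}" N] by (simp add: r_def)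
  have r3: "r (Suc k) \<ge> N k" for k using member_le_sum[of k "{..Suc k}" N] by (simp add: r_def)
  define g where "g k = f (r k)" for k
  have gm [measurable]: "g k \<in> borel_measurable lebesgue" for k by (simp add: g_def)
  let ?D = "\<lambda>k x. ennreal (4 ^ k * (norm (g (Suc k) x - g k x))\<^sup>2)"
  have "(\<integral>\<^sup>+x. (\<Sum>k. ?D k x) \<partial>lebesgue) = (\<Sum>k. \<integral>\<^sup>+x. ?D k x \<partial>lebesgue)"
    by (rule nn_integral_suminf) measurable
  also have "\<dots> \<le> (\<Sum>k. ennreal ((1/4) ^ k))"
  proof (rule suminf_le[OF _ summableI summableI])
    fix k
    have "(\<integral>\<^sup>+x. ?D k x \<partial>lebesgue) = ennreal (4 ^ k) * (\<integral>\<^sup>+x. ennreal ((norm (g (Suc k) x - g k x))\<^sup>2) \<partial>lebesgue)"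
      by (subst nn_integral_cmult[symmetric]) (auto simp: ennreal_mult)
    also have "\<dots> \<le> ennreal (4 ^ k) * ennreal ((1/16) ^ k)"
      unfolding g_def nn using N[of k, rule_format, OF r3 r2]
      by (intro mult_left_mono ennreal_leI less_imp_le) simp_all
    also have "\<dots> = ennreal ((1/4) ^ k)"
      by (simp add: ennreal_mult[symmetric] power_mult_distrib[symmetric])
    finally show "(\<integral>\<^sup>+x. ?D k x \<partial>lebesgue) \<le> ennreal ((1/4) ^ k)" .
  qed
  also have "\<dots> = ennreal (\<Sum>k. (1/4) ^ k)"
    by (rule suminf_ennreal2) (auto simp: summable_geometric)
  finally have fin: "(\<integral>\<^sup>+x. (\<Sum>k. ?D k x) \<partial>lebesgue) < \<infinity>"
    by (rule order.strict_trans1) simp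
  have "AE x in lebesgue. (\<Sum>k. ?D k x) \<noteq> \<infinity>"
    by (rule nn_integral_noteq_infinite) (use fin in auto)
  then have conv: "AE x in lebesgue. convergent (\<lambda>k. g k x)"
  proof eventually_elim
    case (elim x)
    define S where "S = (\<Sum>k. ?D k x)"
    have "S \<noteq> \<infinity>" unfolding S_def by (rule elim)
    then obtain C where "S = ennreal C" "C \<ge> 0" by (cases S) auto
    then have C: "(\<Sum>k. ?D k x) = ennreal C" "C \<ge> 0" unfolding S_def by blast+
    have bd: "norm (g (Suc k) x - g k x) \<le> sqrt C * (1/2) ^ k" for k
    proof -
      have "sum (\<lambda>k. ?D k x) {k} \<le> (\<Sum>k. ?D k x)"
        by (rule sum_le_suminf[OF summableI]) auto
      then have "?D k x \<le> ennreal C" unfolding C(1) by simp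
      then have "4 ^ k * (norm (g (Suc k) x - g k x))\<^sup>2 \<le> C"
        using ennreal_le_iff[OF C(2)] by blast
      moreover have "4 ^ k = (2 ^ k :: real)\<^sup>2"
        by (simp add: power2_eq_square flip: power_mult_distrib)
      ultimately have "(2 ^ k * norm (g (Suc k) x - g k x))\<^sup>2 \<le> C"
        by (simp add: power_mult_distrib)
      then have "2 ^ k * norm (g (Suc k) x - g k x) \<le> sqrt C"
        by (rule real_le_rsqrt)
      then show ?thesis by (simp add: field_simps)
    qed
    have "summable (\<lambda>k. g (Suc k) x - g k x)"
    proof (rule summable_comparison_test)
      show "summable (\<lambda>k. sqrt C * (1/2) ^ k)" by (intro summable_mult summable_geometric) simp
    qed (use bd in blast)
    then have "convergent (\<lambda>n. \<Sum>k<n. g (Suc k) x - g k x)"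
      by (simp add: summable_iff_convergent)
    then have "convergent (\<lambda>n. g n x - g 0 x)"
      by (simp only: sum_lessThan_telescope[of "\<lambda>k. g k x"])
    then show ?case
      using convergent_add[OF _ convergent_const, of "\<lambda>n. g n x - g 0 x" "g 0 x"] by simp
  qed
  define h where "h x = lim (\<lambda>k. g k x)" for x
  have hm [measurable]: "h \<in> borel_measurable lebesgue"
    unfolding h_def by measurable
  have lim: "AE x in lebesgue. (\<lambda>k. g k x) \<longlonglongrightarrow> h x"
    using conv by eventually_elim (simp add: h_def convergent_LIMSEQ_iff)
  have est: "(\<integral>\<^sup>+x. ennreal ((norm (f n x - h x))\<^sup>2) \<partial>lebesgue) \<le> ennreal e"
    if M: "\<forall>m\<ge>M. \<forall>n\<ge>M. (\<integral>x. (norm (f m x - f n x))\<^sup>2 \<partial>lebesgue) < e" and n: "n \<ge> M" for n M e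
  proof -
    have "(\<integral>\<^sup>+x. ennreal ((norm (f n x - h x))\<^sup>2) \<partial>lebesgue)
        = (\<integral>\<^sup>+x. liminf (\<lambda>k. ennreal ((norm (f n x - g k x))\<^sup>2)) \<partial>lebesgue)"
    proof (rule nn_integral_cong_AE)
      show "AE x in lebesgue. ennreal ((norm (f n x - h x))\<^sup>2) = liminf (\<lambda>k. ennreal ((norm (f n x - g k x))\<^sup>2))"
        using lim
      proof eventually_elim
        case (elim x)
        have "(\<lambda>k. ennreal ((norm (f n x - g k x))\<^sup>2)) \<longlonglongrightarrow> ennreal ((norm (f n x - h x))\<^sup>2)"
          by (intro tendsto_intros elim)
        then show ?case by (rule lim_imp_Liminf[OF trivial_limit_sequentially, symmetric])
      qed
    qed
    also have "\<dots> \<le> liminf (\<lambda>k. \<integral>\<^sup>+x. ennreal ((norm (f n x - g k x))\<^sup>2) \<partial>lebesgue)"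
      by (rule nn_integral_liminf) measurable
    also have "\<dots> \<le> ennreal e"
    proof (rule Liminf_le)
      show "\<forall>\<^sub>F k in sequentially. (\<integral>\<^sup>+x. ennreal ((norm (f n x - g k x))\<^sup>2) \<partial>lebesgue) \<le> ennreal e"
        unfolding g_def nn eventually_sequentially
      proof (intro exI[of _ M] allI impI)
        fix k assume "M \<le> k"
        then have "M \<le> r k" using r1[of k] by linarith
        then show "ennreal (\<integral>x. (norm (f n x - f (r k) x))\<^sup>2 \<partial>lebesgue) \<le> ennreal e"
          using M n by (intro ennreal_leI) (auto intro: less_imp_le)
      qed
    qed simp
    finally show ?thesis .
  qed
  have hL2: "h \<in> L2"
  proof -
    obtain M where M: "\<forall>m\<ge>M. \<forall>n\<ge>M. (\<integral>x. (norm (f m x - f n x))\<^sup>2 \<partial>lebesgue) < 1"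
      using cauchy[of 1] by auto
    have "(\<lambda>x. f M x - h x) \<in> L2"
      unfolding L2_def using est[OF M order_refl]
      by (auto intro!: integrableI_bounded simp: le_less_trans)
    then show ?thesis using L2_diff[OF f[of M], of "\<lambda>x. f M x - h x"] by simp
  qed
  show thesis
  proof
    show "h \<in> L2" by (rule hL2)
    fix e :: real assume e: "e > 0"
    then obtain M where M: "\<forall>m\<ge>M. \<forall>n\<ge>M. (\<integral>x. (norm (f m x - f n x))\<^sup>2 \<partial>lebesgue) < e"
      using cauchy by blast
    show "\<exists>N. \<forall>n\<ge>N. (\<integral>x. (norm (f n x - h x))\<^sup>2 \<partial>lebesgue) \<le> e"
    proof (intro exI[of _ M] allI impI)
      fix n assume "n \<ge> M"
      have "ennreal (\<integral>x. (norm (f n x - h x))\<^sup>2 \<partial>lebesgue)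
          = (\<integral>\<^sup>+x. ennreal ((norm (f n x - h x))\<^sup>2) \<partial>lebesgue)"
        by (rule nn_integral_eq_integral[symmetric]) (use L2D2[OF L2_diff[OF f hL2]] in auto)
      also have "\<dots> \<le> ennreal e" by (rule est[OF M \<open>n \<ge> M\<close>])
      finally show "(\<integral>x. (norm (f n x - h x))\<^sup>2 \<partial>lebesgue) \<le> e"
        using e by (simp add: ennreal_le_iff)
    qed
  qed
qed

text \<open>
  Square integrable fields modulo equality almost everywhere. Passing to classes turns the seminorm into
  a norm and makes the Hilbert space results above applicable. As all fields have values in \<open>\<complex>\<^sup>n\<close> with its real
  scalar product, the scalar product of classes is the real part of \<^const>\<open>L2_inner\<close>.
\<close>

quotient_type (overloaded) ('d, 'n) l2 = "('d::finite, 'n::finite) field" /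
  partial: "\<lambda>f g. f \<in> L2 \<and> g \<in> L2 \<and> ae_eq f g"
  morphisms rep cls
proof (rule part_equivpI)
  show "\<exists>f::('d, 'n) field. f \<in> L2 \<and> f \<in> L2 \<and> ae_eq f f" using L2_zero by auto
  show "symp (\<lambda>f g::('d, 'n) field. f \<in> L2 \<and> g \<in> L2 \<and> ae_eq f g)"
    by (rule sympI) (auto elim: AE_mp)
  show "transp (\<lambda>f g::('d, 'n) field. f \<in> L2 \<and> g \<in> L2 \<and> ae_eq f g)"
    by (rule transpI) (auto elim: AE_mp)
qed

instantiation l2 :: (finite, finite) real_inner
begin

lift_definition zero_l2 :: "('a, 'b) l2" is "\<lambda>x. 0" by (simp add: L2_zero)
lift_definition plus_l2 :: "('a, 'b) l2 \<Rightarrow> ('a, 'b) l2 \<Rightarrow> ('a, 'b) l2" is "\<lambda>f g x. f x + g x"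
  by (auto intro: L2_add)
lift_definition minus_l2 :: "('a, 'b) l2 \<Rightarrow> ('a, 'b) l2 \<Rightarrow> ('a, 'b) l2" is "\<lambda>f g x. f x - g x"
  by (auto intro: L2_diff)
lift_definition uminus_l2 :: "('a, 'b) l2 \<Rightarrow> ('a, 'b) l2" is "\<lambda>f x. - f x"
  using L2_scaleR[of _ "-1"] by auto
lift_definition scaleR_l2 :: "real \<Rightarrow> ('a, 'b) l2 \<Rightarrow> ('a, 'b) l2" is "\<lambda>r f x. r *\<^sub>R f x"
  by (auto intro: L2_scaleR)
lift_definition inner_l2 :: "('a, 'b) l2 \<Rightarrow> ('a, 'b) l2 \<Rightarrow> real" is "\<lambda>f g. \<integral>x. f x \<bullet> g x \<partial>lebesgue"
  by (rule integral_cong_AE) (auto intro!: borel_measurable_inner L2D)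

definition norm_l2 :: "('a, 'b) l2 \<Rightarrow> real" where "norm_l2 u = sqrt (u \<bullet> u)"
definition sgn_l2 :: "('a, 'b) l2 \<Rightarrow> ('a, 'b) l2" where "sgn_l2 u = inverse (norm u) *\<^sub>R u"
definition dist_l2 :: "('a, 'b) l2 \<Rightarrow> ('a, 'b) l2 \<Rightarrow> real" where "dist_l2 u v = norm (u - v)"
definition uniformity_l2 :: "(('a, 'b) l2 \<times> ('a, 'b) l2) filter"
  where "uniformity_l2 = (INF e\<in>{0<..}. principal {(u, v). dist u v < e})"
definition open_l2 :: "('a, 'b) l2 set \<Rightarrow> bool"
  where "open_l2 U \<longleftrightarrow> (\<forall>u\<in>U. eventually (\<lambda>(u', v). u' = u \<longrightarrow> v \<in> U) uniformity)"

instance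
proof
  fix u v w :: "('a, 'b) l2" and r s :: real and U :: "('a, 'b) l2 set"
  show "u + v + w = u + (v + w)" by transfer (auto simp: add.assoc intro: L2_add)
  show "u + v = v + u" by transfer (auto simp: add.commute intro: L2_add)
  show "0 + u = u" by transfer auto
  show "- u + u = 0" by transfer (auto simp: L2_zero)
  show "u - v = u + - v" by transfer (auto intro: L2_diff)
  show "r *\<^sub>R (u + v) = r *\<^sub>R u + r *\<^sub>R v" by transfer (auto simp: scaleR_add_right intro: L2_add L2_scaleR)
  show "(r + s) *\<^sub>R u = r *\<^sub>R u + s *\<^sub>R u" by transfer (auto simp: scaleR_add_left intro: L2_add L2_scaleR)
  show "r *\<^sub>R s *\<^sub>R u = (r * s) *\<^sub>R u" by transfer (auto intro: L2_scaleR)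
  show "1 *\<^sub>R u = u" by transfer auto
  show "sgn u = inverse (norm u) *\<^sub>R u" by (rule sgn_l2_def)
  show "norm u = sqrt (u \<bullet> u)" by (rule norm_l2_def)
  show "dist u v = norm (u - v)" by (rule dist_l2_def)
  show "(uniformity :: (('a, 'b) l2 \<times> ('a, 'b) l2) filter) = (INF e\<in>{0<..}. principal {(u, v). dist u v < e})"
    by (rule uniformity_l2_def)
  show "open U \<longleftrightarrow> (\<forall>u\<in>U. eventually (\<lambda>(u', v). u' = u \<longrightarrow> v \<in> U) uniformity)" by (rule open_l2_def)
  show "u \<bullet> v = v \<bullet> u" by transfer (simp add: inner_commute)
  show "(u + v) \<bullet> w = u \<bullet> w + v \<bullet> w"
    by transfer (simp add: inner_add_left L2_inner_integrable)
  show "(r *\<^sub>R u) \<bullet> v = r * (u \<bullet> v)" by transfer simp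
  show "0 \<le> u \<bullet> u" by transfer simp
  show "(u \<bullet> u = 0) = (u = 0)"
    by transfer (auto simp: integral_nonneg_eq_0_iff_AE L2_inner_integrable L2_zero)
qed

end

lemma rep_L2: "rep u \<in> L2"
  using Quotient3_rep_reflp[OF Quotient3_l2, of u] by simp

lemma cls_rep: "cls (rep u) = u"
  by (rule Quotient3_abs_rep[OF Quotient3_l2])

lemma cls_eq_iff: "f \<in> L2 \<Longrightarrow> g \<in> L2 \<Longrightarrow> cls f = cls g \<longleftrightarrow> ae_eq f g"
  using Quotient3_rel[OF Quotient3_l2, of f g] by simp

lemma rep_cls: "f \<in> L2 \<Longrightarrow> ae_eq (rep (cls f)) f"
  using cls_eq_iff[OF rep_L2] cls_rep by blast

lemma cls_add: "f \<in> L2 \<Longrightarrow> g \<in> L2 \<Longrightarrow> cls f + cls g = cls (\<lambda>x. f x + g x)"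
  by (simp add: plus_l2.abs_eq)

lemma cls_diff: "f \<in> L2 \<Longrightarrow> g \<in> L2 \<Longrightarrow> cls f - cls g = cls (\<lambda>x. f x - g x)"
  by (simp add: minus_l2.abs_eq)

lemma cls_scaleR: "f \<in> L2 \<Longrightarrow> r *\<^sub>R cls f = cls (\<lambda>x. r *\<^sub>R f x)"
  by (simp add: scaleR_l2.abs_eq)

lemma cls_inner: "f \<in> L2 \<Longrightarrow> g \<in> L2 \<Longrightarrow> cls f \<bullet> cls g = (\<integral>x. f x \<bullet> g x \<partial>lebesgue)"
  by (simp add: inner_l2.abs_eq)

lemma norm_cls: "f \<in> L2 \<Longrightarrow> norm (cls f) = L2_norm f"
  by (simp add: norm_eq_sqrt_inner cls_inner L2_norm_def power2_norm_eq_inner)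

instance l2 :: (finite, finite) complete_space
proof
  fix X :: "nat \<Rightarrow> ('a, 'b) l2"
  assume X: "Cauchy X"
  have nrm: "(\<integral>x. (norm (f x - g x))\<^sup>2 \<partial>lebesgue) = (dist (cls f) (cls g))\<^sup>2"
    if "f \<in> L2" "g \<in> L2" for f g :: "('a, 'b) field"
    using that by (simp add: dist_norm cls_diff norm_cls L2_diff L2_norm_def)
  obtain h where h: "h \<in> L2"
    "\<And>e. e > 0 \<Longrightarrow> \<exists>N. \<forall>n\<ge>N. (\<integral>x. (norm (rep (X n) x - h x))\<^sup>2 \<partial>lebesgue) \<le> e"
  proof (rule L2_complete[of "\<lambda>n. rep (X n)"])
    fix e :: real assume e: "e > 0"
    then obtain N where "\<forall>m\<ge>N. \<forall>n\<ge>N. dist (X m) (X n) < sqrt e"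
      using metric_CauchyD[OF X, of "sqrt e"] by auto
    then show "\<exists>N. \<forall>m\<ge>N. \<forall>n\<ge>N. (\<integral>x. (norm (rep (X m) x - rep (X n) x))\<^sup>2 \<partial>lebesgue) < e"
      unfolding nrm[OF rep_L2 rep_L2] cls_rep
      by (metis e real_sqrt_less_iff real_sqrt_abs abs_of_nonneg zero_le_dist)
  qed (auto simp: rep_L2)
  have "X \<longlonglongrightarrow> cls h"
  proof (rule metric_LIMSEQ_I)
    fix e :: real assume e: "e > 0"
    obtain N where N: "\<forall>n\<ge>N. (dist (X n) (cls h))\<^sup>2 \<le> (e / 2)\<^sup>2"
      using h(2)[of "(e / 2)\<^sup>2"] e unfolding nrm[OF rep_L2 h(1)] cls_rep by auto
    have "dist (X n) (cls h) < e" if "n \<ge> N" for n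
    proof -
      have "dist (X n) (cls h) \<le> e / 2"
        by (rule power2_le_imp_le) (use N that e in auto)
      then show ?thesis using e by simp
    qed
    then show "\<exists>N. \<forall>n\<ge>N. dist (X n) (cls h) < e" by blast
  qed
  then show "convergent X" by (auto simp: convergent_def)
qed

section \<open>Smooth functions\<close>

lemma partial_deriv_eq:
  "(f has_derivative f') (at x) \<Longrightarrow> partial_deriv j f x = f' (axis j 1)"
  unfolding partial_deriv_def by (metis frechet_derivative_at)

lemma has_derivative_chain:
  assumes "f differentiable (at x)" "(h has_real_derivative h') (at (f x))"
  shows "((\<lambda>x. h (f x)) has_derivative (\<lambda>v. h' * frechet_derivative f (at x) v)) (at x)"
proof -
  have "((h \<circ> f) has_derivative ((*) h' \<circ> frechet_derivative f (at x))) (at x)"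
    using assms by (intro diff_chain_at)
      (auto simp: has_field_derivative_def frechet_derivative_works)
  then show ?thesis by (simp add: o_def)
qed

lemma differentiable_chain_partial:
  assumes "f differentiable (at x)" "(h has_real_derivative h') (at (f x))"
  shows "(\<lambda>x. h (f x)) differentiable (at x)"
    and "partial_deriv j (\<lambda>x. h (f x)) x = h' * partial_deriv j f x"
  using has_derivative_chain[OF assms] partial_deriv_eq[OF has_derivative_chain[OF assms]]
  by (auto simp: differentiable_def partial_deriv_def)

lemma partial_deriv_mult:
  assumes "f differentiable (at x)" "g differentiable (at x)"
  shows "partial_deriv j (\<lambda>x. f x * g x) x = f x * partial_deriv j g x + partial_deriv j f x * g x"
  using partial_deriv_eq[OF has_derivative_mult[OF assms[THEN frechet_derivative_works[THEN iffD1]]]]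
  by (simp add: partial_deriv_def)

lemma partial_deriv_add:
  assumes "f differentiable (at x)" "g differentiable (at x)"
  shows "partial_deriv j (\<lambda>x. f x + g x) x = partial_deriv j f x + partial_deriv j g x"
  using partial_deriv_eq[OF has_derivative_add[OF assms[THEN frechet_derivative_works[THEN iffD1]]]]
  by (simp add: partial_deriv_def)

text \<open>
  The functions \<open>exp (- 1 / t) / t ^ k\<close>, extended by zero. The derivative of one of them is a linear
  combination of others, and \<open>k = 0\<close> is the standard smooth function that vanishes exactly on a half-line.
\<close>

definition flat_exp :: "nat \<Rightarrow> real \<Rightarrow> real"
  where "flat_exp k t = (if t > 0 then exp (- inverse t) * inverse t ^ k else 0)"

lemma flat_exp_nonneg: "0 \<le> flat_exp k t"
  by (simp add: flat_exp_def)

lemma power_le_fact_exp: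
  fixes y :: real assumes "0 \<le> y" shows "y ^ n \<le> fact n * exp y"
proof -
  have "(\<Sum>m\<in>{n}. y ^ m /\<^sub>R fact m) \<le> (\<Sum>m. y ^ m /\<^sub>R fact m)"
    using assms exp_converges[of y] by (intro sum_le_suminf) (auto simp: sums_iff)
  also have "\<dots> = exp y" using exp_converges[of y] by (simp add: sums_iff)
  finally show ?thesis by (simp add: field_simps)
qed

lemma flat_exp_le: "flat_exp k t \<le> fact k"
proof (cases "t > 0")
  case True
  then have "inverse t ^ k \<le> fact k * exp (inverse t)" by (intro power_le_fact_exp) auto
  then have "exp (- inverse t) * inverse t ^ k \<le> exp (- inverse t) * (fact k * exp (inverse t))"
    by (intro mult_left_mono) auto
  also have "\<dots> = fact k" by (simp add: exp_minus field_simps)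
  finally show ?thesis using True by (simp add: flat_exp_def)
qed (simp add: flat_exp_def)

text \<open>
  A quadratic bound, so that the derivative at \<open>0\<close> exists and is \<open>0\<close>.
\<close>

lemma flat_exp_quadratic: "flat_exp k t \<le> fact (k + 2) * t\<^sup>2"
proof (cases "t > 0")
  case True
  have "flat_exp k t = flat_exp (k + 2) t * t\<^sup>2"
    using True by (simp add: flat_exp_def power_add power_inverse field_simps power2_eq_square)
  also have "\<dots> \<le> fact (k + 2) * t\<^sup>2" by (intro mult_right_mono flat_exp_le) auto
  finally show ?thesis .
qed (simp add: flat_exp_def)

lemma flat_exp_deriv: "(flat_exp k has_real_derivative flat_exp (k + 2) t - real k * flat_exp (k + 1) t) (at t)"
proof -
  consider "t > 0" | "t < 0" | "t = 0" by linarith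
  then show ?thesis
  proof cases
    case 1
    have d1: "(inverse has_real_derivative - (inverse t ^ 2)) (at t)"
      using DERIV_inverse[of t] 1 by (simp add: numeral_2_eq_2)
    have d2: "((\<lambda>t. inverse t ^ k) has_real_derivative - real k * inverse t ^ (k + 1)) (at t)"
    proof (cases k)
      case (Suc n)
      show ?thesis
        unfolding Suc using DERIV_power_Suc[OF d1, of n] by (simp add: power2_eq_square algebra_simps)
    qed simp
    have d3: "((\<lambda>t. exp (- inverse t)) has_real_derivative exp (- inverse t) * inverse t ^ 2) (at t)"
      using DERIV_chain2[OF DERIV_exp DERIV_minus[OF d1]] by simp
    have "((\<lambda>t. exp (- inverse t) * inverse t ^ k) has_real_derivative
        flat_exp (k + 2) t - real k * flat_exp (k + 1) t) (at t)"
      using DERIV_mult[OF d3 d2] 1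
      by (simp add: flat_exp_def algebra_simps power_add power2_eq_square)
    then show ?thesis
      by (rule has_field_derivative_transform_within_open[where S = "{0<..}"])
        (use 1 in \<open>auto simp: flat_exp_def\<close>)
  next
    case 2
    have "((\<lambda>t. 0) has_real_derivative flat_exp (k + 2) t - real k * flat_exp (k + 1) t) (at t)"
      using 2 by (simp add: flat_exp_def)
    then show ?thesis
      by (rule has_field_derivative_transform_within_open[where S = "{..<0}"])
        (use 2 in \<open>auto simp: flat_exp_def\<close>)
  next
    case 3
    have "((\<lambda>h. (flat_exp k (0 + h) - flat_exp k 0) / h) \<longlongrightarrow> 0) (at 0)"
    proof (rule Lim_null_comparison)
      show "\<forall>\<^sub>F h in at 0. norm ((flat_exp k (0 + h) - flat_exp k 0) / h) \<le> fact (k + 2) * \<bar>h\<bar>"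
      proof (rule always_eventually, rule allI)
        fix h :: real
        show "norm ((flat_exp k (0 + h) - flat_exp k 0) / h) \<le> fact (k + 2) * \<bar>h\<bar>"
        proof (cases "h = 0")
          case False
          have "\<bar>flat_exp k h\<bar> \<le> fact (k + 2) * \<bar>h\<bar> * \<bar>h\<bar>"
            using flat_exp_quadratic[of k h] flat_exp_nonneg[of k h] by (simp add: power2_eq_square)
          then show ?thesis using False by (simp add: flat_exp_def[of k 0] divide_le_eq)
        qed simp
      qed
      have "((\<lambda>h::real. fact (k + 2) * \<bar>h\<bar>) \<longlongrightarrow> fact (k + 2) * \<bar>0\<bar>) (at 0)"
        by (intro tendsto_intros)
      then show "((\<lambda>h::real. fact (k + 2) * \<bar>h\<bar>) \<longlongrightarrow> 0) (at 0)" by simp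
    qed
    then show ?thesis using 3 by (simp add: DERIV_def flat_exp_def)
  qed
qed

text \<open>
  The rule \<open>base\<close> makes this the set of all infinitely differentiable functions. The other rules
  list the operations needed to build bump functions and weights. Differentiability to all orders need not
  be checked for each of them: it suffices that every function built by the rules is differentiable with partial
  derivatives that are built by the rules again.
\<close>

inductive_set smooth :: "(real ^ 'd::finite \<Rightarrow> real) set" where
  base: "(\<And>k. times_differentiable k f) \<Longrightarrow> f \<in> smooth"
| const: "(\<lambda>x. c) \<in> smooth"
| coord: "(\<lambda>x. x $ i) \<in> smooth"
| add: "f \<in> smooth \<Longrightarrow> g \<in> smooth \<Longrightarrow> (\<lambda>x. f x + g x) \<in> smooth"
| mult: "f \<in> smooth \<Longrightarrow> g \<in> smooth \<Longrightarrow> (\<lambda>x. f x * g x) \<in> smooth"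
| inverse: "f \<in> smooth \<Longrightarrow> (\<And>x. f x > 0) \<Longrightarrow> (\<lambda>x. inverse (f x)) \<in> smooth"
| sqrt: "f \<in> smooth \<Longrightarrow> (\<And>x. f x > 0) \<Longrightarrow> (\<lambda>x. sqrt (f x)) \<in> smooth"
| exp: "f \<in> smooth \<Longrightarrow> (\<lambda>x. exp (f x)) \<in> smooth"
| flat_exp: "f \<in> smooth \<Longrightarrow> (\<lambda>x. flat_exp k (f x)) \<in> smooth"

lemma smooth_partial_deriv_closed:
  fixes f :: "real ^ 'd::finite \<Rightarrow> real"
  assumes "f \<in> smooth"
  shows "(\<forall>x. f differentiable (at x)) \<and> (\<forall>j. partial_deriv j f \<in> smooth)"
  using assms
proof induction
  case (base f)
  show ?case
  proof (intro conjI allI)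
    fix j
    have "times_differentiable k (partial_deriv j f)" for k using base[of "Suc k"] by simp
    then show "partial_deriv j f \<in> smooth" by (rule smooth.base)
  qed (use base[of "Suc 0"] in auto)
next
  case (const c)
  have "partial_deriv j (\<lambda>x::real^'d. c) = (\<lambda>x. 0)" for j
    by (rule ext) (use partial_deriv_eq[OF has_derivative_const] in auto)
  then show ?case by (auto intro: smooth.const)
next
  case (coord i)
  have *: "((\<lambda>x. x $ i) has_derivative (\<lambda>x. x $ i)) (at x)" for x :: "real ^ 'd"
    by (intro bounded_linear_imp_has_derivative bounded_linear_vec_nth)
  then have "partial_deriv j (\<lambda>x::real^'d. x $ i) = (\<lambda>x. axis j 1 $ i)" for j
    by (intro ext) (rule partial_deriv_eq)
  then show ?case using * by (auto intro: smooth.const simp: differentiable_def)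
next
  case (add f g)
  then have "partial_deriv j (\<lambda>x. f x + g x) = (\<lambda>x. partial_deriv j f x + partial_deriv j g x)" for j
    by (intro ext partial_deriv_add) auto
  then show ?case using add by (auto intro: smooth.add)
next
  case (mult f g)
  then have "partial_deriv j (\<lambda>x. f x * g x)
      = (\<lambda>x. f x * partial_deriv j g x + partial_deriv j f x * g x)" for j
    by (intro ext partial_deriv_mult) auto
  then show ?case using mult by (auto intro!: smooth.add smooth.mult)
next
  case (inverse f)
  have d: "(Fields.inverse has_real_derivative (-1) * (inverse (f x) * inverse (f x))) (at (f x))" for x
    using DERIV_inverse[of "f x" UNIV] inverse(2)[of x] by (simp add: power2_eq_square)
  have eq: "partial_deriv j (\<lambda>x. inverse (f x))
      = (\<lambda>x. ((-1) * (inverse (f x) * inverse (f x))) * partial_deriv j f x)" for j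
    using inverse by (intro ext differentiable_chain_partial(2)[OF _ d]) auto
  have "partial_deriv j (\<lambda>x. inverse (f x)) \<in> smooth" for j
    unfolding eq using inverse by (intro smooth.mult smooth.const smooth.inverse) auto
  moreover have "(\<lambda>x. inverse (f x)) differentiable (at x)" for x
    using inverse by (intro differentiable_chain_partial(1)[OF _ d]) auto
  ultimately show ?case by blast
next
  case (sqrt f)
  have d: "(NthRoot.sqrt has_real_derivative (1/2) * inverse (sqrt (f x))) (at (f x))" for x
    using DERIV_real_sqrt[of "f x"] sqrt(2)[of x] by (simp add: field_simps)
  have eq: "partial_deriv j (\<lambda>x. sqrt (f x))
      = (\<lambda>x. ((1/2) * inverse (sqrt (f x))) * partial_deriv j f x)" for j
    using sqrt by (intro ext differentiable_chain_partial(2)[OF _ d]) auto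
  have "partial_deriv j (\<lambda>x. sqrt (f x)) \<in> smooth" for j
    unfolding eq using sqrt by (intro smooth.mult smooth.const smooth.inverse smooth.sqrt) auto
  moreover have "(\<lambda>x. sqrt (f x)) differentiable (at x)" for x
    using sqrt by (intro differentiable_chain_partial(1)[OF _ d]) auto
  ultimately show ?case by blast
next
  case (exp f)
  have d: "(Transcendental.exp has_real_derivative exp (f x)) (at (f x))" for x
    by (rule DERIV_exp)
  have eq: "partial_deriv j (\<lambda>x. exp (f x)) = (\<lambda>x. exp (f x) * partial_deriv j f x)" for j
    using exp by (intro ext differentiable_chain_partial(2)[OF _ d]) auto
  have "partial_deriv j (\<lambda>x. exp (f x)) \<in> smooth" for j
    unfolding eq using exp by (intro smooth.mult smooth.exp) auto
  moreover have "(\<lambda>x. exp (f x)) differentiable (at x)" for x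
    using exp by (intro differentiable_chain_partial(1)[OF _ d]) auto
  ultimately show ?case by blast
next
  case (flat_exp f k)
  have d: "(flat_exp k has_real_derivative flat_exp (k + 2) (f x) + (- real k) * flat_exp (k + 1) (f x)) (at (f x))" for x
    using flat_exp_deriv[of k "f x"] by simp
  have eq: "partial_deriv j (\<lambda>x. flat_exp k (f x))
      = (\<lambda>x. (flat_exp (k + 2) (f x) + (- real k) * flat_exp (k + 1) (f x)) * partial_deriv j f x)" for j
    using flat_exp by (intro ext differentiable_chain_partial(2)[OF _ d]) auto
  have "partial_deriv j (\<lambda>x. flat_exp k (f x)) \<in> smooth" for j
    unfolding eq using flat_exp by (intro smooth.mult smooth.const smooth.add smooth.flat_exp) auto
  moreover have "(\<lambda>x. flat_exp k (f x)) differentiable (at x)" for x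
    using flat_exp by (intro differentiable_chain_partial(1)[OF _ flat_exp_deriv]) auto
  ultimately show ?case by blast
qed

lemma smooth_differentiable: "f \<in> smooth \<Longrightarrow> f differentiable (at x)"
  and smooth_partial: "f \<in> smooth \<Longrightarrow> partial_deriv j f \<in> smooth"
  using smooth_partial_deriv_closed by blast+

lemma smooth_continuous: "f \<in> smooth \<Longrightarrow> continuous_on UNIV f"
  by (meson smooth_differentiable continuous_at_imp_continuous_on differentiable_imp_continuous_within)

lemma smooth_times_differentiable: "f \<in> smooth \<Longrightarrow> times_differentiable k f"
  by (induction k arbitrary: f) (auto simp: smooth_continuous smooth_differentiable smooth_partial)

lemma smooth_sum:
  assumes "\<And>i. i \<in> I \<Longrightarrow> f i \<in> smooth" shows "(\<lambda>x. \<Sum>i\<in>I. f i x) \<in> smooth"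
  using assms by (induction I rule: infinite_finite_induct) (auto intro: smooth.intros)

lemma smooth_prod:
  assumes "\<And>i. i \<in> I \<Longrightarrow> f i \<in> smooth" shows "(\<lambda>x. \<Prod>i\<in>I. f i x) \<in> smooth"
  using assms by (induction I rule: infinite_finite_induct) (auto intro: smooth.intros)

lemma test_functions_iff:
  "f \<in> test_functions \<longleftrightarrow> f \<in> smooth \<and> (\<exists>K. compact K \<and> (\<forall>x. x \<notin> K \<longrightarrow> f x = 0))"
  unfolding test_functions_def using smooth.base smooth_times_differentiable by blast

lemma partial_deriv_support:
  assumes "compact K" "\<And>x. x \<notin> K \<Longrightarrow> f x = 0" "x \<notin> K"
  shows "partial_deriv j f x = 0"
proof -
  have "((\<lambda>x. 0) has_derivative (\<lambda>x. 0)) (at x)" by simp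
  then have "(f has_derivative (\<lambda>x. 0)) (at x)"
    by (rule has_derivative_transform_within_open[of _ _ _ _ "- K"])
      (use assms compact_imp_closed in auto)
  then show ?thesis by (simp add: partial_deriv_eq)
qed

lemma partial_deriv_test_functions:
  assumes "f \<in> test_functions" shows "partial_deriv j f \<in> test_functions"
proof -
  obtain K where "compact K" "\<And>x. x \<notin> K \<Longrightarrow> f x = 0" and f: "f \<in> smooth"
    using assms unfolding test_functions_iff by blast
  then show ?thesis
    unfolding test_functions_iff using partial_deriv_support smooth_partial by blast
qed

lemma mult_test_functions:
  assumes "f \<in> smooth" "\<phi> \<in> test_functions" shows "(\<lambda>x. f x * \<phi> x) \<in> test_functions"
  using assms unfolding test_functions_iff by (auto intro: smooth.mult)

section \<open>Products with smooth functions in the sense of distributions\<close>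

lemma L1_loc_mult:
  assumes \<eta>: "continuous_on UNIV \<eta>" and f: "f \<in> L1_loc"
  shows "(\<lambda>x. \<eta> x *\<^sub>R f x) \<in> L1_loc"
proof -
  have \<eta>m [measurable]: "\<eta> \<in> borel_measurable lebesgue"
    using borel_measurable_continuous_onI[OF \<eta>] by (simp add: measurable_completion)
  have fm [measurable]: "f \<in> borel_measurable lebesgue" using f by (simp add: L1_loc_def)
  have "set_integrable lebesgue K (\<lambda>x. \<eta> x *\<^sub>R f x)" if K: "compact K" for K
  proof -
    have [measurable]: "K \<in> sets lebesgue" using K by (simp add: lmeasurable_compact fmeasurableD)
    obtain B where B: "\<And>x. x \<in> K \<Longrightarrow> \<bar>\<eta> x\<bar> \<le> B"
      using compact_imp_bounded[OF compact_continuous_image[OF continuous_on_subset[OF \<eta>] K]]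
      unfolding bounded_iff by auto
    have "integrable lebesgue (\<lambda>x. indicat_real K x *\<^sub>R (\<eta> x *\<^sub>R f x))"
    proof (rule Bochner_Integration.integrable_bound)
      show "integrable lebesgue (\<lambda>x. B *\<^sub>R (indicat_real K x *\<^sub>R f x))"
        using f K by (intro integrable_scaleR_right) (simp add: L1_loc_def set_integrable_def)
      show "AE x in lebesgue. norm (indicat_real K x *\<^sub>R (\<eta> x *\<^sub>R f x)) \<le> norm (B *\<^sub>R (indicat_real K x *\<^sub>R f x))"
      proof (rule AE_I2)
        fix x
        have "\<bar>\<eta> x\<bar> * norm (f x) \<le> \<bar>B\<bar> * norm (f x)" if "x \<in> K"
          using B[OF that] by (intro mult_right_mono) auto
        then show "norm (indicat_real K x *\<^sub>R (\<eta> x *\<^sub>R f x)) \<le> norm (B *\<^sub>R (indicat_real K x *\<^sub>R f x))"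
          by (auto simp: indicator_def)
      qed
    qed measurable
    then show ?thesis by (simp add: set_integrable_def)
  qed
  moreover have "(\<lambda>x. \<eta> x *\<^sub>R f x) \<in> borel_measurable lebesgue" by measurable
  ultimately show ?thesis by (simp add: L1_loc_def)
qed

lemma L1_loc_add: "f \<in> L1_loc \<Longrightarrow> g \<in> L1_loc \<Longrightarrow> (\<lambda>x. f x + g x) \<in> L1_loc"
  unfolding L1_loc_def by (auto intro: set_integral_add)

lemma L1_loc_diff: "f \<in> L1_loc \<Longrightarrow> g \<in> L1_loc \<Longrightarrow> (\<lambda>x. f x - g x) \<in> L1_loc"
  unfolding L1_loc_def by (auto intro: set_integral_diff)

lemma L1_loc_zero: "(\<lambda>x. 0) \<in> L1_loc"
  unfolding L1_loc_def by (auto simp: set_integrable_def)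

lemma L1_loc_sum:
  assumes "\<And>i. i \<in> I \<Longrightarrow> f i \<in> L1_loc" shows "(\<lambda>x. \<Sum>i\<in>I. f i x) \<in> L1_loc"
  using assms by (induction I rule: infinite_finite_induct) (auto intro: L1_loc_zero L1_loc_add)

lemma L1_loc_linear:
  assumes T: "bounded_linear T" and f: "f \<in> L1_loc"
  shows "(\<lambda>x. T (f x)) \<in> L1_loc"
proof -
  have "(\<lambda>x. T (f x)) \<in> borel_measurable lebesgue"
    using f borel_measurable_continuous_onI[OF linear_continuous_on[OF T]]
    by (auto simp: L1_loc_def intro: measurable_compose)
  moreover have "set_integrable lebesgue K (\<lambda>x. T (f x))" if "compact K" for K
  proof -
    have "integrable lebesgue (\<lambda>x. T (indicat_real K x *\<^sub>R f x))"
      using f that by (intro integrable_bounded_linear[OF T]) (simp add: L1_loc_def set_integrable_def)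
    then show ?thesis by (simp add: set_integrable_def linear_scale[OF bounded_linear.linear[OF T]])
  qed
  ultimately show ?thesis by (simp add: L1_loc_def)
qed

lemma integrable_test:
  assumes \<phi>: "\<phi> \<in> test_functions" and f: "f \<in> L1_loc"
  shows "integrable lebesgue (\<lambda>x. \<phi> x *\<^sub>R f x)"
proof -
  obtain K where K: "compact K" "\<And>x. x \<notin> K \<Longrightarrow> \<phi> x = 0" and s: "\<phi> \<in> smooth"
    using \<phi> unfolding test_functions_iff by blast
  have "set_integrable lebesgue K (\<lambda>x. \<phi> x *\<^sub>R f x)"
    using L1_loc_mult[OF smooth_continuous[OF s] f] K by (simp add: L1_loc_def)
  moreover have "(\<lambda>x. indicat_real K x *\<^sub>R (\<phi> x *\<^sub>R f x)) = (\<lambda>x. \<phi> x *\<^sub>R f x)"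
    using K(2) by (intro ext) (auto simp: indicator_def)
  ultimately show ?thesis by (simp only: set_integrable_def)
qed

text \<open>
  The product rule. A smooth factor can be moved to the test function, so the rule for distributions
  reduces to \<open>\<eta> \<partial>\<phi> = \<partial>(\<eta> \<phi>) - (\<partial>\<eta>) \<phi>\<close>. For this reason all weights are chosen smooth.
\<close>

lemma is_symbol_deriv_mult:
  assumes \<eta>: "\<eta> \<in> smooth" and sd: "is_symbol_deriv A f g"
  shows "is_symbol_deriv A (\<lambda>x. \<eta> x *\<^sub>R f x)
    (\<lambda>x. \<eta> x *\<^sub>R g x + (\<Sum>j\<in>UNIV. partial_deriv j \<eta> x *\<^sub>R (A j *v f x)))"
proof -
  have f: "f \<in> L1_loc" and g: "g \<in> L1_loc"
    and eq: "\<And>\<phi>. \<phi> \<in> test_functions \<Longrightarrow> (\<Sum>j\<in>UNIV. A j *v distr_deriv j f \<phi>) = regular_distr g \<phi>"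
    using sd by (auto simp: is_symbol_deriv_def)
  have Af: "(\<lambda>x. A j *v f x) \<in> L1_loc" for j
    by (rule L1_loc_linear[OF matrix_vector_mul_bounded_linear f])
  have dAf: "(\<lambda>x. partial_deriv j \<eta> x *\<^sub>R (A j *v f x)) \<in> L1_loc" for j
    by (intro L1_loc_mult smooth_continuous smooth_partial \<eta> Af)
  have "(\<Sum>j\<in>UNIV. A j *v distr_deriv j (\<lambda>x. \<eta> x *\<^sub>R f x) \<phi>)
      = regular_distr (\<lambda>x. \<eta> x *\<^sub>R g x + (\<Sum>j\<in>UNIV. partial_deriv j \<eta> x *\<^sub>R (A j *v f x))) \<phi>"
    if \<phi>: "\<phi> \<in> test_functions" for \<phi>
  proof -
    have \<phi>s: "\<phi> \<in> smooth" using \<phi> by (simp add: test_functions_iff)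
    have \<eta>\<phi>: "(\<lambda>x. \<eta> x * \<phi> x) \<in> test_functions" by (rule mult_test_functions[OF \<eta> \<phi>])
    have d\<eta>\<phi>: "(\<lambda>x. partial_deriv j \<eta> x * \<phi> x) \<in> test_functions" for j
      by (rule mult_test_functions[OF smooth_partial[OF \<eta>] \<phi>])
    have prod_rule: "A j *v distr_deriv j (\<lambda>x. \<eta> x *\<^sub>R f x) \<phi>
        = A j *v distr_deriv j f (\<lambda>x. \<eta> x * \<phi> x)
          + (\<integral>x. \<phi> x *\<^sub>R (partial_deriv j \<eta> x *\<^sub>R (A j *v f x)) \<partial>lebesgue)" for j
    proof -
      have "distr_deriv j (\<lambda>x. \<eta> x *\<^sub>R f x) \<phi>
          = - (\<integral>x. partial_deriv j (\<lambda>x. \<eta> x * \<phi> x) x *\<^sub>R f x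
                 - (partial_deriv j \<eta> x * \<phi> x) *\<^sub>R f x \<partial>lebesgue)"
        unfolding distr_deriv_def regular_distr_def
        by (simp add: partial_deriv_mult[OF smooth_differentiable[OF \<eta>] smooth_differentiable[OF \<phi>s]]
            algebra_simps)
      also have "\<dots> = distr_deriv j f (\<lambda>x. \<eta> x * \<phi> x)
          + (\<integral>x. (partial_deriv j \<eta> x * \<phi> x) *\<^sub>R f x \<partial>lebesgue)"
        unfolding distr_deriv_def regular_distr_def
        by (subst Bochner_Integration.integral_diff)
          (auto intro!: integrable_test partial_deriv_test_functions \<eta>\<phi> d\<eta>\<phi> f)
      finally have "A j *v distr_deriv j (\<lambda>x. \<eta> x *\<^sub>R f x) \<phi> = A j *v distr_deriv j f (\<lambda>x. \<eta> x * \<phi> x)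
          + A j *v (\<integral>x. (partial_deriv j \<eta> x * \<phi> x) *\<^sub>R f x \<partial>lebesgue)"
        by (simp add: matrix_vector_right_distrib)
      also have "A j *v (\<integral>x. (partial_deriv j \<eta> x * \<phi> x) *\<^sub>R f x \<partial>lebesgue)
          = (\<integral>x. A j *v ((partial_deriv j \<eta> x * \<phi> x) *\<^sub>R f x) \<partial>lebesgue)"
        by (rule integral_bounded_linear[symmetric])
          (auto intro!: integrable_test d\<eta>\<phi> f)
      also have "\<dots> = (\<integral>x. \<phi> x *\<^sub>R (partial_deriv j \<eta> x *\<^sub>R (A j *v f x)) \<partial>lebesgue)"
        by (simp add: linear_scale[OF bounded_linear.linear[OF matrix_vector_mul_bounded_linear]] mult.commute)
      finally show ?thesis .
    qed
    have int: "integrable lebesgue (\<lambda>x. \<phi> x *\<^sub>R (partial_deriv j \<eta> x *\<^sub>R (A j *v f x)))" for j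
      by (rule integrable_test[OF \<phi> dAf])
    have "(\<Sum>j\<in>UNIV. A j *v distr_deriv j (\<lambda>x. \<eta> x *\<^sub>R f x) \<phi>)
        = regular_distr g (\<lambda>x. \<eta> x * \<phi> x)
          + (\<Sum>j\<in>UNIV. \<integral>x. \<phi> x *\<^sub>R (partial_deriv j \<eta> x *\<^sub>R (A j *v f x)) \<partial>lebesgue)"
      unfolding prod_rule sum.distrib eq[OF \<eta>\<phi>] ..
    also have "\<dots> = (\<integral>x. \<phi> x *\<^sub>R (\<eta> x *\<^sub>R g x) \<partial>lebesgue)
          + (\<integral>x. (\<Sum>j\<in>UNIV. \<phi> x *\<^sub>R (partial_deriv j \<eta> x *\<^sub>R (A j *v f x))) \<partial>lebesgue)"
      unfolding regular_distr_def by (subst Bochner_Integration.integral_sum[OF int]) (simp add: mult.commute)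
    also have "\<dots> = regular_distr (\<lambda>x. \<eta> x *\<^sub>R g x + (\<Sum>j\<in>UNIV. partial_deriv j \<eta> x *\<^sub>R (A j *v f x))) \<phi>"
      unfolding regular_distr_def scaleR_add_right scaleR_sum_right
      by (rule Bochner_Integration.integral_add[symmetric])
        (intro integrable_test[OF \<phi>] L1_loc_mult smooth_continuous \<eta> g
          Bochner_Integration.integrable_sum int)+
    finally show ?thesis .
  qed
  then show ?thesis
    unfolding is_symbol_deriv_def
    by (auto intro!: L1_loc_mult L1_loc_add L1_loc_sum smooth_continuous \<eta> f g dAf)
qed

section \<open>Uniqueness of the symbol derivative\<close>

text \<open>
  Since \<open>exp (- 1 / (k t))\<close> tends to \<open>1\<close> for every \<open>t > 0\<close>, products of such functions are test functions that
  converge to the indicator function of an open box and stay below it.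
\<close>

lemma integral_box_zero:
  fixes f :: "('d::finite, 'n::finite) field"
  assumes f: "f \<in> L1_loc" and z: "\<And>\<phi>. \<phi> \<in> test_functions \<Longrightarrow> regular_distr f \<phi> = 0"
  shows "(\<integral>x. indicat_real (box a b) x *\<^sub>R f x \<partial>lebesgue) = 0"
proof -
  define \<phi> where "\<phi> k x = (\<Prod>i\<in>UNIV. flat_exp 0 (real (Suc k) * (x $ i - a $ i))
      * flat_exp 0 (real (Suc k) * (b $ i - x $ i)))" for k and x :: "real ^ 'd"
  have smooth: "\<phi> k \<in> smooth" for k
  proof -
    have "(\<lambda>x::real^'d. x $ i - a $ i) \<in> smooth" "(\<lambda>x::real^'d. b $ i - x $ i) \<in> smooth" for i
      using smooth.add[OF smooth.coord[of i] smooth.const[of "- a $ i"]]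
        smooth.add[OF smooth.const[of "b $ i"] smooth.mult[OF smooth.const[of "-1"] smooth.coord[of i]]]
      by auto
    then show ?thesis
      unfolding \<phi>_def by (intro smooth_prod smooth.mult smooth.flat_exp smooth.const)
  qed
  have supp: "\<phi> k x = 0" if "x \<notin> box a b" for k x
  proof -
    obtain i where "\<not> (a $ i < x $ i \<and> x $ i < b $ i)"
      using \<open>x \<notin> box a b\<close> unfolding mem_box_cart by blast
    then have "flat_exp 0 (real (Suc k) * (x $ i - a $ i)) * flat_exp 0 (real (Suc k) * (b $ i - x $ i)) = 0"
      by (auto simp: flat_exp_def zero_less_mult_iff)
    then show ?thesis unfolding \<phi>_def by (intro prod_zero) auto
  qed
  have test: "\<phi> k \<in> test_functions" for k
    unfolding test_functions_iff using smooth supp box_subset_cbox[of a b]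
    by (intro conjI exI[of _ "cbox a b"] allI impI compact_cbox) blast+
  have bd: "\<bar>\<phi> k x\<bar> \<le> indicat_real (cbox a b) x" for k x
  proof (cases "x \<in> box a b")
    case True
    have "\<phi> k x \<le> 1" "\<phi> k x \<ge> 0"
      unfolding \<phi>_def using flat_exp_le[of 0] flat_exp_nonneg[of 0]
      by (auto intro!: prod_le_1 prod_nonneg mult_le_one)
    then show ?thesis using True box_subset_cbox[of a b] by (auto simp: indicator_def)
  next
    case False
    then show ?thesis by (simp add: supp)
  qed
  have lim: "(\<lambda>k. \<phi> k x) \<longlonglongrightarrow> indicat_real (box a b) x" for x
  proof (cases "x \<in> box a b")
    case True
    have fl: "(\<lambda>k. flat_exp 0 (real (Suc k) * c)) \<longlonglongrightarrow> 1" if c: "c > 0" for c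
    proof -
      have "(\<lambda>k. exp (- (inverse (real (Suc k)) * inverse c))) \<longlonglongrightarrow> exp (- (0 * inverse c))"
        by (intro tendsto_intros LIMSEQ_inverse_real_of_nat)
      then show ?thesis using c by (simp add: flat_exp_def)
    qed
    have "(\<lambda>k. \<phi> k x) \<longlonglongrightarrow> (\<Prod>i\<in>(UNIV :: 'd set). 1 * 1)"
      unfolding \<phi>_def using True by (intro tendsto_prod tendsto_mult fl) (auto simp: mem_box_cart)
    then show ?thesis using True by simp
  next
    case False
    then show ?thesis by (simp add: supp)
  qed
  have "(\<lambda>k. \<integral>x. \<phi> k x *\<^sub>R f x \<partial>lebesgue) \<longlonglongrightarrow> (\<integral>x. indicat_real (box a b) x *\<^sub>R f x \<partial>lebesgue)"
  proof (rule integral_dominated_convergence)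
    show "integrable lebesgue (\<lambda>x. norm (indicat_real (cbox a b) x *\<^sub>R f x))"
      using f by (intro integrable_norm) (simp add: L1_loc_def set_integrable_def)
    have [measurable]: "f \<in> borel_measurable lebesgue" using f by (simp add: L1_loc_def)
    have "box a b \<in> sets lebesgue" by simp
    then show "(\<lambda>x. indicat_real (box a b) x *\<^sub>R f x) \<in> borel_measurable lebesgue" by measurable
    show "(\<lambda>x. \<phi> k x *\<^sub>R f x) \<in> borel_measurable lebesgue" for k
      by (rule borel_measurable_integrable[OF integrable_test[OF test f]])
    show "AE x in lebesgue. (\<lambda>k. \<phi> k x *\<^sub>R f x) \<longlonglongrightarrow> indicat_real (box a b) x *\<^sub>R f x"
      by (intro AE_I2 tendsto_intros lim)
    show "AE x in lebesgue. norm (\<phi> k x *\<^sub>R f x) \<le> norm (indicat_real (cbox a b) x *\<^sub>R f x)" for k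
      using bd by (intro AE_I2) (simp add: mult_right_mono)
  qed
  then show ?thesis using z[OF test] by (simp add: regular_distr_def LIMSEQ_const_iff)
qed

lemma sigma_finite_lebesgue: "sigma_finite_measure (lebesgue :: 'a::euclidean_space measure)"
proof
  obtain A :: "'a set set" where A: "countable A" "A \<subseteq> sets lborel" "\<Union>A = space lborel"
    "\<forall>a\<in>A. emeasure lborel a \<noteq> \<infinity>"
    using lborel.sigma_finite_countable by blast
  have "A \<subseteq> sets lebesgue" using A(2) by auto
  moreover have "\<forall>a\<in>A. emeasure lebesgue a \<noteq> \<infinity>"
    using A(2,4) by (auto simp: subset_eq)
  ultimately show "\<exists>A::'a set set. countable A \<and> A \<subseteq> sets lebesgue \<and> \<Union>A = space lebesgue
      \<and> (\<forall>a\<in>A. emeasure lebesgue a \<noteq> \<infinity>)"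
    using A by (intro exI[of _ A]) auto
qed

text \<open>
  Restrict \<open>f\<close> to a cube to make it integrable. The sets over which its integral vanishes form a Dynkin system
  that contains the boxes, a generator of the Borel sets closed under intersection.
\<close>

lemma AE_zero_if_box_integrals_zero:
  fixes f :: "('d::finite, 'n::finite) field"
  assumes f: "f \<in> L1_loc"
    and z: "\<And>a b. (\<integral>x. indicat_real (box a b) x *\<^sub>R f x \<partial>lebesgue) = 0"
  shows "AE x in lebesgue. f x = 0"
proof -
  define Q :: "nat \<Rightarrow> (real ^ 'd) set" where "Q N = box (\<chi> i. - real N) (\<chi> i. real N)" for N
  have Qm [measurable]: "Q N \<in> sets lebesgue" for N by (simp add: Q_def)
  have AE_Q: "AE x in lebesgue. indicat_real (Q N) x *\<^sub>R f x = 0" for N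
  proof (rule sigma_finite_measure.density_zero[OF sigma_finite_lebesgue])
    let ?F = "\<lambda>x. indicat_real (Q N) x *\<^sub>R f x"
    have "set_integrable lebesgue (cbox (\<chi> i. - real N) (\<chi> i. real N)) f"
      using f by (simp add: L1_loc_def)
    then have "set_integrable lebesgue (Q N) f"
      by (rule set_integrable_subset) (auto simp: Q_def box_subset_cbox)
    then show int: "integrable lebesgue ?F" by (simp add: set_integrable_def)
    have borel: "set_lebesgue_integral lebesgue A ?F = 0" if "A \<in> sets borel" for A
    proof -
      let ?G = "range (\<lambda>(a, b). box a b) :: (real ^ 'd) set set"
      have G: "sets borel = sigma_sets UNIV ?G"
        unfolding borel_eq_box by (rule sets_measure_of) auto
      have sb: "B \<in> sets lebesgue" if "B \<in> sigma_sets UNIV ?G" for B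
        using that by (simp flip: G)
      have stable: "Int_stable ?G"
        by (auto simp: Int_stable_def Int_interval box_Int_box)
      have A: "A \<in> sigma_sets UNIV ?G" using that by (simp add: G)
      have "?G \<subseteq> Pow UNIV" by simp
      from stable this A show ?thesis
      proof (induction rule: sigma_sets_induct_disjoint)
        case (basic B)
        then obtain a b where B: "B = box a b" by auto
        obtain a' b' where B': "box a b \<inter> Q N = box a' b'"
          unfolding Q_def box_Int_box by blast
        have "(\<lambda>x. indicat_real (box a b) x *\<^sub>R ?F x) = (\<lambda>x. indicat_real (box a' b') x *\<^sub>R f x)"
          by (simp add: B'[symmetric] indicator_inter_arith)
        then show ?case unfolding set_lebesgue_integral_def B by (simp only: z)
      next
        case empty
        then show ?case by (simp add: set_lebesgue_integral_def)
      next
        case (compl B)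
        have "indicat_real (UNIV - B) x *\<^sub>R ?F x = ?F x - indicat_real B x *\<^sub>R ?F x" for x
          by (simp add: indicator_def)
        then have "set_lebesgue_integral lebesgue (UNIV - B) ?F
            = (\<integral>x. ?F x - indicat_real B x *\<^sub>R ?F x \<partial>lebesgue)"
          by (simp add: set_lebesgue_integral_def)
        also have "\<dots> = (\<integral>x. ?F x \<partial>lebesgue) - set_lebesgue_integral lebesgue B ?F"
          unfolding set_lebesgue_integral_def
          using int integrable_mult_indicator[OF sb[OF compl(1)] int]
          by (rule Bochner_Integration.integral_diff)
        also have "\<dots> = 0" using compl(2) z by (simp add: Q_def)
        finally show ?case .
      next
        case (union B)
        have "set_lebesgue_integral lebesgue (\<Union>i. B i) ?F = (\<Sum>i. set_lebesgue_integral lebesgue (B i) ?F)"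
        proof (rule lebesgue_integral_countable_add)
          show "B i \<in> sets lebesgue" for i using union(2) sb by auto
          then have "(\<Union>i. B i) \<in> sets lebesgue" by auto
          then show "set_integrable lebesgue (\<Union>i. B i) ?F"
            unfolding set_integrable_def by (rule integrable_mult_indicator[OF _ int])
        qed (use union(1) in \<open>auto simp: disjoint_family_on_def\<close>)
        then show ?case using union(3) by simp
      qed
    qed
    fix A :: "(real ^ 'd) set" assume A: "A \<in> sets lebesgue"
    then obtain S M M' where S: "A = S \<union> M" "M \<subseteq> M'" "M' \<in> null_sets lborel" "S \<in> sets lborel"
      by (rule sets_completionE)
    have "AE x in lebesgue. x \<notin> M'"
      using S(3) by (intro AE_not_in) (simp add: null_sets_completionI)
    then have "AE x in lebesgue. indicat_real A x *\<^sub>R ?F x = indicat_real S x *\<^sub>R ?F x"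
      by eventually_elim (use S in \<open>auto simp: indicator_def\<close>)
    moreover have "S \<in> sets lebesgue" using S(4) by auto
    ultimately have "set_lebesgue_integral lebesgue A ?F = set_lebesgue_integral lebesgue S ?F"
      unfolding set_lebesgue_integral_def
      using integrable_mult_indicator[OF A int] integrable_mult_indicator[OF _ int, of S]
      by (intro integral_cong_AE borel_measurable_integrable)
    then show "set_lebesgue_integral lebesgue A ?F = 0" using borel S(4) by simp
  qed
  have "AE x in lebesgue. \<forall>N. indicat_real (Q N) x *\<^sub>R f x = 0"
    unfolding AE_all_countable using AE_Q by blast
  then show ?thesis
  proof eventually_elim
    case (elim x)
    obtain N where N: "norm x < real N" using reals_Archimedean2 by blast
    have "x \<in> Q N"
      unfolding Q_def mem_box_cart
    proof
      fix i
      have "\<bar>x $ i\<bar> \<le> norm x" using component_le_norm_cart by blast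
      then show "(\<chi> i. - real N) $ i < x $ i \<and> x $ i < (\<chi> i. real N) $ i" using N by auto
    qed
    then show ?case using elim[rule_format, of N] by simp
  qed
qed

lemma is_symbol_deriv_unique:
  assumes "is_symbol_deriv A f g" "is_symbol_deriv A f h"
  shows "ae_eq g h"
proof -
  have g: "g \<in> L1_loc" and h: "h \<in> L1_loc" using assms by (auto simp: is_symbol_deriv_def)
  have "regular_distr (\<lambda>x. g x - h x) \<phi> = 0" if \<phi>: "\<phi> \<in> test_functions" for \<phi>
  proof -
    have "regular_distr (\<lambda>x. g x - h x) \<phi> = regular_distr g \<phi> - regular_distr h \<phi>"
      unfolding regular_distr_def scaleR_diff_right
      by (rule Bochner_Integration.integral_diff) (intro integrable_test \<phi> g h)+
    also have "\<dots> = 0"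
    proof -
      have "(\<Sum>j\<in>UNIV. A j *v distr_deriv j f \<phi>) = regular_distr g \<phi>"
        "(\<Sum>j\<in>UNIV. A j *v distr_deriv j f \<phi>) = regular_distr h \<phi>"
        using assms \<phi> by (auto simp: is_symbol_deriv_def)
      then show ?thesis by simp
    qed
    finally show ?thesis .
  qed
  then have "AE x in lebesgue. g x - h x = 0"
    by (intro AE_zero_if_box_integrals_zero L1_loc_diff g h integral_box_zero)
  then show ?thesis by simp
qed

section \<open>Exponential weights\<close>

text \<open>
  A smooth substitute for the norm, with gradient of length at most \<open>1\<close>.
\<close>

definition bracket :: "real ^ 'd::finite \<Rightarrow> real" where "bracket x = sqrt (1 + x \<bullet> x)"

lemma bracket_ge_1: "1 \<le> bracket x"
  by (simp add: bracket_def)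

lemma norm_le_bracket: "norm x \<le> bracket x"
  unfolding bracket_def norm_eq_sqrt_inner by (rule real_sqrt_le_mono) simp

lemma smooth_bracket: "bracket \<in> smooth"
proof -
  have "(\<lambda>x::real^'a. \<Sum>i\<in>UNIV. x $ i * x $ i) \<in> smooth"
    by (intro smooth_sum smooth.mult smooth.coord)
  then have "(\<lambda>x::real^'a. x \<bullet> x) \<in> smooth" by (simp add: inner_vec_def)
  then have "(\<lambda>x::real^'a. sqrt (1 + x \<bullet> x)) \<in> smooth"
    by (intro smooth.sqrt smooth.add smooth.const) (simp_all add: add_pos_nonneg)
  then show ?thesis by (simp add: bracket_def[abs_def])
qed

lemma partial_deriv_bracket: "partial_deriv j bracket x = x $ j / bracket x"
proof -
  have d: "((\<lambda>x. 1 + x \<bullet> x) has_derivative (\<lambda>v. x \<bullet> v + v \<bullet> x)) (at x)"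
    by (auto intro!: derivative_eq_intros)
  have "(sqrt has_real_derivative inverse (sqrt (1 + x \<bullet> x)) / 2) (at (1 + x \<bullet> x))"
    by (rule DERIV_real_sqrt) (simp add: add_pos_nonneg)
  then have "partial_deriv j (\<lambda>x. sqrt (1 + x \<bullet> x)) x
      = inverse (sqrt (1 + x \<bullet> x)) / 2 * partial_deriv j (\<lambda>x. 1 + x \<bullet> x) x"
    using d by (intro differentiable_chain_partial(2)) (auto simp: differentiable_def)
  also have "partial_deriv j (\<lambda>x. 1 + x \<bullet> x) x = 2 * x $ j"
    using partial_deriv_eq[OF d, of j] by (simp add: inner_axis inner_commute)
  finally show ?thesis by (simp add: bracket_def[abs_def] field_simps)
qed

text \<open>
  The weight as a function of \<open>s = \<surd>(1 + |x|\<^sup>2)\<close>. The exponent \<open>\<delta> s\<close> is replaced by \<open>\<delta> s / (1 + s / k)\<close>, which increases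
  at most as fast and stays below \<open>\<delta> k\<close>. So the first factor is at most \<open>M = exp (\<delta> k)\<close>, and a cutoff whose slope is
  of order \<open>1 / M\<close> costs only a bounded amount in the derivative of the product. The cutoff vanishes from \<open>s = k M\<close> on and tends to
  \<open>1\<close> as \<open>k\<close> grows, because \<open>(k M - s) / M\<close> tends to infinity.
\<close>

definition profile :: "real \<Rightarrow> real \<Rightarrow> real \<Rightarrow> real" where
  "profile \<delta> k s = exp (\<delta> * (s * inverse (1 + s / k)))
     * flat_exp 0 ((k * exp (\<delta> * k) - s) * inverse (exp (\<delta> * k)))"

lemma profile_nonneg: "0 \<le> profile \<delta> k s"
  by (simp add: profile_def flat_exp_nonneg)

lemma soft_min_le:
  fixes k s :: real
  assumes "k > 0" "s \<ge> 0"
  shows "s * inverse (1 + s / k) \<le> s" "s * inverse (1 + s / k) \<le> k"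
proof -
  have "s / k \<ge> 0" using assms by simp
  then have pos: "1 + s / k > 0" by linarith
  have "s * inverse (1 + s / k) \<le> s * 1"
    using assms pos by (intro mult_left_mono) (auto simp: inverse_le_1_iff)
  then show "s * inverse (1 + s / k) \<le> s" by simp
  have "s \<le> k * (1 + s / k)" using assms by (simp add: algebra_simps)
  then show "s * inverse (1 + s / k) \<le> k" using pos by (simp add: pos_divide_le_eq flip: divide_inverse)
qed

lemma profile_le:
  assumes "k > 0" "s \<ge> 0" "\<delta> \<ge> 0"
  shows "profile \<delta> k s \<le> exp (\<delta> * s)" "profile \<delta> k s \<le> exp (\<delta> * k)"
proof -
  have "profile \<delta> k s \<le> exp (\<delta> * (s * inverse (1 + s / k))) * 1"
    unfolding profile_def using flat_exp_le[of 0] by (intro mult_left_mono) auto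
  moreover have "exp (\<delta> * (s * inverse (1 + s / k))) \<le> exp (\<delta> * s)"
    "exp (\<delta> * (s * inverse (1 + s / k))) \<le> exp (\<delta> * k)"
    using soft_min_le[OF assms(1,2)] assms(3) by (auto intro!: mult_left_mono)
  ultimately show "profile \<delta> k s \<le> exp (\<delta> * s)" "profile \<delta> k s \<le> exp (\<delta> * k)" by linarith+
qed

lemma profile_support: "k * exp (\<delta> * k) \<le> s \<Longrightarrow> profile \<delta> k s = 0"
  by (simp add: profile_def flat_exp_def zero_less_mult_iff)

lemma profile_deriv:
  assumes k: "k > 0" and s: "s \<ge> 0" and \<delta>: "\<delta> \<ge> 0"
  obtains r where "(profile \<delta> k has_real_derivative r) (at s)" "\<bar>r\<bar> \<le> \<delta> * profile \<delta> k s + 2"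
proof -
  define M where "M = exp (\<delta> * k)"
  define q where "q s = s * inverse (1 + s / k)" for s
  define t where "t = (k * M - s) * inverse M"
  define q' where "q' = (inverse (1 + s / k))\<^sup>2"
  have "s / k \<ge> 0" using k s by simp
  then have pos: "1 + s / k > 0" by linarith
  have dq: "(q has_real_derivative q') (at s)"
    unfolding q_def q'_def using pos k
    by (auto intro!: derivative_eq_intros simp: field_simps power2_eq_square)
  have q': "0 \<le> q'" "q' \<le> 1"
    using k s pos unfolding q'_def by (auto intro!: power_le_one simp: inverse_le_1_iff)
  have dE: "((\<lambda>s. exp (\<delta> * q s)) has_real_derivative exp (\<delta> * q s) * (\<delta> * q')) (at s)"
    by (rule DERIV_chain2[OF DERIV_exp]) (rule DERIV_cmult[OF dq])
  have dF: "((\<lambda>s. flat_exp 0 ((k * M - s) * inverse M)) has_real_derivative flat_exp 2 t * (- inverse M)) (at s)"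
  proof (rule DERIV_chain2[where g = "\<lambda>s. (k * M - s) * inverse M"])
    show "(flat_exp 0 has_real_derivative flat_exp 2 t) (at ((k * M - s) * inverse M))"
      using flat_exp_deriv[of 0 t] by (simp add: t_def numeral_2_eq_2)
    show "((\<lambda>s. (k * M - s) * inverse M) has_real_derivative - inverse M) (at s)"
      by (auto intro!: derivative_eq_intros)
  qed
  define r where "r = exp (\<delta> * q s) * (\<delta> * q') * flat_exp 0 t + flat_exp 2 t * (- inverse M) * exp (\<delta> * q s)"
  have p: "profile \<delta> k s = exp (\<delta> * q s) * flat_exp 0 t"
    by (simp add: profile_def q_def t_def M_def)
  have "(profile \<delta> k has_real_derivative r) (at s)"
    using DERIV_mult[OF dE dF] unfolding r_def t_def
    by (simp add: profile_def[abs_def] q_def M_def)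
  moreover have "\<bar>r\<bar> \<le> \<delta> * profile \<delta> k s + 2"
  proof -
    have 1: "\<bar>exp (\<delta> * q s) * (\<delta> * q') * flat_exp 0 t\<bar> \<le> \<delta> * profile \<delta> k s"
    proof -
      have "\<bar>exp (\<delta> * q s) * (\<delta> * q') * flat_exp 0 t\<bar> = q' * (\<delta> * profile \<delta> k s)"
        using \<delta> q' by (simp add: p abs_mult flat_exp_nonneg)
      also have "\<dots> \<le> 1 * (\<delta> * profile \<delta> k s)"
        using q' \<delta> by (intro mult_right_mono) (auto simp: profile_nonneg)
      finally show ?thesis by simp
    qed
    have "\<bar>flat_exp 2 t * (- inverse M) * exp (\<delta> * q s)\<bar> = flat_exp 2 t * (exp (\<delta> * q s) / M)"
      by (simp add: abs_mult flat_exp_nonneg M_def field_simps)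
    also have "\<dots> \<le> 2 * 1"
    proof (intro mult_mono)
      show "flat_exp 2 t \<le> 2" using flat_exp_le[of 2 t] by (simp add: numeral_2_eq_2)
      show "exp (\<delta> * q s) / M \<le> 1"
        using soft_min_le(2)[OF k s] \<delta> by (simp add: M_def q_def mult_left_mono)
    qed (auto simp: M_def)
    finally show ?thesis using 1 unfolding r_def by linarith
  qed
  ultimately show thesis by (rule that)
qed

lemma profile_tendsto:
  assumes s: "s \<ge> 0" and \<delta>: "\<delta> > 0"
  shows "(\<lambda>n. profile \<delta> (real (Suc n)) s) \<longlonglongrightarrow> exp (\<delta> * s)"
proof -
  have i: "(\<lambda>n. inverse (real (Suc n))) \<longlonglongrightarrow> 0" by (rule LIMSEQ_inverse_real_of_nat)
  have 1: "(\<lambda>n. exp (\<delta> * (s * inverse (1 + s * inverse (real (Suc n)))))) \<longlonglongrightarrow> exp (\<delta> * (s * inverse (1 + s * 0)))"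
    by (intro tendsto_intros i) simp
  have e: "(\<lambda>n. inverse (real (Suc n) - s * inverse (exp (\<delta> * real (Suc n))))) \<longlonglongrightarrow> 0"
  proof (rule tendsto_inverse_0_at_top)
    show "filterlim (\<lambda>n. real (Suc n) - s * inverse (exp (\<delta> * real (Suc n)))) at_top sequentially"
    proof (rule filterlim_at_top_mono)
      show "filterlim (\<lambda>n. - s + real (Suc n)) at_top sequentially"
        by (intro filterlim_tendsto_add_at_top[OF tendsto_const]
            filterlim_compose[OF filterlim_real_sequentially filterlim_Suc])
      show "\<forall>\<^sub>F n in sequentially. - s + real (Suc n) \<le> real (Suc n) - s * inverse (exp (\<delta> * real (Suc n)))"
      proof (intro always_eventually allI)
        fix n
        have "inverse (exp (\<delta> * real (Suc n))) \<le> 1" using \<delta> by (simp add: inverse_le_1_iff)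
        then have "s * inverse (exp (\<delta> * real (Suc n))) \<le> s * 1" using s by (rule mult_left_mono)
        then show "- s + real (Suc n) \<le> real (Suc n) - s * inverse (exp (\<delta> * real (Suc n)))" by simp
      qed
    qed
  qed
  have "(\<lambda>n. exp (- inverse (real (Suc n) - s * inverse (exp (\<delta> * real (Suc n)))))) \<longlonglongrightarrow> exp (- 0)"
    by (intro tendsto_exp tendsto_minus e)
  moreover have "\<forall>\<^sub>F n in sequentially. exp (- inverse (real (Suc n) - s * inverse (exp (\<delta> * real (Suc n)))))
      = flat_exp 0 ((real (Suc n) * exp (\<delta> * real (Suc n)) - s) * inverse (exp (\<delta> * real (Suc n))))"
  proof -
    obtain N where N: "s < real N" using reals_Archimedean2 by blast
    show ?thesis
      unfolding eventually_sequentially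
    proof (intro exI[of _ N] allI impI)
      fix n assume "N \<le> n"
      let ?M = "exp (\<delta> * real (Suc n))"
      have eq: "(real (Suc n) * ?M - s) * inverse ?M = real (Suc n) - s * inverse ?M"
        by (simp add: field_simps)
      have "inverse ?M \<le> 1" using \<delta> by (simp add: inverse_le_1_iff)
      then have "s * inverse ?M \<le> s * 1" using s by (rule mult_left_mono)
      moreover have "s < real (Suc n)" using N \<open>N \<le> n\<close> by simp
      ultimately have "real (Suc n) - s * inverse ?M > 0" by simp
      then show "exp (- inverse (real (Suc n) - s * inverse ?M))
          = flat_exp 0 ((real (Suc n) * ?M - s) * inverse ?M)"
        unfolding eq by (simp add: flat_exp_def)
    qed
  qed
  ultimately have 2: "(\<lambda>n. flat_exp 0 ((real (Suc n) * exp (\<delta> * real (Suc n)) - s)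
      * inverse (exp (\<delta> * real (Suc n))))) \<longlonglongrightarrow> 1"
    by (simp add: Lim_transform_eventually)
  show ?thesis
    using tendsto_mult[OF 1 2] by (simp add: profile_def field_simps)
qed

definition weight :: "real \<Rightarrow> real \<Rightarrow> real ^ 'd::finite \<Rightarrow> real"
  where "weight \<delta> k x = profile \<delta> k (bracket x)"

lemma smooth_weight:
  assumes "k > 0" shows "weight \<delta> k \<in> smooth"
proof -
  have "(\<lambda>x. exp (\<delta> * (bracket x * inverse (1 + bracket x * inverse k)))
     * flat_exp 0 ((k * exp (\<delta> * k) + (-1) * bracket x) * inverse (exp (\<delta> * k)))) \<in> smooth"
    using assms order.trans[OF zero_le_one bracket_ge_1]
    by (intro smooth.mult smooth.exp smooth.flat_exp smooth.inverse smooth.add smooth.const smooth_bracket)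
      (auto intro!: add_pos_nonneg mult_nonneg_nonneg)
  then show ?thesis by (simp add: weight_def[abs_def] profile_def divide_inverse)
qed

lemma weight_support: "k * exp (\<delta> * k) \<le> norm x \<Longrightarrow> weight \<delta> k x = 0"
  unfolding weight_def using norm_le_bracket[of x] by (intro profile_support) linarith

lemma weight_test:
  assumes "k > 0" shows "weight \<delta> k \<in> test_functions"
  unfolding test_functions_iff using smooth_weight[OF assms]
  by (auto intro!: exI[of _ "cball 0 (k * exp (\<delta> * k))"] weight_support)

lemma norm_gradient_weight_le:
  assumes "k > 0" "\<delta> \<ge> 0"
  shows "norm (\<chi> j. partial_deriv j (weight \<delta> k) x) \<le> \<delta> * weight \<delta> k x + 2"
proof -
  have bracket0: "bracket x > 0" using bracket_ge_1[of x] by linarith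
  obtain r where r: "(profile \<delta> k has_real_derivative r) (at (bracket x))" "\<bar>r\<bar> \<le> \<delta> * profile \<delta> k (bracket x) + 2"
    using profile_deriv[OF assms(1) _ assms(2), of "bracket x"] bracket0 by (metis less_imp_le)
  have "partial_deriv j (weight \<delta> k) x = r * (x $ j / bracket x)" for j
    unfolding weight_def[abs_def]
    using differentiable_chain_partial(2)[OF smooth_differentiable[OF smooth_bracket] r(1)]
    by (simp add: partial_deriv_bracket)
  then have "(\<chi> j. partial_deriv j (weight \<delta> k) x) = (r / bracket x) *\<^sub>R x"
    by (simp add: vec_eq_iff)
  then have "norm (\<chi> j. partial_deriv j (weight \<delta> k) x) = \<bar>r\<bar> * (norm x / bracket x)"
    using bracket0 by (simp add: abs_mult)
  also have "\<dots> \<le> \<bar>r\<bar> * 1"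
    using norm_le_bracket[of x] bracket0 by (intro mult_left_mono) auto
  finally show ?thesis using r(2) by (simp add: weight_def)
qed

section \<open>The symbol\<close>

lemma symbol_apply:
  fixes A :: "'d::finite \<Rightarrow> complex ^ 'n ^ 'n::finite"
  shows "(\<Sum>j\<in>UNIV. y $ j *\<^sub>R A j) *v v = (\<Sum>j\<in>UNIV. y $ j *\<^sub>R (A j *v v))"
proof -
  have sc: "(r *\<^sub>R M) *v v = r *\<^sub>R (M *v v)" for r :: real and M :: "complex ^ 'n ^ 'n"
    by (simp add: vec_eq_iff matrix_vector_mult_def scaleR_sum_right)
  have "(\<Sum>j\<in>I. y $ j *\<^sub>R A j) *v v = (\<Sum>j\<in>I. y $ j *\<^sub>R (A j *v v))" for I
    by (induction I rule: infinite_finite_induct)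
      (auto simp: matrix_vector_mult_add_rdistrib sc)
  then show ?thesis .
qed

lemma bdd_above_symbol:
  fixes A :: "'d::finite \<Rightarrow> complex ^ 'n ^ 'n::finite"
  shows "bdd_above ((\<lambda>x. onorm ((*v) (\<Sum>j\<in>UNIV. x $ j *\<^sub>R A j))) ` sphere (0 :: real ^ 'd) 1)"
proof (rule bdd_aboveI2)
  fix x :: "real ^ 'd" assume x: "x \<in> sphere 0 1"
  show "onorm ((*v) (\<Sum>j\<in>UNIV. x $ j *\<^sub>R A j)) \<le> (\<Sum>j\<in>UNIV. onorm ((*v) (A j)))"
  proof (rule onorm_bound)
    show "0 \<le> (\<Sum>j\<in>UNIV. onorm ((*v) (A j)))"
      by (intro sum_nonneg onorm_pos_le) simp
    fix v :: "complex ^ 'n"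
    have "norm ((\<Sum>j\<in>UNIV. x $ j *\<^sub>R A j) *v v) \<le> (\<Sum>j\<in>UNIV. norm (x $ j *\<^sub>R (A j *v v)))"
      unfolding symbol_apply by (rule norm_sum)
    also have "\<dots> \<le> (\<Sum>j\<in>UNIV. onorm ((*v) (A j)) * norm v)"
    proof (rule sum_mono)
      fix j
      have "\<bar>x $ j\<bar> \<le> 1" using component_le_norm_cart[of x j] x by simp
      moreover have "norm (A j *v v) \<le> onorm ((*v) (A j)) * norm v" by (intro onorm) simp
      ultimately have "\<bar>x $ j\<bar> * norm (A j *v v) \<le> 1 * (onorm ((*v) (A j)) * norm v)"
        by (intro mult_mono) auto
      then show "norm (x $ j *\<^sub>R (A j *v v)) \<le> onorm ((*v) (A j)) * norm v" by simp
    qed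
    finally show "norm ((\<Sum>j\<in>UNIV. x $ j *\<^sub>R A j) *v v) \<le> (\<Sum>j\<in>UNIV. onorm ((*v) (A j))) * norm v"
      by (simp add: sum_distrib_right)
  qed
qed

lemma norm_symbol_le:
  fixes A :: "'d::finite \<Rightarrow> complex ^ 'n ^ 'n::finite" and y :: "real ^ 'd"
  shows "norm (\<Sum>j\<in>UNIV. y $ j *\<^sub>R (A j *v v)) \<le> max_speed A * norm y * norm v"
proof (cases "y = 0")
  case False
  define e where "e = (1 / norm y) *\<^sub>R y"
  have e: "e \<in> sphere 0 1" using False by (simp add: e_def)
  have "norm (\<Sum>j\<in>UNIV. y $ j *\<^sub>R (A j *v v)) = norm y * norm (\<Sum>j\<in>UNIV. e $ j *\<^sub>R (A j *v v))"
  proof -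
    have "(\<Sum>j\<in>UNIV. y $ j *\<^sub>R (A j *v v)) = norm y *\<^sub>R (\<Sum>j\<in>UNIV. e $ j *\<^sub>R (A j *v v))"
      using False by (simp add: e_def scaleR_sum_right)
    then show ?thesis by simp
  qed
  also have "\<dots> \<le> norm y * (max_speed A * norm v)"
  proof (rule mult_left_mono)
    have "norm (\<Sum>j\<in>UNIV. e $ j *\<^sub>R (A j *v v)) \<le> onorm ((*v) (\<Sum>j\<in>UNIV. e $ j *\<^sub>R A j)) * norm v"
      unfolding symbol_apply[symmetric] by (intro onorm) simp
    also have "\<dots> \<le> max_speed A * norm v"
      unfolding max_speed_def by (intro mult_right_mono cSUP_upper e bdd_above_symbol) simp
    finally show "norm (\<Sum>j\<in>UNIV. e $ j *\<^sub>R (A j *v v)) \<le> max_speed A * norm v" .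
  qed simp
  finally show ?thesis by (simp add: mult_ac)
qed simp

lemma max_speed_nonneg: "0 \<le> max_speed (A :: 'd::finite \<Rightarrow> complex ^ 'n ^ 'n::finite)"
proof -
  obtain e :: "real ^ 'd" where e: "norm e = 1" using vector_choose_size[of 1] by auto
  have "0 \<le> onorm ((*v) (\<Sum>j\<in>UNIV. e $ j *\<^sub>R A j))" by (intro onorm_pos_le) simp
  also have "\<dots> \<le> max_speed A"
    unfolding max_speed_def by (intro cSUP_upper bdd_above_symbol) (simp add: e)
  finally show ?thesis .
qed

section \<open>Operators on classes of fields\<close>

lemma scaleR_eq_smult: "r *\<^sub>R v = complex_of_real r *s v" for v :: "complex ^ 'n::finite"
  unfolding vec_eq_iff vector_scaleR_component vector_smult_component
  by (simp add: scaleR_conv_of_real)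

lemma smult_eq: "c *s v = Re c *\<^sub>R v + Im c *\<^sub>R (\<i> *s v)" for v :: "complex ^ 'n::finite"
  by (simp add: vec_eq_iff complex_eq_iff)

text \<open>
  The imaginary part is again a real scalar product, since \<open>Im z = Re (- i z)\<close>.
\<close>

lemma L2_inner_eq:
  assumes f: "f \<in> L2" and g: "g \<in> L2"
  shows "L2_inner f g = complex_of_real (\<integral>x. f x \<bullet> g x \<partial>lebesgue)
    + \<i> * complex_of_real (\<integral>x. ((- \<i>) *s f x) \<bullet> g x \<partial>lebesgue)"
proof -
  have pt: "(\<Sum>k\<in>UNIV. a $ k * cnj (b $ k)) = complex_of_real (a \<bullet> b) + \<i> * complex_of_real (((- \<i>) *s a) \<bullet> b)"
    for a b :: "complex ^ 'n"
    by (simp add: complex_eq_iff inner_vec_def inner_complex_def Re_sum Im_sum algebra_simps)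
  have i1: "integrable lebesgue (\<lambda>x. complex_of_real (f x \<bullet> g x))"
    using L2_inner_integrable[OF f g] by simp
  have i2: "integrable lebesgue (\<lambda>x. \<i> * complex_of_real (((- \<i>) *s f x) \<bullet> g x))"
    using L2_inner_integrable[OF L2_smult[OF f] g] by simp
  show ?thesis
    unfolding L2_inner_def pt using Bochner_Integration.integral_add[OF i1 i2] by simp
qed

lemma Re_L2_inner: "f \<in> L2 \<Longrightarrow> g \<in> L2 \<Longrightarrow> Re (L2_inner f g) = cls f \<bullet> cls g"
  by (simp add: L2_inner_eq cls_inner)

lemma Im_L2_inner:
  assumes "f \<in> L2" "g \<in> L2"
  shows "Im (L2_inner f g) = cls (\<lambda>x. (- \<i>) *s f x) \<bullet> cls g"
  unfolding cls_inner[OF L2_smult[OF assms(1)] assms(2)] L2_inner_eq[OF assms] by simp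

lemma cls_zero: "cls (\<lambda>x. 0) = 0"
  using cls_scaleR[OF L2_zero, of 0] by simp

lemma cls_sum:
  assumes "finite B" "\<And>b. b \<in> B \<Longrightarrow> F b \<in> L2"
  shows "(\<lambda>x. \<Sum>b\<in>B. F b x) \<in> L2 \<and> cls (\<lambda>x. \<Sum>b\<in>B. F b x) = (\<Sum>b\<in>B. cls (F b))"
  using assms
proof (induction B rule: finite_induct)
  case empty
  show ?case by (simp add: L2_zero cls_zero)
next
  case (insert b B)
  then show ?case by (simp add: L2_add cls_add[symmetric])
qed

text \<open>
  Domain and action of an operator on classes are read off from representatives. This is independent of the choice
  because the domain is saturated and the action respects equality almost everywhere (\<open>op_cls_cls\<close>).
\<close>

definition dom_cls :: "('d::finite, 'n::finite) field set \<Rightarrow> ('d, 'n) l2 set"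
  where "dom_cls D = {u. rep u \<in> D}"

definition op_cls :: "(('d::finite, 'n::finite) field \<Rightarrow> ('d, 'n) field) \<Rightarrow> ('d, 'n) l2 \<Rightarrow> ('d, 'n) l2"
  where "op_cls T u = cls (T (rep u))"

lemma L2_operatorD:
  assumes "L2_operator D T"
  shows "f \<in> D \<Longrightarrow> f \<in> L2" "(\<lambda>x. 0) \<in> D" "f \<in> D \<Longrightarrow> g \<in> D \<Longrightarrow> (\<lambda>x. f x + g x) \<in> D"
    "f \<in> D \<Longrightarrow> (\<lambda>x. c *s f x) \<in> D" "f \<in> D \<Longrightarrow> g \<in> L2 \<Longrightarrow> ae_eq f g \<Longrightarrow> g \<in> D"
    "f \<in> D \<Longrightarrow> T f \<in> L2" "f \<in> D \<Longrightarrow> g \<in> D \<Longrightarrow> ae_eq f g \<Longrightarrow> ae_eq (T f) (T g)"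
    "f \<in> D \<Longrightarrow> g \<in> D \<Longrightarrow> ae_eq (T (\<lambda>x. f x + g x)) (\<lambda>x. T f x + T g x)"
    "f \<in> D \<Longrightarrow> ae_eq (T (\<lambda>x. c *s f x)) (\<lambda>x. c *s T f x)"
  using assms unfolding L2_operator_def by blast+

lemma op_cls_cls:
  assumes op: "L2_operator D T" and f: "f \<in> D"
  shows "cls f \<in> dom_cls D" "op_cls T (cls f) = cls (T f)"
proof -
  note od = L2_operatorD[OF op]
  have ae: "ae_eq (rep (cls f)) f" by (rule rep_cls[OF od(1)[OF f]])
  then have ae': "ae_eq f (rep (cls f))" by eventually_elim simp
  have r: "rep (cls f) \<in> D" by (rule od(5)[OF f rep_L2 ae'])
  then show "cls f \<in> dom_cls D" by (simp add: dom_cls_def)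
  show "op_cls T (cls f) = cls (T f)"
    unfolding op_cls_def using od(7)[OF r f ae] by (simp add: cls_eq_iff od(6) r f)
qed

text \<open>
  For maximality, a vector pair that is adjoint to \<open>T\<close> for the real scalar product is also adjoint for the
  complex one: the imaginary parts agree by the hypothesis for \<open>- i g\<close> in place of \<open>g\<close>.
\<close>

lemma selfadjoint_cls:
  assumes sa: "selfadjoint_on D T"
  shows "selfadjoint (dom_cls D) (op_cls T)"
proof -
  have op: "L2_operator D T" and adj: "adjoint_graph D T = {(f, h). f \<in> D \<and> h \<in> L2 \<and> ae_eq (T f) h}"
    using sa by (auto simp: selfadjoint_on_def)
  note od = L2_operatorD[OF op]
  note oc = op_cls_cls[OF op]
  have repD: "rep u \<in> D" if "u \<in> dom_cls D" for u using that by (simp add: dom_cls_def)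
  have sumeq: "u + v = cls (\<lambda>x. rep u x + rep v x)" for u v :: "('a, 'b) l2"
    using cls_add[OF rep_L2 rep_L2, of u v] by (simp add: cls_rep)
  have scaleq: "r *\<^sub>R u = cls (\<lambda>x. complex_of_real r *s rep u x)" for r and u :: "('a, 'b) l2"
    using cls_scaleR[OF rep_L2, of r u] by (simp add: cls_rep scaleR_eq_smult)
  show ?thesis
  proof
    show "subspace (dom_cls D)"
      unfolding subspace_def
    proof (intro conjI ballI allI)
      show "0 \<in> dom_cls D" using oc(1)[OF od(2)] by (simp add: cls_zero)
      show "u + v \<in> dom_cls D" if "u \<in> dom_cls D" "v \<in> dom_cls D" for u v
        unfolding sumeq by (intro oc(1) od(3) repD that)
      show "r *\<^sub>R u \<in> dom_cls D" if "u \<in> dom_cls D" for r u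
        unfolding scaleq by (intro oc(1) od(4) repD that)
    qed
  next
    fix u v assume uv: "u \<in> dom_cls D" "v \<in> dom_cls D"
    note r = repD[OF uv(1)] repD[OF uv(2)]
    have "op_cls T (u + v) = cls (T (\<lambda>x. rep u x + rep v x))"
      unfolding sumeq[of u v] by (intro oc(2) od(3) r)
    also have "\<dots> = cls (\<lambda>x. T (rep u) x + T (rep v) x)"
      using od(8)[OF r] by (simp add: cls_eq_iff od(1,3,4,6) r L2_add)
    also have "\<dots> = op_cls T u + op_cls T v"
      by (simp add: op_cls_def cls_add od(1,3,4,6) r)
    finally show "op_cls T (u + v) = op_cls T u + op_cls T v" .
  next
    fix u r assume u: "u \<in> dom_cls D"
    note ru = repD[OF u]
    have "op_cls T (r *\<^sub>R u) = cls (T (\<lambda>x. complex_of_real r *s rep u x))"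
      unfolding scaleq[of r u] by (intro oc(2) od(4) ru)
    also have "\<dots> = cls (\<lambda>x. complex_of_real r *s T (rep u) x)"
      using od(9)[OF ru] by (simp add: cls_eq_iff od(1,3,4,6) ru L2_smult)
    also have "\<dots> = r *\<^sub>R op_cls T u"
      by (simp add: op_cls_def cls_scaleR od(1,3,4,6) ru scaleR_eq_smult)
    finally show "op_cls T (r *\<^sub>R u) = r *\<^sub>R op_cls T u" .
  next
    fix v w
    show "(\<forall>u\<in>dom_cls D. op_cls T u \<bullet> v = u \<bullet> w) \<longleftrightarrow> v \<in> dom_cls D \<and> op_cls T v = w"
    proof
      assume v: "v \<in> dom_cls D \<and> op_cls T v = w"
      then have "(rep v, T (rep v)) \<in> adjoint_graph D T"
        unfolding adj using repD od(6) by auto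
      then have eq: "\<And>g. g \<in> D \<Longrightarrow> L2_inner (T g) (rep v) = L2_inner g (T (rep v))"
        by (auto simp: adjoint_graph_def)
      show "\<forall>u\<in>dom_cls D. op_cls T u \<bullet> v = u \<bullet> w"
      proof
        fix u assume u: "u \<in> dom_cls D"
        have "cls (T (rep u)) \<bullet> cls (rep v) = cls (rep u) \<bullet> cls (T (rep v))"
          using eq[OF repD[OF u]] repD[OF u] repD v
          by (metis Re_L2_inner od(6) rep_L2)
        then show "op_cls T u \<bullet> v = u \<bullet> w" using v by (auto simp: op_cls_def cls_rep)
      qed
    next
      assume eq: "\<forall>u\<in>dom_cls D. op_cls T u \<bullet> v = u \<bullet> w"
      have eqD: "cls (T g) \<bullet> v = cls g \<bullet> w" if "g \<in> D" for g
        using eq oc[OF that] by metis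
      have "L2_inner (T g) (rep v) = L2_inner g (rep w)" if g: "g \<in> D" for g
      proof (rule complex_eqI)
        show "Re (L2_inner (T g) (rep v)) = Re (L2_inner g (rep w))"
          using eqD[OF g] by (simp add: Re_L2_inner od(1,3,4,6) g rep_L2 cls_rep)
        have "cls (T (\<lambda>x. (- \<i>) *s g x)) = cls (\<lambda>x. (- \<i>) *s T g x)"
          using od(9)[OF g, of "- \<i>"] cls_eq_iff[OF od(6)[OF od(4)[OF g]] L2_smult[OF od(6)[OF g]]] by blast
        then show "Im (L2_inner (T g) (rep v)) = Im (L2_inner g (rep w))"
          using eqD[OF od(4)[OF g, of "- \<i>"]]
          by (simp only: Im_L2_inner[OF od(6)[OF g] rep_L2] Im_L2_inner[OF od(1)[OF g] rep_L2] cls_rep)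
      qed
      then have "(rep v, rep w) \<in> adjoint_graph D T" by (simp add: adjoint_graph_def rep_L2)
      then have vD: "rep v \<in> D" and ae: "ae_eq (T (rep v)) (rep w)" unfolding adj by auto
      have "op_cls T v = cls (rep w)"
        unfolding op_cls_def using ae cls_eq_iff[OF od(6)[OF vD] rep_L2] by blast
      then show "v \<in> dom_cls D \<and> op_cls T v = w" using vD by (simp add: dom_cls_def cls_rep)
    qed
  qed
qed

lemma discrete_at_cls:
  assumes sa: "selfadjoint_on D T" and t: "complex_of_real t \<notin> essential_spectrum D T"
  shows "selfadjoint.discrete_at (dom_cls D) (op_cls T) t"
proof -
  interpret S: selfadjoint "dom_cls D" "op_cls T" by (rule selfadjoint_cls[OF sa])
  have op: "L2_operator D T" using sa by (auto simp: selfadjoint_on_def)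
  note od = L2_operatorD[OF op]
  note oc = op_cls_cls[OF op]
  have reg: "S.regular_at s" if s: "complex_of_real s \<in> resolvent_set D T" for s
  proof -
    obtain C where C: "\<And>f. f \<in> D \<Longrightarrow> L2_norm f \<le> C * L2_norm (\<lambda>x. T f x - complex_of_real s *s f x)"
      using s by (auto simp: resolvent_set_def)
    show ?thesis
      unfolding S.regular_at_def
    proof (intro exI[of _ C] ballI)
      fix u assume "u \<in> dom_cls D"
      then have f: "rep u \<in> D" by (simp add: dom_cls_def)
      have "op_cls T u - s *\<^sub>R u = cls (T (rep u)) - s *\<^sub>R cls (rep u)"
        by (simp add: op_cls_def cls_rep)
      also have "\<dots> = cls (\<lambda>x. T (rep u) x - complex_of_real s *s rep u x)"
        by (simp add: cls_scaleR cls_diff L2_scaleR od(1,3,4,6) f rep_L2 flip: scaleR_eq_smult)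
      finally have "norm (op_cls T u - s *\<^sub>R u) = L2_norm (\<lambda>x. T (rep u) x - complex_of_real s *s rep u x)"
        by (simp add: norm_cls L2_diff L2_smult od(1,3,4,6) f rep_L2)
      moreover have "norm u = L2_norm (rep u)" using norm_cls[OF rep_L2, of u] by (simp add: cls_rep)
      ultimately show "norm u \<le> C * norm (op_cls T u - s *\<^sub>R u)" using C[OF f] by simp
    qed
  qed
  show ?thesis
  proof (cases "complex_of_real t \<in> resolvent_set D T")
    case True
    then show ?thesis by (intro S.regular_imp_discrete reg)
  next
    case False
    then have "complex_of_real t \<in> discrete_spectrum D T"
      using t by (auto simp: essential_spectrum_def op_spectrum_def)
    then have iso: "complex_of_real t isolated_in op_spectrum D T"
      and fm: "finite_multiplicity D T (complex_of_real t)" by (auto simp: discrete_spectrum_def)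
    obtain e where e: "e > 0" "\<And>y. y \<in> op_spectrum D T \<Longrightarrow> dist (complex_of_real t) y < e \<Longrightarrow> y = complex_of_real t"
      using iso by (auto simp: isolated_in_dist_Ex_iff)
    have near: "S.regular_at s" if s: "s \<noteq> t" "\<bar>s - t\<bar> < e" for s
    proof -
      have "dist (complex_of_real t) (complex_of_real s) < e"
        using s(2) by (simp add: dist_of_real dist_real_def abs_minus_commute)
      then have "complex_of_real s \<notin> op_spectrum D T" using e(2) s(1) by fastforce
      then show ?thesis by (intro reg) (simp add: op_spectrum_def)
    qed
    obtain B where B: "finite B" "B \<subseteq> eigenspace D T (complex_of_real t)"
      "\<And>f. f \<in> eigenspace D T (complex_of_real t) \<Longrightarrow> \<exists>c. ae_eq f (\<lambda>x. \<Sum>b\<in>B. c b *s b x)"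
      using fm unfolding finite_multiplicity_def by blast
    have BD: "b \<in> D" "ae_eq (T b) (\<lambda>x. complex_of_real t *s b x)" if "b \<in> B" for b
      using B(2) that by (auto simp: eigenspace_def)
    \<comment> \<open>Over the reals, a complex eigenvector \<open>b\<close> spans a plane with basis \<open>b\<close>, \<open>i b\<close>.\<close>
    define E where "E = cls ` B \<union> (\<lambda>b. cls (\<lambda>x. \<i> *s b x)) ` B"
    have ev: "op_cls T (cls f) = t *\<^sub>R cls f" if "f \<in> D" "ae_eq (T f) (\<lambda>x. complex_of_real t *s f x)" for f
    proof -
      have "op_cls T (cls f) = cls (\<lambda>x. complex_of_real t *s f x)"
        unfolding oc(2)[OF that(1)] using that by (simp add: cls_eq_iff od(1,3,4,6) L2_smult)
      then show ?thesis by (simp add: cls_scaleR od(1)[OF that(1)] flip: scaleR_eq_smult)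
    qed
    have "S.eigenvectors E"
      unfolding S.eigenvectors_def
    proof (intro conjI)
      show "finite E" using B(1) by (simp add: E_def)
      show "E \<subseteq> dom_cls D" using oc(1) BD(1) od(4) by (auto simp: E_def)
      show "\<forall>u\<in>E. \<exists>r. op_cls T u = r *\<^sub>R u"
      proof
        fix u assume "u \<in> E"
        then consider b where "b \<in> B" "u = cls b" | b where "b \<in> B" "u = cls (\<lambda>x. \<i> *s b x)"
          by (auto simp: E_def)
        then show "\<exists>r. op_cls T u = r *\<^sub>R u"
        proof cases
          case 1
          then show ?thesis using ev BD by blast
        next
          case 2
          have "ae_eq (T (\<lambda>x. \<i> *s b x)) (\<lambda>x. complex_of_real t *s (\<i> *s b x))"
            using od(9)[OF BD(1)[OF 2(1)], of \<i>] BD(2)[OF 2(1)]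
            by eventually_elim (simp add: vec_eq_iff)
          then show ?thesis using ev[OF od(4)[OF BD(1)[OF 2(1)]]] 2(2) by blast
        qed
      qed
    qed
    moreover have "u \<in> span E" if u: "u \<in> dom_cls D" "op_cls T u = t *\<^sub>R u" for u
    proof -
      have f: "rep u \<in> D" using u(1) by (simp add: dom_cls_def)
      have "cls (T (rep u)) = cls (\<lambda>x. complex_of_real t *s rep u x)"
        using u(2) cls_scaleR[OF rep_L2, of t u] by (simp add: op_cls_def cls_rep scaleR_eq_smult)
      then have "rep u \<in> eigenspace D T (complex_of_real t)"
        using f by (simp add: eigenspace_def cls_eq_iff od(1,3,4,6) L2_smult rep_L2)
      then obtain c where c: "ae_eq (rep u) (\<lambda>x. \<Sum>b\<in>B. c b *s b x)" using B(3) by blast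
      have cb: "(\<lambda>x. c b *s b x) \<in> L2" if "b \<in> B" for b by (intro L2_smult od(1) BD that)
      have "u = cls (\<lambda>x. \<Sum>b\<in>B. c b *s b x)"
        using c cls_eq_iff[OF rep_L2, of "\<lambda>x. \<Sum>b\<in>B. c b *s b x" u] cls_sum[OF B(1) cb]
        by (simp add: cls_rep)
      also have "\<dots> = (\<Sum>b\<in>B. cls (\<lambda>x. c b *s b x))" using cls_sum[OF B(1) cb] by simp
      also have "\<dots> \<in> span E"
      proof (rule span_sum)
        fix b assume b: "b \<in> B"
        have bL: "b \<in> L2" by (intro od(1) BD b)
        have "cls (\<lambda>x. c b *s b x) = cls (\<lambda>x. Re (c b) *\<^sub>R b x + Im (c b) *\<^sub>R (\<i> *s b x))"
          by (simp only: smult_eq[of "c b"])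
        also have "\<dots> = Re (c b) *\<^sub>R cls b + Im (c b) *\<^sub>R cls (\<lambda>x. \<i> *s b x)"
          by (simp add: cls_scaleR cls_add L2_scaleR L2_smult bL)
        also have "\<dots> \<in> span E"
          using b by (intro span_add span_scale span_base) (auto simp: E_def)
        finally show "cls (\<lambda>x. c b *s b x) \<in> span E" .
      qed
      finally show ?thesis .
    qed
    ultimately show ?thesis unfolding S.discrete_at_def using e(1) near by blast
  qed
qed

text \<open>
  On the real plane spanned by \<open>\<psi>\<close> and \<open>i \<psi>\<close> the operator is \<open>Re \<mu> + Im \<mu> J\<close> with the antisymmetric map \<open>J\<close> of multiplication by
  \<open>i\<close>. Symmetry leaves no room for the second term.
\<close>

lemma eigenvalue_real:
  assumes sa: "selfadjoint_on D T" and \<psi>: "\<psi> \<in> D" "ae_eq (T \<psi>) (\<lambda>x. \<mu> *s \<psi> x)"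
    and nz: "cls \<psi> \<noteq> 0"
  shows "\<mu> = complex_of_real (Re \<mu>)"
proof -
  interpret S: selfadjoint "dom_cls D" "op_cls T" by (rule selfadjoint_cls[OF sa])
  have op: "L2_operator D T" using sa by (auto simp: selfadjoint_on_def)
  note od = L2_operatorD[OF op]
  note oc = op_cls_cls[OF op]
  have L: "\<psi> \<in> L2" by (rule od(1)[OF \<psi>(1)])
  define i\<psi> where "i\<psi> = (\<lambda>x. \<i> *s \<psi> x)"
  have iD: "i\<psi> \<in> D" unfolding i\<psi>_def by (rule od(4)[OF \<psi>(1)])
  have iL: "i\<psi> \<in> L2" by (rule od(1)[OF iD])
  have 1: "op_cls T (cls \<psi>) = Re \<mu> *\<^sub>R cls \<psi> + Im \<mu> *\<^sub>R cls i\<psi>"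
  proof -
    have "op_cls T (cls \<psi>) = cls (\<lambda>x. Re \<mu> *\<^sub>R \<psi> x + Im \<mu> *\<^sub>R i\<psi> x)"
      unfolding oc(2)[OF \<psi>(1)] using \<psi>(2)
      by (simp add: cls_eq_iff od(1,3,4,6) \<psi> L2_add L2_scaleR L iL i\<psi>_def smult_eq[of \<mu>] )
    then show ?thesis by (simp add: cls_add cls_scaleR L2_scaleR L iL)
  qed
  have 2: "op_cls T (cls i\<psi>) = Re \<mu> *\<^sub>R cls i\<psi> - Im \<mu> *\<^sub>R cls \<psi>"
  proof -
    have "ae_eq (T i\<psi>) (\<lambda>x. Re \<mu> *\<^sub>R i\<psi> x - Im \<mu> *\<^sub>R \<psi> x)"
      using od(9)[OF \<psi>(1), of \<i>] \<psi>(2) unfolding i\<psi>_def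
      by eventually_elim (simp add: vec_eq_iff complex_eq_iff)
    then have "op_cls T (cls i\<psi>) = cls (\<lambda>x. Re \<mu> *\<^sub>R i\<psi> x - Im \<mu> *\<^sub>R \<psi> x)"
      unfolding oc(2)[OF iD] by (simp add: cls_eq_iff od(1,3,4,6) iD L2_diff L2_scaleR L iL)
    then show ?thesis by (simp add: cls_diff cls_scaleR L2_scaleR L iL)
  qed
  have "op_cls T (cls \<psi>) \<bullet> cls i\<psi> = cls \<psi> \<bullet> op_cls T (cls i\<psi>)"
    by (rule S.symmetric[OF oc(1)[OF \<psi>(1)] oc(1)[OF iD]])
  then have "Im \<mu> * (cls i\<psi> \<bullet> cls i\<psi> + cls \<psi> \<bullet> cls \<psi>) = 0"
    unfolding 1 2 by (simp add: inner_add_left inner_diff_right algebra_simps)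
  moreover have "cls i\<psi> \<bullet> cls i\<psi> + cls \<psi> \<bullet> cls \<psi> > 0" using nz by (intro add_nonneg_pos) auto
  ultimately have "Im \<mu> = 0" by simp
  then show ?thesis by (simp add: complex_eq_iff)
qed

section \<open>Exponential decay of eigenfunctions\<close>

lemma norm_cls_mono:
  assumes "f \<in> L2" "g \<in> L2" "AE x in lebesgue. norm (f x) \<le> norm (g x)"
  shows "norm (cls f) \<le> norm (cls g)"
  unfolding norm_cls[OF assms(1)] norm_cls[OF assms(2)] L2_norm_def
proof (intro real_sqrt_le_mono integral_mono_AE L2D2 assms(1,2))
  show "AE x in lebesgue. (norm (f x))\<^sup>2 \<le> (norm (g x))\<^sup>2"
    using assms(3) by eventually_elim (simp add: power_mono)
qed

lemma L2_restrict:
  assumes "f \<in> L2" "S \<in> sets lebesgue"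
  shows "(\<lambda>x. indicat_real S x *\<^sub>R f x) \<in> L2"
proof (rule L2_bounded_mult[OF assms(1), of _ 1])
  have [measurable]: "f \<in> borel_measurable lebesgue" "S \<in> sets lebesgue" using assms L2D by auto
  show "(\<lambda>x. indicat_real S x *\<^sub>R f x) \<in> borel_measurable lebesgue" by measurable
qed (simp add: indicator_def)

lemma L2_tail:
  fixes h :: "('d::finite, 'n::finite) field"
  assumes h: "h \<in> L2" and \<epsilon>: "\<epsilon> > 0"
  obtains \<rho> where "norm (cls (\<lambda>x. indicat_real (- cball 0 \<rho>) x *\<^sub>R h x)) \<le> \<epsilon>"
proof -
  let ?h = "\<lambda>n x. indicat_real (- cball 0 (real n)) x *\<^sub>R h x"
  have L: "?h n \<in> L2" for n by (intro L2_restrict h) simp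
  have [measurable]: "h \<in> borel_measurable lebesgue" by (rule L2D[OF h])
  have "(\<lambda>n. \<integral>x. (norm (?h n x))\<^sup>2 \<partial>lebesgue) \<longlonglongrightarrow> integral\<^sup>L lebesgue (\<lambda>x::real ^ 'd. 0 :: real)"
  proof (rule integral_dominated_convergence)
    show "integrable lebesgue (\<lambda>x. (norm (h x))\<^sup>2)" by (rule L2D2[OF h])
    show "(\<lambda>x. (norm (?h n x))\<^sup>2) \<in> borel_measurable lebesgue" for n
      using L2D[OF L[of n]] by measurable
    show "AE x in lebesgue. (\<lambda>n. (norm (?h n x))\<^sup>2) \<longlonglongrightarrow> 0"
    proof (rule AE_I2)
      fix x :: "real ^ 'd"
      obtain N where N: "norm x \<le> real N" using real_arch_simple by blast
      have "\<forall>\<^sub>F n in sequentially. (norm (?h n x))\<^sup>2 = 0"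
        unfolding eventually_sequentially using N by (intro exI[of _ N]) (auto simp: indicator_def)
      then show "(\<lambda>n. (norm (?h n x))\<^sup>2) \<longlonglongrightarrow> 0" by (rule tendsto_eventually)
    qed
    show "AE x in lebesgue. norm ((norm (?h n x))\<^sup>2) \<le> (norm (h x))\<^sup>2" for n
      by (intro AE_I2) (simp add: indicator_def)
  qed simp
  then have "(\<lambda>n. norm (cls (?h n))) \<longlonglongrightarrow> sqrt 0"
    unfolding norm_cls[OF L] L2_norm_def by (intro tendsto_real_sqrt) simp
  then have "\<forall>\<^sub>F n in sequentially. norm (cls (?h n)) < \<epsilon>"
    using \<epsilon> by (intro order_tendstoD) auto
  then show thesis using that by (auto simp: eventually_sequentially intro: less_imp_le)
qed

text \<open>
  Cut \<open>c\<close> at a ball outside of which its norm is at most \<open>\<epsilon>\<close>. Inside the ball every admissible \<open>f\<close> is bounded by a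
  fixed multiple of \<open>|\<psi>|\<close>, so \<open>K\<close> does not depend on \<open>f\<close>.
\<close>

lemma pairing_bound:
  fixes c :: "('d::finite, 'n::finite) l2"
  assumes \<psi>: "\<psi> \<in> L2" and \<epsilon>: "\<epsilon> > 0" and \<delta>: "\<delta> \<ge> 0"
  obtains K where "\<And>f. f \<in> L2 \<Longrightarrow> (\<And>x. norm (f x) \<le> exp (\<delta> * bracket x) * norm (\<psi> x))
    \<Longrightarrow> \<bar>c \<bullet> cls f\<bar> \<le> \<epsilon> * norm (cls f) + K"
proof -
  define h where "h = rep c"
  have h: "h \<in> L2" "c = cls h" by (auto simp: h_def rep_L2 cls_rep)
  obtain \<rho> where \<rho>: "norm (cls (\<lambda>x. indicat_real (- cball 0 \<rho>) x *\<^sub>R h x)) \<le> \<epsilon>"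
    using L2_tail[OF h(1) \<epsilon>] by blast
  define R where "R = exp (\<delta> * sqrt (1 + \<rho>\<^sup>2))"
  let ?in = "\<lambda>f x. indicat_real (cball 0 \<rho>) x *\<^sub>R f x"
  let ?out = "\<lambda>x. indicat_real (- cball 0 \<rho>) x *\<^sub>R h x"
  have inL: "?in f \<in> L2" if "f \<in> L2" for f :: "('d, 'n) field" by (intro L2_restrict that) simp
  have outL: "?out \<in> L2" by (intro L2_restrict h) simp
  show thesis
  proof
    fix f :: "('d, 'n) field"
    assume f: "f \<in> L2" and le: "\<And>x. norm (f x) \<le> exp (\<delta> * bracket x) * norm (\<psi> x)"
    have "(\<lambda>x. ?in h x + ?out x) = h" by (intro ext) (simp add: indicator_def)
    then have "c = cls (?in h) + cls ?out" by (simp add: cls_add inL outL h)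
    then have "c \<bullet> cls f = cls (?in h) \<bullet> cls f + cls ?out \<bullet> cls f" by (simp add: inner_add_left)
    also have "cls (?in h) \<bullet> cls f = c \<bullet> cls (?in f)"
      by (simp add: h(2) cls_inner inL h(1) f)
    finally have "\<bar>c \<bullet> cls f\<bar> \<le> \<bar>c \<bullet> cls (?in f)\<bar> + \<bar>cls ?out \<bullet> cls f\<bar>" by simp
    also have "\<dots> \<le> norm c * norm (cls (?in f)) + norm (cls ?out) * norm (cls f)"
      by (intro add_mono Cauchy_Schwarz_ineq2)
    also have "norm (cls (?in f)) \<le> norm (R *\<^sub>R cls \<psi>)"
      unfolding cls_scaleR[OF \<psi>]
    proof (rule norm_cls_mono[OF inL[OF f] L2_scaleR[OF \<psi>]], rule AE_I2)
      fix x
      show "norm (?in f x) \<le> norm (R *\<^sub>R \<psi> x)"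
      proof (cases "x \<in> cball 0 \<rho>")
        case True
        then have "norm x \<le> \<rho>" by simp
        then have "bracket x \<le> sqrt (1 + \<rho>\<^sup>2)"
          unfolding bracket_def power2_norm_eq_inner[symmetric]
          by (intro real_sqrt_le_mono add_left_mono power_mono) auto
        then have "exp (\<delta> * bracket x) * norm (\<psi> x) \<le> R * norm (\<psi> x)"
          unfolding R_def using \<delta> by (intro mult_right_mono) (auto intro: mult_left_mono)
        then show ?thesis using le[of x] True by (simp add: R_def)
      qed simp
    qed
    also have "norm (R *\<^sub>R cls \<psi>) = R * norm (cls \<psi>)" by (simp add: R_def)
    also have "norm (cls ?out) * norm (cls f) \<le> \<epsilon> * norm (cls f)" by (intro mult_right_mono \<rho>) simp
    finally show "\<bar>c \<bullet> cls f\<bar> \<le> \<epsilon> * norm (cls f) + norm c * (R * norm (cls \<psi>))"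
      by (simp add: mult_left_mono)
  qed
qed

lemma first_order_op_AE:
  assumes "is_symbol_deriv A f g"
  shows "AE x in lebesgue. first_order_op A V f x = (- \<i>) *s g x + V x *v f x"
proof -
  have "is_symbol_deriv A f (SOME g. is_symbol_deriv A f g)" by (rule someI[of "is_symbol_deriv A f", OF assms])
  then have "ae_eq (SOME g. is_symbol_deriv A f g) g" using assms by (rule is_symbol_deriv_unique)
  then show ?thesis by eventually_elim (simp add: first_order_op_def)
qed

lemma L2_test_mult:
  assumes \<phi>: "\<phi> \<in> test_functions" and g: "g \<in> L2_loc"
  shows "(\<lambda>x. \<phi> x *\<^sub>R g x) \<in> L2"
proof -
  obtain K where K: "compact K" "\<And>x. x \<notin> K \<Longrightarrow> \<phi> x = 0" and s: "\<phi> \<in> smooth"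
    using \<phi> unfolding test_functions_iff by blast
  obtain B where B: "\<And>x. x \<in> K \<Longrightarrow> \<bar>\<phi> x\<bar> \<le> B"
    using compact_imp_bounded[OF compact_continuous_image[OF continuous_on_subset[OF smooth_continuous[OF s]] K(1)]]
    unfolding bounded_iff by auto
  have [measurable]: "\<phi> \<in> borel_measurable lebesgue"
    using borel_measurable_continuous_onI[OF smooth_continuous[OF s]] by (simp add: measurable_completion)
  have [measurable]: "g \<in> borel_measurable lebesgue" using g by (simp add: L2_loc_def)
  show ?thesis
  proof (rule L2I_bound)
    show "(\<lambda>x. \<phi> x *\<^sub>R g x) \<in> borel_measurable lebesgue" by measurable
    show "integrable lebesgue (\<lambda>x. B\<^sup>2 * (indicat_real K x *\<^sub>R (norm (g x))\<^sup>2))"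
      using g K(1) by (intro integrable_mult_right) (simp add: L2_loc_def set_integrable_def)
    show "AE x in lebesgue. (norm (\<phi> x *\<^sub>R g x))\<^sup>2 \<le> B\<^sup>2 * (indicat_real K x *\<^sub>R (norm (g x))\<^sup>2)"
    proof (rule AE_I2)
      fix x
      show "(norm (\<phi> x *\<^sub>R g x))\<^sup>2 \<le> B\<^sup>2 * (indicat_real K x *\<^sub>R (norm (g x))\<^sup>2)"
      proof (cases "x \<in> K")
        case True
        have "\<bar>\<phi> x\<bar>\<^sup>2 \<le> B\<^sup>2" by (intro power_mono B True) simp
        then show ?thesis using True by (simp add: power_mult_distrib mult_right_mono)
      qed (simp add: K(2))
    qed
  qed
qed

lemma L2_subset_L2_loc: "f \<in> L2 \<Longrightarrow> f \<in> L2_loc"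
  unfolding L2_loc_def set_integrable_def
  by (intro CollectI conjI allI impI L2D integrable_mult_indicator L2D2)
    (simp_all add: lmeasurable_compact fmeasurableD)

text \<open>
  The commutator of \<open>H\<close> with a test function \<open>\<phi>\<close> is multiplication by \<open>-i \<Sum>\<^sub>j (\<partial>\<^sub>j \<phi>) A\<^sub>j\<close>. The compact support of \<open>\<phi>\<close> is used twice:
  the product \<open>\<phi> \<psi>\<close> has compact support, and \<open>\<phi> g\<close> is square integrable although \<open>g\<close> is so only locally. Both together
  put \<open>\<phi> \<psi>\<close> into the domain.
\<close>

lemma localization:
  assumes sa: "selfadjoint_on D (first_order_op A V)"
    and loc1: "\<And>f g. f \<in> L2 \<Longrightarrow> compactly_supported f \<Longrightarrow> g \<in> L2 \<Longrightarrow> is_symbol_deriv A f g \<Longrightarrow> f \<in> D"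
    and loc2: "\<And>f. f \<in> D \<Longrightarrow> \<exists>g\<in>L2_loc. is_symbol_deriv A f g"
    and \<psi>: "\<psi> \<in> D" "ae_eq (first_order_op A V \<psi>) (\<lambda>x. \<mu> *s \<psi> x)"
    and \<phi>: "\<phi> \<in> test_functions"
  defines "F \<equiv> \<lambda>x. \<Sum>j\<in>UNIV. partial_deriv j \<phi> x *\<^sub>R (A j *v \<psi> x)"
  shows "(\<lambda>x. \<phi> x *\<^sub>R \<psi> x) \<in> D" "F \<in> L2"
    "ae_eq (first_order_op A V (\<lambda>x. \<phi> x *\<^sub>R \<psi> x)) (\<lambda>x. \<mu> *s (\<phi> x *\<^sub>R \<psi> x) + (- \<i>) *s F x)"
proof -
  have op: "L2_operator D (first_order_op A V)" using sa by (auto simp: selfadjoint_on_def)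
  have \<psi>L: "\<psi> \<in> L2" by (rule L2_operatorD(1)[OF op \<psi>(1)])
  have \<phi>s: "\<phi> \<in> smooth" using \<phi> by (simp add: test_functions_iff)
  obtain g where g: "g \<in> L2_loc" "is_symbol_deriv A \<psi> g" using loc2[OF \<psi>(1)] by blast
  have sd: "is_symbol_deriv A (\<lambda>x. \<phi> x *\<^sub>R \<psi> x) (\<lambda>x. \<phi> x *\<^sub>R g x + F x)"
    unfolding F_def by (rule is_symbol_deriv_mult[OF \<phi>s g(2)])
  have "(\<lambda>x. A j *v \<psi> x) \<in> L2" for j
  proof (rule L2_bounded_mult[OF \<psi>L])
    show "(\<lambda>x. A j *v \<psi> x) \<in> borel_measurable lebesgue"
      using L2D[OF \<psi>L] borel_measurable_continuous_onI[OF linear_continuous_on[OF matrix_vector_mul_bounded_linear]]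
      by (rule measurable_compose)
    show "AE x in lebesgue. norm (A j *v \<psi> x) \<le> onorm ((*v) (A j)) * norm (\<psi> x)"
      by (intro AE_I2 onorm) simp
  qed
  then have dL: "(\<lambda>x. partial_deriv j \<phi> x *\<^sub>R (A j *v \<psi> x)) \<in> L2" for j
    by (intro L2_test_mult[OF partial_deriv_test_functions[OF \<phi>]] L2_subset_L2_loc)
  show FL: "F \<in> L2"
    unfolding F_def by (rule conjunct1[OF cls_sum[OF finite dL]])
  have fL: "(\<lambda>x. \<phi> x *\<^sub>R \<psi> x) \<in> L2" by (intro L2_test_mult[OF \<phi>] L2_subset_L2_loc \<psi>L)
  have "compactly_supported (\<lambda>x. \<phi> x *\<^sub>R \<psi> x)"
    using \<phi> unfolding test_functions_iff compactly_supported_def by fastforce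
  then show "(\<lambda>x. \<phi> x *\<^sub>R \<psi> x) \<in> D"
    by (rule loc1[OF fL _ L2_add[OF L2_test_mult[OF \<phi> g(1)] FL] sd])
  show "ae_eq (first_order_op A V (\<lambda>x. \<phi> x *\<^sub>R \<psi> x)) (\<lambda>x. \<mu> *s (\<phi> x *\<^sub>R \<psi> x) + (- \<i>) *s F x)"
    using first_order_op_AE[OF sd, of V] first_order_op_AE[OF g(2), of V] \<psi>(2)
  proof eventually_elim
    case (elim x)
    have eq: "(- \<i>) *s g x + V x *v \<psi> x = \<mu> *s \<psi> x" using elim(2,3) by metis
    have lin: "V x *v (\<phi> x *\<^sub>R \<psi> x) = \<phi> x *\<^sub>R (V x *v \<psi> x)"
      by (rule linear_scale[OF bounded_linear.linear[OF matrix_vector_mul_bounded_linear]])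
    have cm: "c *s (r *\<^sub>R v) = r *\<^sub>R (c *s v)" for c r and v :: "complex ^ 'b"
      by (simp add: vec_eq_iff)
    have ad: "c *s (v + w) = c *s v + c *s w" for c and v w :: "complex ^ 'b"
      by (simp add: vec_eq_iff algebra_simps)
    have "(- \<i>) *s (\<phi> x *\<^sub>R g x + F x) + V x *v (\<phi> x *\<^sub>R \<psi> x)
        = \<phi> x *\<^sub>R ((- \<i>) *s g x + V x *v \<psi> x) + (- \<i>) *s F x"
      unfolding ad cm lin scaleR_add_right by simp
    then show ?case unfolding elim(1) eq cm .
  qed
qed

text \<open>
  For \<open>\<gamma> = 0\<close> the factor \<open>inverse (ereal \<gamma>)\<close> is \<open>\<infinity>\<close>, and the hypothesis only says that \<open>e\<close> is positive, because \<open>\<infinity> * 0 = 0\<close>.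
\<close>

lemma ereal_mult_less:
  assumes \<gamma>: "0 \<le> \<gamma>" and \<delta>: "0 < \<delta>" and e: "0 \<le> e"
    and less: "ereal \<delta> < inverse (ereal \<gamma>) * e"
  shows "ereal (\<gamma> * \<delta>) < e"
proof (cases e)
  case (real r)
  show ?thesis
  proof (cases "\<gamma> = 0")
    case True
    then have "r \<noteq> 0" using less \<delta> real by auto
    then show ?thesis using True real e by simp
  next
    case False
    then have "\<delta> < r / \<gamma>" using less real by (simp add: divide_inverse mult.commute)
    then show ?thesis using \<gamma> False real by (simp add: field_simps)
  qed
qed (use e in auto)

lemma edist_set_nonneg: "0 \<le> edist_set z S"
  unfolding edist_set_def by (intro INF_greatest) simp

theorem theorem2p3:
  fixes A :: "'d::finite \<Rightarrow> complex ^ 'n ^ 'n::finite"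
    and V :: "real ^ 'd \<Rightarrow> complex ^ 'n ^ 'n"
    and D :: "('d, 'n) field set"
    and \<psi> :: "('d, 'n) field"
    and \<mu> :: complex
    and \<delta> :: real
  assumes "\<And>j. hermitian (A j)"
    and "\<And>x. hermitian (V x)"
    and "locally_bounded V"
    and "selfadjoint_on D (first_order_op A V)"
    and "\<And>f g. f \<in> L2 \<Longrightarrow> compactly_supported f \<Longrightarrow> g \<in> L2 \<Longrightarrow> is_symbol_deriv A f g \<Longrightarrow> f \<in> D"
    and "\<And>f. f \<in> D \<Longrightarrow> \<exists>g\<in>L2_loc. is_symbol_deriv A f g"
    and "\<psi> \<in> D"
    and "ae_eq (first_order_op A V \<psi>) (\<lambda>x. \<mu> *s \<psi> x)"
    and "ereal \<delta> < inverse (ereal (max_speed A)) *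
           edist_set \<mu> (essential_spectrum D (first_order_op A V))"
  shows "(\<integral>\<^sup>+x. ennreal ((norm (\<psi> x))\<^sup>2 * exp (2 * \<delta> * norm x)) \<partial>lebesgue) < \<infinity>"
proof -
  let ?T = "first_order_op A V"
  note sa = assms(4)
  have op: "L2_operator D ?T" using sa by (auto simp: selfadjoint_on_def)
  note od = L2_operatorD[OF op]
  note oc = op_cls_cls[OF op]
  have \<psi>L: "\<psi> \<in> L2" by (rule od(1)[OF assms(7)])
  have [measurable]: "\<psi> \<in> borel_measurable lebesgue" by (rule L2D[OF \<psi>L])
  have nn\<psi>: "(\<integral>\<^sup>+x. ennreal ((norm (\<psi> x))\<^sup>2) \<partial>lebesgue) < \<infinity>"
    using nn_integral_eq_integral[OF L2D2[OF \<psi>L]] by simp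
  consider "\<delta> \<le> 0" | "cls \<psi> = 0" | "\<delta> > 0" "cls \<psi> \<noteq> 0" by linarith
  then show ?thesis
  proof cases
    case 1
    have "(\<integral>\<^sup>+x. ennreal ((norm (\<psi> x))\<^sup>2 * exp (2 * \<delta> * norm x)) \<partial>lebesgue)
        \<le> (\<integral>\<^sup>+x. ennreal ((norm (\<psi> x))\<^sup>2) \<partial>lebesgue)"
    proof (intro nn_integral_mono ennreal_leI)
      fix x :: "real ^ 'd"
      have "exp (2 * \<delta> * norm x) \<le> 1" using 1 by (simp add: mult_nonpos_nonneg)
      then show "(norm (\<psi> x))\<^sup>2 * exp (2 * \<delta> * norm x) \<le> (norm (\<psi> x))\<^sup>2"
        by (simp add: mult_left_le)
    qed
    then show ?thesis using nn\<psi> by (rule le_less_trans)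
  next
    case 2
    have "cls \<psi> = cls (\<lambda>x. 0)" using 2 by (simp add: cls_zero)
    then have "ae_eq \<psi> (\<lambda>x. 0)" by (simp add: cls_eq_iff \<psi>L L2_zero)
    then have "(\<integral>\<^sup>+x. ennreal ((norm (\<psi> x))\<^sup>2 * exp (2 * \<delta> * norm x)) \<partial>lebesgue)
        = integral\<^sup>N lebesgue (\<lambda>x::real ^ 'd. 0)"
      by (intro nn_integral_cong_AE) (auto elim!: eventually_mono)
    then show ?thesis by simp
  next
    case 3
    define \<gamma> where "\<gamma> = max_speed A"
    define l where "l = Re \<mu>"
    have \<gamma>: "\<gamma> \<ge> 0" by (simp add: \<gamma>_def max_speed_nonneg)
    have \<mu>: "\<mu> = complex_of_real l"
      unfolding l_def by (rule eigenvalue_real[OF sa assms(7,8) 3(2)])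
    interpret S: selfadjoint "dom_cls D" "op_cls ?T" by (rule selfadjoint_cls[OF sa])
    have "ereal (\<gamma> * \<delta>) < edist_set \<mu> (essential_spectrum D ?T)"
      using ereal_mult_less[OF \<gamma> 3(1) edist_set_nonneg] assms(9) by (simp add: \<gamma>_def)
    then obtain d where d: "\<gamma> * \<delta> < d" "ereal d < edist_set \<mu> (essential_spectrum D ?T)"
      using ereal_dense2 by (metis less_ereal.simps(1))
    have d0: "d \<ge> 0" using d(1) \<gamma> 3(1) mult_nonneg_nonneg[of \<gamma> \<delta>] by linarith
    have disc: "S.discrete_at t" if t: "\<bar>t - l\<bar> \<le> d" for t
    proof (rule discrete_at_cls[OF sa], rule notI)
      assume "complex_of_real t \<in> essential_spectrum D ?T"
      then have "edist_set \<mu> (essential_spectrum D ?T) \<le> ereal (dist \<mu> (complex_of_real t))"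
        unfolding edist_set_def by (rule INF_lower)
      also have "dist \<mu> (complex_of_real t) = \<bar>t - l\<bar>"
        by (simp add: \<mu> dist_of_real dist_real_def abs_minus_commute)
      finally show False using d(2) t by (metis ereal_less_eq(3) not_less order.trans)
    qed
    obtain C K where C: "finite C" "K \<ge> 0"
      and coer: "\<And>u. u \<in> dom_cls D \<Longrightarrow>
        d * norm u \<le> norm (op_cls ?T u - l *\<^sub>R u) + K * (\<Sum>c\<in>C. \<bar>c \<bullet> u\<bar>)"
      using S.coercive_modulo_finite_rank[OF d0 disc] by blast
    define w :: "nat \<Rightarrow> real ^ 'd \<Rightarrow> real" where "w n = weight \<delta> (real (Suc n))" for n
    have test: "w n \<in> test_functions" for n unfolding w_def by (rule weight_test) simp
    have w0: "0 \<le> w n x" for n x by (simp add: w_def weight_def profile_nonneg)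
    have w_le: "w n x \<le> exp (\<delta> * bracket x)" for n x
      unfolding w_def weight_def using 3(1) bracket_ge_1[of x] by (intro profile_le) auto
    define f where "f n = (\<lambda>x. w n x *\<^sub>R \<psi> x)" for n
    define F where "F n = (\<lambda>x. \<Sum>j\<in>UNIV. partial_deriv j (w n) x *\<^sub>R (A j *v \<psi> x))" for n
    have fD: "f n \<in> D" for n
      unfolding f_def by (rule localization(1)[OF sa assms(5,6,7,8) test])
    have FL: "F n \<in> L2" for n
      unfolding F_def by (rule localization(2)[OF sa assms(5,6,7,8) test])
    have Tf: "ae_eq (?T (f n)) (\<lambda>x. \<mu> *s f n x + (- \<i>) *s F n x)" for n
      unfolding f_def F_def by (rule localization(3)[OF sa assms(5,6,7,8) test])
    have fL: "f n \<in> L2" for n by (rule od(1)[OF fD])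
    define u where "u n = cls (f n)" for n
    have resid: "norm (op_cls ?T (u n) - l *\<^sub>R u n) \<le> \<gamma> * \<delta> * norm (u n) + 2 * \<gamma> * norm (cls \<psi>)" for n
    proof -
      have "op_cls ?T (u n) = cls (\<lambda>x. \<mu> *s f n x + (- \<i>) *s F n x)"
        unfolding u_def oc(2)[OF fD] using Tf cls_eq_iff[OF od(6)[OF fD] L2_add[OF L2_smult[OF fL] L2_smult[OF FL]]]
        by blast
      also have "\<dots> = cls (\<lambda>x. l *\<^sub>R f n x) + cls (\<lambda>x. (- \<i>) *s F n x)"
        unfolding \<mu> scaleR_eq_smult by (rule cls_add[OF L2_smult[OF fL] L2_smult[OF FL], symmetric])
      finally have "op_cls ?T (u n) - l *\<^sub>R u n = cls (\<lambda>x. (- \<i>) *s F n x)"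
        by (simp add: u_def cls_scaleR[OF fL])
      also have "norm \<dots> \<le> norm (cls (\<lambda>x. (\<gamma> * \<delta>) *\<^sub>R f n x + (2 * \<gamma>) *\<^sub>R \<psi> x))"
      proof (rule norm_cls_mono[OF L2_smult[OF FL] L2_add[OF L2_scaleR[OF fL] L2_scaleR[OF \<psi>L]]], rule AE_I2)
        fix x
        have "norm ((- \<i>) *s F n x) = norm (F n x)" unfolding norm_vector_smult by simp
        also have "\<dots> \<le> \<gamma> * norm (\<chi> j. partial_deriv j (w n) x) * norm (\<psi> x)"
          using norm_symbol_le[of "\<chi> j. partial_deriv j (w n) x" A "\<psi> x"] by (simp add: F_def \<gamma>_def)
        also have "\<dots> \<le> \<gamma> * (\<delta> * w n x + 2) * norm (\<psi> x)"
          unfolding w_def using \<gamma> 3(1)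
          by (intro mult_right_mono mult_left_mono norm_gradient_weight_le) auto
        also have "\<dots> = norm ((\<gamma> * (\<delta> * w n x + 2)) *\<^sub>R \<psi> x)"
          using \<gamma> 3(1) w0[of n x] by simp
        also have "(\<gamma> * (\<delta> * w n x + 2)) *\<^sub>R \<psi> x = (\<gamma> * \<delta>) *\<^sub>R f n x + (2 * \<gamma>) *\<^sub>R \<psi> x"
          by (simp add: f_def algebra_simps)
        finally show "norm ((- \<i>) *s F n x) \<le> norm ((\<gamma> * \<delta>) *\<^sub>R f n x + (2 * \<gamma>) *\<^sub>R \<psi> x)" .
      qed
      also have "cls (\<lambda>x. (\<gamma> * \<delta>) *\<^sub>R f n x + (2 * \<gamma>) *\<^sub>R \<psi> x) = (\<gamma> * \<delta>) *\<^sub>R u n + (2 * \<gamma>) *\<^sub>R cls \<psi>"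
        by (simp add: u_def cls_add cls_scaleR L2_scaleR fL \<psi>L)
      also have "norm \<dots> \<le> norm ((\<gamma> * \<delta>) *\<^sub>R u n) + norm ((2 * \<gamma>) *\<^sub>R cls \<psi>)" by (rule norm_triangle_ineq)
      also have "\<dots> = \<gamma> * \<delta> * norm (u n) + 2 * \<gamma> * norm (cls \<psi>)" using \<gamma> 3(1) by simp
      finally show ?thesis .
    qed
    \<comment> \<open>With this choice the small multiples of \<open>\<parallel>u\<parallel>\<close> use up at most half of \<open>d - \<gamma> \<delta>\<close>; the summand \<open>1\<close> only keeps the denominator positive.\<close>
    define \<epsilon> where "\<epsilon> = (d - \<gamma> * \<delta>) / (2 * (K * real (card C) + 1))"
    have den: "K * real (card C) + 1 > 0" using C(2) by (simp add: add_nonneg_pos)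
    have \<epsilon>: "\<epsilon> > 0" using d(1) den by (simp add: \<epsilon>_def)
    have "\<exists>k. \<forall>f\<in>L2. (\<forall>x. norm (f x) \<le> exp (\<delta> * bracket x) * norm (\<psi> x))
        \<longrightarrow> \<bar>c \<bullet> cls f\<bar> \<le> \<epsilon> * norm (cls f) + k" for c :: "('d, 'n) l2"
      using pairing_bound[OF \<psi>L \<epsilon>, of \<delta> c] 3(1) by (metis less_imp_le)
    then obtain k where k: "\<And>c :: ('d, 'n) l2. \<forall>f\<in>L2. (\<forall>x. norm (f x) \<le> exp (\<delta> * bracket x) * norm (\<psi> x))
        \<longrightarrow> \<bar>c \<bullet> cls f\<bar> \<le> \<epsilon> * norm (cls f) + k c" by metis
    have pair: "\<bar>c \<bullet> u n\<bar> \<le> \<epsilon> * norm (u n) + k c" for c n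
    proof -
      have "norm (f n x) \<le> exp (\<delta> * bracket x) * norm (\<psi> x)" for x
        using w0[of n x] w_le[of n x] by (simp add: f_def mult_right_mono)
      then show ?thesis using k[of c] fL[of n] by (simp add: u_def)
    qed
    define R where "R = 2 * (2 * \<gamma> * norm (cls \<psi>) + K * sum k C) / (d - \<gamma> * \<delta>)"
    have bound: "norm (u n) \<le> R" for n
    proof -
      have "d * norm (u n) \<le> norm (op_cls ?T (u n) - l *\<^sub>R u n) + K * (\<Sum>c\<in>C. \<bar>c \<bullet> u n\<bar>)"
        unfolding u_def by (rule coer[OF oc(1)[OF fD]])
      also have "\<dots> \<le> (\<gamma> * \<delta> * norm (u n) + 2 * \<gamma> * norm (cls \<psi>)) + K * (\<Sum>c\<in>C. \<epsilon> * norm (u n) + k c)"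
        using C(2) by (intro add_mono resid mult_left_mono sum_mono pair)
      also have "\<dots> = \<gamma> * \<delta> * norm (u n) + 2 * \<gamma> * norm (cls \<psi>) + K * sum k C
          + (K * real (card C)) * \<epsilon> * norm (u n)"
        by (simp add: sum.distrib algebra_simps)
      also have "(K * real (card C)) * \<epsilon> * norm (u n) \<le> ((d - \<gamma> * \<delta>) / 2) * norm (u n)"
      proof (rule mult_right_mono)
        have "(K * real (card C)) * \<epsilon> \<le> (K * real (card C) + 1) * \<epsilon>" using \<epsilon> by simp
        also have "\<dots> = (d - \<gamma> * \<delta>) / 2" using den by (simp add: \<epsilon>_def field_simps)
        finally show "(K * real (card C)) * \<epsilon> \<le> (d - \<gamma> * \<delta>) / 2" .
      qed simp
      finally have "(d - \<gamma> * \<delta>) * norm (u n) \<le> 2 * (2 * \<gamma> * norm (cls \<psi>) + K * sum k C)"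
        by (simp add: field_simps)
      then show ?thesis using d(1) by (simp add: R_def field_simps)
    qed
    have nn_f: "(\<integral>\<^sup>+x. ennreal ((norm (f n x))\<^sup>2) \<partial>lebesgue) \<le> ennreal (R\<^sup>2)" for n
    proof -
      have "(\<integral>\<^sup>+x. ennreal ((norm (f n x))\<^sup>2) \<partial>lebesgue) = ennreal (\<integral>x. (norm (f n x))\<^sup>2 \<partial>lebesgue)"
        by (rule nn_integral_eq_integral[OF L2D2[OF fL]]) simp
      also have "(\<integral>x. (norm (f n x))\<^sup>2 \<partial>lebesgue) = (norm (u n))\<^sup>2"
        by (simp add: u_def norm_cls fL L2_norm_def)
      also have "ennreal \<dots> \<le> ennreal (R\<^sup>2)" using bound[of n] by (intro ennreal_leI power_mono) auto
      finally show ?thesis .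
    qed
    have "(\<integral>\<^sup>+x. ennreal ((norm (\<psi> x))\<^sup>2 * exp (2 * \<delta> * norm x)) \<partial>lebesgue)
        \<le> (\<integral>\<^sup>+x. liminf (\<lambda>n. ennreal ((norm (f n x))\<^sup>2)) \<partial>lebesgue)"
    proof (rule nn_integral_mono)
      fix x :: "real ^ 'd"
      have "(\<lambda>n. w n x) \<longlonglongrightarrow> exp (\<delta> * bracket x)"
        unfolding w_def weight_def using bracket_ge_1[of x] 3(1) by (intro profile_tendsto) auto
      then have "(\<lambda>n. ennreal ((norm (f n x))\<^sup>2)) \<longlonglongrightarrow> ennreal ((norm (exp (\<delta> * bracket x) *\<^sub>R \<psi> x))\<^sup>2)"
        unfolding f_def by (intro tendsto_intros)
      then have lim: "liminf (\<lambda>n. ennreal ((norm (f n x))\<^sup>2)) = ennreal ((norm (exp (\<delta> * bracket x) *\<^sub>R \<psi> x))\<^sup>2)"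
        by (rule lim_imp_Liminf[OF trivial_limit_sequentially])
      have "exp (2 * \<delta> * norm x) = (exp (\<delta> * norm x))\<^sup>2" by (simp add: power2_eq_square flip: exp_add)
      also have "\<dots> \<le> (exp (\<delta> * bracket x))\<^sup>2"
        using norm_le_bracket[of x] 3(1) by (intro power_mono) (auto intro: mult_left_mono)
      finally have "exp (2 * \<delta> * norm x) \<le> (exp (\<delta> * bracket x))\<^sup>2" .
      then have "(norm (\<psi> x))\<^sup>2 * exp (2 * \<delta> * norm x) \<le> (norm (exp (\<delta> * bracket x) *\<^sub>R \<psi> x))\<^sup>2"
        by (simp add: power_mult_distrib mult_left_mono mult.commute)
      then show "ennreal ((norm (\<psi> x))\<^sup>2 * exp (2 * \<delta> * norm x)) \<le> liminf (\<lambda>n. ennreal ((norm (f n x))\<^sup>2))"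
        unfolding lim by (rule ennreal_leI)
    qed
    also have "\<dots> \<le> liminf (\<lambda>n. \<integral>\<^sup>+x. ennreal ((norm (f n x))\<^sup>2) \<partial>lebesgue)"
    proof (rule nn_integral_liminf)
      fix n
      have [measurable]: "f n \<in> borel_measurable lebesgue" by (rule L2D[OF fL])
      show "(\<lambda>x. ennreal ((norm (f n x))\<^sup>2)) \<in> borel_measurable lebesgue" by measurable
    qed
    also have "\<dots> \<le> ennreal (R\<^sup>2)"
      by (rule Liminf_le) (auto simp: nn_f)
    also have "\<dots> < \<infinity>" by simp
    finally show ?thesis .
  qed
qed

end
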